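(* Let $\Gamma$ be a finite graph. If $Z(A_\Gamma)=\{1\}$ and $c \geq 1$, then the group $H_c/H_{c+1}$ is torsion-free.
   Context: $\Gamma$ is a finite simple graph; $A_\Gamma$ is the group generated by the vertices of $\Gamma$ with relations $[v,w]=1$ for $v,w$ adjacent; $Z(A_\Gamma)$ is its centre. Let $\gamma_1=A_\Gamma$, $\gamma_{c+1}=[\gamma_c,A_\Gamma]$ be the lower central series. For $c\ge0$, $G_c$ is the kernel of the natural map $\mathrm{Aut}(A_\Gamma)\to\mathrm{Aut}(A_\Gamma/\gamma_{c+1})$, and $H_c$ is the image of $G_c$ in $\mathrm{Out}(A_\Gamma)$. ($H_1,H_2,\dots$ is a decreasing sequence of normal subgroups of $\mathrm{Out}(A_\Gamma)$, and $H_c/H_{c+1}$ is abelian for $c\ge1$.) *)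

theory Defs
  imports "HOL-Algebra.Bij" "HOL-Algebra.Generated_Groups" "Graph_Theory.Digraph"
begin

section \<open>Group presentations\<close>

text \<open>The letter \<open>(a, True)\<close> stands for the generator \<open>a\<close> and \<open>(a, False)\<close> for its formal inverse.\<close>

type_synonym 'a word = "('a \<times> bool) list"

definition words :: "'a set \<Rightarrow> 'a word set" where
  "words S = lists (S \<times> UNIV)"

text \<open>The congruence on words over \<open>S\<close> generated by free cancellation and by \<open>r = 1\<close>
  for \<open>r \<in> R\<close>.\<close>

inductive_set pres_rel :: "'a set \<Rightarrow> 'a word set \<Rightarrow> ('a word \<times> 'a word) set"
  for S :: "'a set" and R :: "'a word set" where
  refl: "u \<in> words S \<Longrightarrow> (u, u) \<in> pres_rel S R"
| sym: "(u, v) \<in> pres_rel S R \<Longrightarrow> (v, u) \<in> pres_rel S R"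
| trans: "(u, v) \<in> pres_rel S R \<Longrightarrow> (v, w) \<in> pres_rel S R \<Longrightarrow> (u, w) \<in> pres_rel S R"
| cancel: "u \<in> words S \<Longrightarrow> v \<in> words S \<Longrightarrow> a \<in> S \<Longrightarrow>
    (u @ [(a, b), (a, \<not> b)] @ v, u @ v) \<in> pres_rel S R"
| relator: "u \<in> words S \<Longrightarrow> v \<in> words S \<Longrightarrow> r \<in> R \<Longrightarrow> (u @ r @ v, u @ v) \<in> pres_rel S R"

definition presented_group :: "'a set \<Rightarrow> 'a word set \<Rightarrow> 'a word set monoid" where
  "presented_group S R =
    \<lparr>carrier = words S // pres_rel S R,
     mult = (\<lambda>X Y. \<Union>x\<in>X. \<Union>y\<in>Y. pres_rel S R `` {x @ y}),
     one = pres_rel S R `` {[]}\<rparr>"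

definition comm_word :: "'a \<Rightarrow> 'a \<Rightarrow> 'a word" where
  "comm_word v w = [(v, True), (w, True), (v, False), (w, False)]"

definition raag :: "('a, 'b) pre_digraph \<Rightarrow> 'a word set monoid" where
  "raag \<Gamma> = presented_group (verts \<Gamma>) {comm_word v w | v w. (v, w) \<in> arcs_ends \<Gamma>}"


section \<open>Centre, lower central series, torsion\<close>

definition centre :: "('a, 'b) monoid_scheme \<Rightarrow> 'a set" where
  "centre G = {z \<in> carrier G. \<forall>x\<in>carrier G. z \<otimes>\<^bsub>G\<^esub> x = x \<otimes>\<^bsub>G\<^esub> z}"

definition comm_subgroup :: "('a, 'b) monoid_scheme \<Rightarrow> 'a set \<Rightarrow> 'a set \<Rightarrow> 'a set" where
  "comm_subgroup G H K =
    generate G (\<Union>h\<in>H. \<Union>k\<in>K. {h \<otimes>\<^bsub>G\<^esub> k \<otimes>\<^bsub>G\<^esub> inv\<^bsub>G\<^esub> h \<otimes>\<^bsub>G\<^esub> inv\<^bsub>G\<^esub> k})"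

text \<open>Indexed from 1 as is customary; the value at 0 is a dummy.\<close>

fun lower_central :: "('a, 'b) monoid_scheme \<Rightarrow> nat \<Rightarrow> 'a set" where
  "lower_central G 0 = carrier G"
| "lower_central G (Suc 0) = carrier G"
| "lower_central G (Suc (Suc c)) = comm_subgroup G (lower_central G (Suc c)) (carrier G)"

definition torsion_free :: "('a, 'b) monoid_scheme \<Rightarrow> bool" where
  "torsion_free G \<longleftrightarrow>
    (\<forall>x\<in>carrier G. \<forall>n::nat. n > 0 \<longrightarrow> x [^]\<^bsub>G\<^esub> n = \<one>\<^bsub>G\<^esub> \<longrightarrow> x = \<one>\<^bsub>G\<^esub>)"


section \<open>Inner and outer automorphisms\<close>

definition conj_auto :: "('a, 'b) monoid_scheme \<Rightarrow> 'a \<Rightarrow> 'a \<Rightarrow> 'a" where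
  "conj_auto G g = (\<lambda>x\<in>carrier G. g \<otimes>\<^bsub>G\<^esub> x \<otimes>\<^bsub>G\<^esub> inv\<^bsub>G\<^esub> g)"

definition Inn :: "('a, 'b) monoid_scheme \<Rightarrow> ('a \<Rightarrow> 'a) set" where
  "Inn G = conj_auto G ` carrier G"

definition OutGroup :: "('a, 'b) monoid_scheme \<Rightarrow> ('a \<Rightarrow> 'a) set monoid" where
  "OutGroup G = AutoGroup G Mod Inn G"

definition to_Out :: "('a, 'b) monoid_scheme \<Rightarrow> ('a \<Rightarrow> 'a) \<Rightarrow> ('a \<Rightarrow> 'a) set" where
  "to_Out G \<phi> = Inn G #>\<^bsub>AutoGroup G\<^esub> \<phi>"

text \<open>For a characteristic subgroup \<open>N\<close>, the automorphism of \<open>G / N\<close> induced by one of \<open>G\<close>;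
  it sends the coset \<open>xN\<close> to its image \<open>\<phi>(x)N\<close>.\<close>

definition induced_auto :: "('a, 'b) monoid_scheme \<Rightarrow> 'a set \<Rightarrow> ('a \<Rightarrow> 'a) \<Rightarrow> 'a set \<Rightarrow> 'a set" where
  "induced_auto G N \<phi> = (\<lambda>X\<in>carrier (G Mod N). \<phi> ` X)"

text \<open>\<open>aut_filt G c\<close> is \<open>G\<^sub>c\<close>, the kernel of the action on \<open>G / \<gamma>\<^sub>c\<^sub>+\<^sub>1\<close>; its image \<open>out_filt G c\<close>
  in the outer automorphism group is \<open>H\<^sub>c\<close>, and \<open>out_filt_quot G c\<close> is \<open>H\<^sub>c / H\<^sub>c\<^sub>+\<^sub>1\<close>.\<close>

definition aut_filt :: "('a, 'b) monoid_scheme \<Rightarrow> nat \<Rightarrow> ('a \<Rightarrow> 'a) set" where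
  "aut_filt G c =
    kernel (AutoGroup G) (AutoGroup (G Mod lower_central G (Suc c)))
      (induced_auto G (lower_central G (Suc c)))"

definition out_filt :: "('a, 'b) monoid_scheme \<Rightarrow> nat \<Rightarrow> ('a \<Rightarrow> 'a) set set" where
  "out_filt G c = to_Out G ` aut_filt G c"

definition out_filt_quot :: "('a, 'b) monoid_scheme \<Rightarrow> nat \<Rightarrow> ('a \<Rightarrow> 'a) set set monoid" where
  "out_filt_quot G c = (OutGroup G \<lparr>carrier := out_filt G c\<rparr>) Mod out_filt G (Suc c)"


section \<open>Well-definedness\<close>

text \<open>The presented group is a group with the expected universal property; the subgroups divided
  out above are normal, so that all the quotients are groups.\<close>

lemma words_simps [simp]:
  "[] \<in> words S" "x # u \<in> words S \<longleftrightarrow> fst x \<in> S \<and> u \<in> words S"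
  "u @ v \<in> words S \<longleftrightarrow> u \<in> words S \<and> v \<in> words S"
  by (cases x; auto simp: words_def)+

lemma pres_rel_words:
  assumes "(u, v) \<in> pres_rel S R" "R \<subseteq> words S"
  shows "u \<in> words S" "v \<in> words S"
  using assms by induct auto

lemma equiv_pres_rel:
  assumes "R \<subseteq> words S"
  shows "equiv (words S) (pres_rel S R)"
proof (rule equivI)
  show "pres_rel S R \<subseteq> words S \<times> words S"
    using pres_rel_words[OF _ assms] by auto
  show "refl_on (words S) (pres_rel S R)"
    by (auto simp: refl_on_def intro: pres_rel.refl)
  show "sym (pres_rel S R)" by (auto simp: sym_def intro: pres_rel.sym)
  show "trans (pres_rel S R)" by (auto simp: trans_def intro: pres_rel.trans)
qed

lemma pres_rel_context:
  assumes "(u, v) \<in> pres_rel S R" "p \<in> words S" "q \<in> words S"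
  shows "(p @ u @ q, p @ v @ q) \<in> pres_rel S R"
  using assms
proof induct
  case (cancel u v a b)
  then show ?case using pres_rel.cancel[of "p @ u" S "v @ q" a b R] by simp
next
  case (relator u v r)
  then show ?case using pres_rel.relator[of "p @ u" S "v @ q" r R] by simp
qed (auto intro: pres_rel.intros)

lemma pres_rel_append:
  assumes "(u, u') \<in> pres_rel S R" "(v, v') \<in> pres_rel S R" "R \<subseteq> words S"
  shows "(u @ v, u' @ v') \<in> pres_rel S R"
proof -
  note w = pres_rel_words[OF assms(1,3)] pres_rel_words[OF assms(2,3)]
  have "(u @ v, u' @ v) \<in> pres_rel S R"
    using pres_rel_context[OF assms(1), of "[]" v] w by simp
  moreover have "(u' @ v, u' @ v') \<in> pres_rel S R"
    using pres_rel_context[OF assms(2), of u' "[]"] w by simp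
  ultimately show ?thesis by (rule pres_rel.trans)
qed

lemma presented_mult:
  assumes "u \<in> words S" "v \<in> words S" "R \<subseteq> words S"
  shows "pres_rel S R `` {u} \<otimes>\<^bsub>presented_group S R\<^esub> pres_rel S R `` {v} = pres_rel S R `` {u @ v}"
proof -
  have "pres_rel S R `` {x @ y} = pres_rel S R `` {u @ v}"
    if "x \<in> pres_rel S R `` {u}" "y \<in> pres_rel S R `` {v}" for x y
    using that pres_rel_append[of u x S R v y] assms(3) equiv_class_eq[OF equiv_pres_rel[OF assms(3)]]
    by (metis Image_singleton_iff)
  moreover have "u \<in> pres_rel S R `` {u}" "v \<in> pres_rel S R `` {v}"
    using assms by (auto intro: pres_rel.refl)
  ultimately have "(\<Union>x\<in>pres_rel S R `` {u}. \<Union>y\<in>pres_rel S R `` {v}. pres_rel S R `` {x @ y})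
     = pres_rel S R `` {u @ v}" by blast
  then show ?thesis by (simp add: presented_group_def)
qed

lemma inverse_word:
  assumes "u \<in> words S"
  shows "\<exists>v\<in>words S. (v @ u, []) \<in> pres_rel S R"
  using assms
proof (induct u)
  case Nil then show ?case by (auto intro!: bexI[of _ "[]"] pres_rel.refl)
next
  case (Cons x u)
  obtain a b where x: "x = (a, b)" by (cases x)
  from Cons obtain v where v: "v \<in> words S" "(v @ u, []) \<in> pres_rel S R" by auto
  have "(v @ [(a, \<not> b), (a, \<not> \<not> b)] @ u, v @ u) \<in> pres_rel S R"
    using Cons v x by (intro pres_rel.cancel) auto
  then have "((v @ [(a, \<not> b)]) @ x # u, []) \<in> pres_rel S R"
    using v x pres_rel.trans by fastforce
  then show ?case using v x Cons by (intro bexI[of _ "v @ [(a, \<not> b)]"]) auto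
qed

lemma group_presented_group:
  assumes "R \<subseteq> words S"
  shows "group (presented_group S R)"
proof -
  let ?G = "presented_group S R" and ?c = "\<lambda>u. pres_rel S R `` {u}"
  have C: "carrier ?G = ?c ` words S"
    by (auto simp: presented_group_def quotient_def)
  have I: "\<one>\<^bsub>?G\<^esub> = ?c []" by (simp add: presented_group_def)
  note M = presented_mult[OF _ _ assms]
  show ?thesis
  proof (rule groupI)
    fix x assume "x \<in> carrier ?G"
    then obtain u where u: "u \<in> words S" "x = ?c u" using C by auto
    then obtain v where v: "v \<in> words S" "(v @ u, []) \<in> pres_rel S R"
      using inverse_word by metis
    have "?c v \<otimes>\<^bsub>?G\<^esub> x = \<one>\<^bsub>?G\<^esub>"
      using u v M I equiv_class_eq[OF equiv_pres_rel[OF assms] v(2)] by simp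
    then show "\<exists>y\<in>carrier ?G. y \<otimes>\<^bsub>?G\<^esub> x = \<one>\<^bsub>?G\<^esub>" using v C by auto
  qed (auto simp: C I M)
qed

lemma (in wf_digraph) group_raag: "group (raag G)"
  unfolding raag_def
  by (rule group_presented_group) (auto simp: comm_word_def adj_in_verts)

text \<open>The universal property: a map on generators whose extension to words kills the relators
  extends to a homomorphism.\<close>

lemma presented_universal:
  assumes R: "R \<subseteq> words S" and K: "group K" and f: "f \<in> S \<rightarrow> carrier K"
  and rel: "\<And>r. r \<in> R \<Longrightarrow> foldr (\<lambda>(a,b) y. (if b then f a else inv\<^bsub>K\<^esub> f a) \<otimes>\<^bsub>K\<^esub> y) r \<one>\<^bsub>K\<^esub> = \<one>\<^bsub>K\<^esub>"
  shows "\<exists>h \<in> hom (presented_group S R) K. \<forall>a\<in>S. h (pres_rel S R `` {[(a,True)]}) = f a"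
proof -
  interpret K: group K by fact
  define e where "e = (\<lambda>r. foldr (\<lambda>(a,b) y. (if b then f a else inv\<^bsub>K\<^esub> f a) \<otimes>\<^bsub>K\<^esub> y) r \<one>\<^bsub>K\<^esub>)"
  have ec: "e u \<in> carrier K" if "u \<in> words S" for u
    using that f by (induct u) (auto simp: e_def Pi_iff)
  have ea: "e (u @ v) = e u \<otimes>\<^bsub>K\<^esub> e v" if "u \<in> words S" "v \<in> words S" for u v
    using that(1)
  proof (induct u)
    case Nil then show ?case using ec[OF that(2)] by (simp add: e_def)
  next
    case (Cons x u)
    then show ?case using ec[OF that(2)] ec[of u] f
      by (cases x) (auto simp: e_def K.m_assoc Pi_iff)
  qed
  have eq: "e u = e v" if "(u,v) \<in> pres_rel S R" for u v
    using that
  proof induct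
    case (cancel u v a b)
    have "f a \<in> carrier K" using f cancel by auto
    then have "e [(a, b), (a, \<not> b)] = \<one>\<^bsub>K\<^esub>" by (simp add: e_def)
    then show ?case using cancel ec[of u] ec[of v] by (simp add: ea del: append_Cons append_Nil)
  next
    case (relator u v r)
    have "e r = \<one>\<^bsub>K\<^esub>" "r \<in> words S" using rel relator R by (auto simp: e_def)
    then show ?case using relator ec[of u] ec[of v] by (simp add: ea)
  qed auto
  define h where "h = (\<lambda>A. e (SOME u. u \<in> A))"
  have h: "h (pres_rel S R `` {u}) = e u" if "u \<in> words S" for u
  proof -
    have "u \<in> pres_rel S R `` {u}" using that by (auto intro: pres_rel.refl)
    then have "(SOME w. w \<in> pres_rel S R `` {u}) \<in> pres_rel S R `` {u}" by (rule someI)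
    then show ?thesis unfolding h_def using eq by force
  qed
  have C: "carrier (presented_group S R) = (\<lambda>u. pres_rel S R `` {u}) ` words S"
    by (auto simp: presented_group_def quotient_def)
  have "h \<in> hom (presented_group S R) K"
    by (rule homI) (auto simp: C h ec ea presented_mult[OF _ _ R])
  moreover have "h (pres_rel S R `` {[(a,True)]}) = f a" if "a \<in> S" for a
    using that f by (subst h) (auto simp: e_def Pi_iff)
  ultimately show ?thesis by blast
qed

lemma auto_group_hom:
  assumes "group G" "\<phi> \<in> auto G"
  shows "group_hom G G \<phi>"
  using assms by (auto simp: group_hom_def group_hom_axioms_def auto_def)

lemma auto_img_carrier: "\<phi> \<in> auto G \<Longrightarrow> \<phi> ` carrier G = carrier G"
  by (auto simp: auto_def Bij_def bij_betw_def)

lemma (in group) comm_subgroup_normal: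
  assumes "H \<lhd> G"
  shows "comm_subgroup G H (carrier G) \<lhd> G"
  unfolding comm_subgroup_def
proof (rule normal_generateI)
  interpret H: normal H G by fact
  show "(\<Union>h\<in>H. \<Union>k\<in>carrier G. {h \<otimes> k \<otimes> inv h \<otimes> inv k}) \<subseteq> carrier G" by auto
  fix x g assume "x \<in> (\<Union>h\<in>H. \<Union>k\<in>carrier G. {h \<otimes> k \<otimes> inv h \<otimes> inv k})" and g: "g \<in> carrier G"
  then obtain h k where h: "h \<in> H" "k \<in> carrier G" "x = h \<otimes> k \<otimes> inv h \<otimes> inv k" by auto
  let ?h = "g \<otimes> h \<otimes> inv g" and ?k = "g \<otimes> k \<otimes> inv g"
  have hc: "h \<in> carrier G" using h by auto
  have "?h \<in> H" "?k \<in> carrier G" using h g H.inv_op_closed2 by auto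
  moreover have "g \<otimes> x \<otimes> inv g = ?h \<otimes> ?k \<otimes> inv ?h \<otimes> inv ?k"
  proof -
    have i: "inv g \<otimes> (g \<otimes> y) = y" if "y \<in> carrier G" for y
      using that g by (simp flip: m_assoc)
    show ?thesis using h(2) hc g unfolding h(3) by (simp add: m_assoc inv_mult_group i)
  qed
  ultimately show "g \<otimes> x \<otimes> inv g \<in> (\<Union>h\<in>H. \<Union>k\<in>carrier G. {h \<otimes> k \<otimes> inv h \<otimes> inv k})"
    by blast
qed

lemma (in group) lower_central_normal: "lower_central G c \<lhd> G"
proof (induct c rule: induct_nat_012)
  case 0 then show ?case by (simp add: normal_self)
next
  case 1 then show ?case by (simp add: normal_self)
next
  case (ge2 n) then show ?case using comm_subgroup_normal by simp
qed

lemma (in group) lower_central_char: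
  assumes "\<phi> \<in> auto G" shows "\<phi> ` lower_central G c = lower_central G c"
proof (induct c rule: induct_nat_012)
  case 0 then show ?case by (simp add: assms auto_img_carrier)
next
  case 1 then show ?case by (simp add: assms auto_img_carrier)
next
  case (ge2 n)
  interpret p: group_hom G G \<phi> using auto_group_hom[OF group_axioms assms] .
  let ?N = "lower_central G (Suc n)"
  let ?K = "\<Union>h\<in>?N. \<Union>k\<in>carrier G. {h \<otimes> k \<otimes> inv h \<otimes> inv k}"
  have sub: "?N \<subseteq> carrier G" using lower_central_normal normal_imp_subgroup subgroup.subset by blast
  have K: "?K \<subseteq> carrier G" using sub by auto
  have "\<phi> ` ?K = (\<Union>h\<in>?N. \<Union>k\<in>carrier G. {\<phi> h \<otimes> \<phi> k \<otimes> inv \<phi> h \<otimes> inv \<phi> k})"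
    using sub by (auto simp: image_UN subset_iff intro!: SUP_cong)
  also have "\<dots> = (\<Union>h\<in>\<phi> ` ?N. \<Union>k\<in>\<phi> ` carrier G. {h \<otimes> k \<otimes> inv h \<otimes> inv k})" by simp
  also have "\<dots> = ?K" by (simp only: ge2 auto_img_carrier[OF assms])
  finally have "\<phi> ` ?K = ?K" .
  then show ?case using p.generate_img[OF K] by (simp add: comm_subgroup_def)
qed

lemma (in group) lower_central_decseq: "lower_central G (Suc c) \<subseteq> lower_central G c"
proof (cases c)
  case (Suc n)
  interpret N: normal "lower_central G (Suc n)" G by (rule lower_central_normal)
  have "(\<Union>h\<in>lower_central G (Suc n). \<Union>k\<in>carrier G. {h \<otimes> k \<otimes> inv h \<otimes> inv k}) \<subseteq> lower_central G (Suc n)"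
  proof clarify
    fix h k assume h: "h \<in> lower_central G (Suc n)" "k \<in> carrier G"
    then have "k \<otimes> inv h \<otimes> inv k \<in> lower_central G (Suc n)" by (simp add: N.inv_op_closed2)
    then have "h \<otimes> (k \<otimes> inv h \<otimes> inv k) \<in> lower_central G (Suc n)" using h by blast
    then show "h \<otimes> k \<otimes> inv h \<otimes> inv k \<in> lower_central G (Suc n)" using h by (simp add: m_assoc)
  qed
  then show ?thesis using Suc generate_subgroup_incl[OF _ N.subgroup_axioms]
    by (simp add: comm_subgroup_def)
qed simp

lemma AutoGroup_simps:
  "carrier (AutoGroup G) = auto G" "\<one>\<^bsub>AutoGroup G\<^esub> = (\<lambda>x\<in>carrier G. x)"
  "\<phi> \<in> auto G \<Longrightarrow> \<psi> \<in> auto G \<Longrightarrow> \<phi> \<otimes>\<^bsub>AutoGroup G\<^esub> \<psi> = compose (carrier G) \<phi> \<psi>"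
  by (auto simp: AutoGroup_def BijGroup_def auto_def)

lemma (in group) img_coset:
  assumes "\<phi> \<in> auto G" "N \<subseteq> carrier G" "\<phi> ` N = N" "x \<in> carrier G"
  shows "\<phi> ` (N #> x) = N #> \<phi> x"
proof -
  interpret p: group_hom G G \<phi> using auto_group_hom[OF group_axioms assms(1)] .
  have "\<phi> ` (N #> x) = \<phi> ` N #> \<phi> x" using assms(2,4)
    by (auto simp: r_coset_def image_UN subset_iff intro!: SUP_cong)
  then show ?thesis using assms by simp
qed

lemma (in group) induced_auto_mem:
  assumes "N \<lhd> G" "\<And>\<phi>. \<phi> \<in> auto G \<Longrightarrow> \<phi> ` N = N" "\<phi> \<in> auto G"
  shows "induced_auto G N \<phi> \<in> auto (G Mod N)"
proof -
  interpret N: normal N G by fact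
  interpret p: group_hom G G \<phi> using auto_group_hom[OF group_axioms assms(3)] .
  have I: "\<phi> ` (N #> x) = N #> \<phi> x" if "x \<in> carrier G" for x
    using img_coset[OF assms(3) N.subset assms(2)[OF assms(3)] that] .
  have inj: "inj_on \<phi> (carrier G)" using assms(3) by (auto simp: auto_def Bij_def bij_betw_def)
  have bij: "bij_betw ((`) \<phi>) (carrier (G Mod N)) (carrier (G Mod N))"
    unfolding bij_betw_def
  proof
    have "\<Union> (carrier (G Mod N)) \<subseteq> carrier G" by (auto simp: carrier_FactGroup r_coset_def)
    then show "inj_on ((`) \<phi>) (carrier (G Mod N))"
      using inj by (metis (no_types, lifting) Sup_le_iff inj_onI inj_on_image_eq_iff)
    have "(`) \<phi> ` carrier (G Mod N) = (\<lambda>x. N #> x) ` (\<phi> ` carrier G)"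
      by (auto simp: carrier_FactGroup image_image I cong: image_cong)
    then show "(`) \<phi> ` carrier (G Mod N) = carrier (G Mod N)"
      by (simp add: auto_img_carrier[OF assms(3)] carrier_FactGroup)
  qed
  have "induced_auto G N \<phi> \<in> hom (G Mod N) (G Mod N)"
  proof (rule homI)
    fix X Y assume XY: "X \<in> carrier (G Mod N)" "Y \<in> carrier (G Mod N)"
    then obtain x y where xy: "x \<in> carrier G" "y \<in> carrier G" "X = N #> x" "Y = N #> y"
      by (auto simp: carrier_FactGroup)
    moreover have "N #> (x \<otimes> y) \<in> carrier (G Mod N)" using xy by (auto simp: carrier_FactGroup)
    ultimately show "induced_auto G N \<phi> (X \<otimes>\<^bsub>G Mod N\<^esub> Y) =
      induced_auto G N \<phi> X \<otimes>\<^bsub>G Mod N\<^esub> induced_auto G N \<phi> Y"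
      using XY by (simp add: induced_auto_def N.rcos_sum I)
  qed (use bij in \<open>auto simp: induced_auto_def bij_betw_def\<close>)
  then show ?thesis using bij by (auto simp: auto_def Bij_def induced_auto_def)
qed

lemma (in group) induced_auto_hom:
  assumes "N \<lhd> G" "\<And>\<phi>. \<phi> \<in> auto G \<Longrightarrow> \<phi> ` N = N"
  shows "group_hom (AutoGroup G) (AutoGroup (G Mod N)) (induced_auto G N)"
proof -
  interpret N: normal N G by fact
  interpret Q: group "G Mod N" by (rule N.factorgroup_is_group)
  have mem: "induced_auto G N \<phi> \<in> auto (G Mod N)" if "\<phi> \<in> auto G" for \<phi>
    using induced_auto_mem[OF assms that] .
  have "induced_auto G N \<in> hom (AutoGroup G) (AutoGroup (G Mod N))"
  proof (rule homI)
    fix \<phi> \<psi> assume "\<phi> \<in> carrier (AutoGroup G)" "\<psi> \<in> carrier (AutoGroup G)"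
    then have a: "\<phi> \<in> auto G" "\<psi> \<in> auto G" by (simp_all add: AutoGroup_simps)
    have c: "\<psi> ` A \<in> carrier (G Mod N)" if "A \<in> carrier (G Mod N)" for A
      using mem[OF a(2)] that by (auto simp: auto_def hom_def induced_auto_def Pi_iff)
    have s: "A \<subseteq> carrier G" if "A \<in> carrier (G Mod N)" for A
      using that by (auto simp: carrier_FactGroup r_coset_def)
    have "compose (carrier G) \<phi> \<psi> ` A = \<phi> ` \<psi> ` A" if "A \<in> carrier (G Mod N)" for A
      using s[OF that] by (auto simp: compose_def image_image subset_iff intro!: image_cong)
    then show "induced_auto G N (\<phi> \<otimes>\<^bsub>AutoGroup G\<^esub> \<psi>) =
      induced_auto G N \<phi> \<otimes>\<^bsub>AutoGroup (G Mod N)\<^esub> induced_auto G N \<psi>"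
      using c by (simp add: AutoGroup_simps a mem)
        (auto simp: compose_def[of "carrier (G Mod N)"] induced_auto_def restrict_def fun_eq_iff)
  qed (simp add: AutoGroup_simps mem)
  then show ?thesis
    by (simp add: group_hom_def group_hom_axioms_def AutoGroup Q.AutoGroup)
qed

lemma (in group) aut_filt_normal: "aut_filt G c \<lhd> AutoGroup G"
  unfolding aut_filt_def
  using group_hom.normal_kernel[OF induced_auto_hom[OF lower_central_normal lower_central_char]] .

lemma (in group) aut_filt_iff:
  "\<phi> \<in> aut_filt G c \<longleftrightarrow> \<phi> \<in> auto G \<and> (\<forall>x\<in>carrier G. \<phi> x \<otimes> inv x \<in> lower_central G (Suc c))"
proof -
  let ?N = "lower_central G (Suc c)"
  interpret N: normal ?N G by (rule lower_central_normal)
  {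
    assume p: "\<phi> \<in> auto G"
    have I: "\<phi> ` (?N #> x) = ?N #> \<phi> x" if "x \<in> carrier G" for x
      using img_coset[OF p N.subset lower_central_char[OF p] that] .
    interpret p: group_hom G G \<phi> using auto_group_hom[OF group_axioms p] .
    have "\<phi> \<in> aut_filt G c \<longleftrightarrow> (\<forall>x\<in>carrier G. ?N #> \<phi> x = ?N #> x)"
    proof -
      have "\<phi> \<in> aut_filt G c \<longleftrightarrow> (\<forall>X\<in>carrier (G Mod ?N). \<phi> ` X = X)"
        using p by (auto simp del: lower_central.simps
          simp: aut_filt_def kernel_def AutoGroup_simps induced_auto_def restrict_def fun_eq_iff)
      then show ?thesis by (simp add: carrier_FactGroup I del: lower_central.simps)
    qed
    also have "\<dots> \<longleftrightarrow> (\<forall>x\<in>carrier G. \<phi> x \<otimes> inv x \<in> ?N)"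
    proof (intro ball_cong HOL.refl)
      fix x assume x: "x \<in> carrier G"
      have "?N #> \<phi> x = ?N #> x \<longleftrightarrow> \<phi> x \<in> ?N #> x"
        using x rcos_self[OF p.hom_closed[OF x] N.subgroup_axioms]
          repr_independence[OF _ x N.subgroup_axioms] by metis
      then show "?N #> \<phi> x = ?N #> x \<longleftrightarrow> \<phi> x \<otimes> inv x \<in> ?N"
        using N.rcos_module[OF is_group x p.hom_closed[OF x]] by simp
    qed
    finally have ?thesis using p by simp
  }
  then show ?thesis by (auto simp: aut_filt_def kernel_def AutoGroup_simps)
qed

lemma (in group) aut_filt_decseq: "aut_filt G (Suc c) \<subseteq> aut_filt G c"
  using lower_central_decseq[of "Suc c"]
  by (simp add: aut_filt_iff subset_iff del: lower_central.simps)

lemma (in group) conj_auto_mem: "g \<in> carrier G \<Longrightarrow> conj_auto G g \<in> auto G"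
proof -
  assume g: "g \<in> carrier G"
  have i: "inv g \<otimes> (g \<otimes> y) = y" "g \<otimes> (inv g \<otimes> y) = y" if "y \<in> carrier G" for y
    using that g by (simp_all flip: m_assoc)
  have "conj_auto G g \<in> hom G G"
    by (rule homI) (use g in \<open>auto simp: conj_auto_def m_assoc i\<close>)
  moreover have "bij_betw (conj_auto G g) (carrier G) (carrier G)"
    by (rule bij_betw_byWitness[where f' = "\<lambda>x. inv g \<otimes> x \<otimes> g"])
      (use g in \<open>auto simp: conj_auto_def m_assoc i\<close>)
  ultimately show ?thesis by (auto simp: auto_def Bij_def conj_auto_def)
qed

lemma (in group) conj_auto_group_hom: "group_hom G (AutoGroup G) (conj_auto G)"
proof -
  have "conj_auto G \<in> hom G (AutoGroup G)"
  proof (rule homI)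
    fix x y assume "x \<in> carrier G" "y \<in> carrier G"
    then show "conj_auto G (x \<otimes> y) = conj_auto G x \<otimes>\<^bsub>AutoGroup G\<^esub> conj_auto G y"
      by (simp add: AutoGroup_simps conj_auto_mem)
        (auto simp: conj_auto_def compose_def fun_eq_iff m_assoc inv_mult_group)
  qed (simp add: AutoGroup_simps conj_auto_mem)
  then show ?thesis
    by (simp add: group_hom_def group_hom_axioms_def AutoGroup)
qed

lemma (in group) Inn_normal: "Inn G \<lhd> AutoGroup G"
proof -
  interpret A: group "AutoGroup G" by (rule AutoGroup)
  interpret c: group_hom G "AutoGroup G" "conj_auto G" by (rule conj_auto_group_hom)
  show ?thesis unfolding Inn_def
  proof (rule A.normal_invI[OF c.img_is_subgroup])
    fix \<phi> h assume p: "\<phi> \<in> carrier (AutoGroup G)" and "h \<in> conj_auto G ` carrier G"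
    then obtain g where g: "g \<in> carrier G" "h = conj_auto G g" by auto
    have pa: "\<phi> \<in> auto G" using p by (simp add: AutoGroup_simps)
    interpret p: group_hom G G \<phi> using auto_group_hom[OF group_axioms pa] .
    have "\<phi> \<otimes>\<^bsub>AutoGroup G\<^esub> h = conj_auto G (\<phi> g) \<otimes>\<^bsub>AutoGroup G\<^esub> \<phi>"
      using g pa by (simp add: AutoGroup_simps conj_auto_mem)
        (auto simp: compose_def conj_auto_def fun_eq_iff)
    moreover have "conj_auto G (\<phi> g) \<in> carrier (AutoGroup G)" using g by auto
    ultimately have "\<phi> \<otimes>\<^bsub>AutoGroup G\<^esub> h \<otimes>\<^bsub>AutoGroup G\<^esub> inv\<^bsub>AutoGroup G\<^esub> \<phi> = conj_auto G (\<phi> g)"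
      using p by (simp add: A.m_assoc)
    then show "\<phi> \<otimes>\<^bsub>AutoGroup G\<^esub> h \<otimes>\<^bsub>AutoGroup G\<^esub> inv\<^bsub>AutoGroup G\<^esub> \<phi> \<in> conj_auto G ` carrier G"
      using g by simp
  qed
qed

lemma (in group) out_filt_normal: "out_filt G c \<lhd> OutGroup G"
proof -
  interpret I: normal "Inn G" "AutoGroup G" by (rule Inn_normal)
  interpret O: group "OutGroup G" unfolding OutGroup_def by (rule I.factorgroup_is_group)
  have h: "group_hom (AutoGroup G) (OutGroup G) (to_Out G)"
    using I.r_coset_hom_Mod AutoGroup O.group_axioms
    unfolding group_hom_def group_hom_axioms_def OutGroup_def to_Out_def[abs_def] by simp
  show ?thesis unfolding out_filt_def
    by (rule normal.surj_hom_normal_subgroup[OF aut_filt_normal h])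
      (simp add: OutGroup_def to_Out_def[abs_def] carrier_FactGroup)
qed

lemma (in group) group_OutGroup: "group (OutGroup G)"
  unfolding OutGroup_def by (rule normal.factorgroup_is_group[OF Inn_normal])

lemma (in group) group_out_filt_quot: "group (out_filt_quot G c)"
proof -
  interpret O: group "OutGroup G" by (rule group_OutGroup)
  have "out_filt G (Suc c) \<subseteq> out_filt G c" using aut_filt_decseq by (auto simp: out_filt_def)
  then show ?thesis unfolding out_filt_quot_def
    by (intro normal.factorgroup_is_group O.normal_restrict_supergroup
       out_filt_normal normal_imp_subgroup)
qed

corollary (in wf_digraph) group_out_filt_quot_raag: "group (out_filt_quot (raag G) c)"
  by (rule group.group_out_filt_quot[OF group_raag])

end

theory Submission
  imports Defs "HOL-Library.Poly_Mapping" "HOL-Library.Multiset"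
begin

text \<open>
  Let \<open>A\<close> be the right-angled Artin group, \<open>M\<close> its monoid of traces (words modulo commutation of
  adjacent letters), \<open>L = \<Oplus> \<gamma>\<^sub>k / \<gamma>\<^sub>k\<^sub>+\<^sub>1\<close> the Lie ring of its lower central series and \<open>U\<close> the monoid ring
  of \<open>M\<close>. The Magnus expansion \<open>v \<mapsto> 1 + v\<close> sends \<open>L\<close> to \<open>U\<close>, and the main point is that this map is
  injective with torsion-free cokernel.

  This is proved by Lazard elimination. For a vertex \<open>x\<close>, the ring \<open>L\<close> is the sum of the subring
  generated by the other vertices and the one generated by the set \<open>W\<close> of brackets
  \<open>[[x, w\<^sub>1], \<dots>, w\<^sub>m]\<close>, where \<open>x w\<^sub>1 \<dots> w\<^sub>m\<close> is a trace whose only minimal letter is \<open>x\<close>. Products of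
  elements of \<open>W\<close> are unitriangular over \<open>\<int>\<close> with respect to the corresponding traces, so \<open>W\<close> generates
  a free subring of \<open>U\<close>. In degrees up to \<open>k\<close> both alphabets have fewer words than the original one;
  hence the argument can be iterated, now with no commutation relation in \<open>W\<close>.

  If \<open>A\<close> has trivial centre, then every vertex \<open>v\<close> has a vertex \<open>w\<close> not commuting with it, and comparing
  \<open>P w\<^sup>N\<close> with \<open>w\<^sup>N P\<close> shows that \<open>U / n U\<close> has no central elements of positive degree, for all \<open>n \<ge> 0\<close>.
  Now let \<open>\<phi> \<in> G\<^sub>c\<close> and let \<open>\<phi>\<^sup>n\<close> be in \<open>G\<^sub>c\<^sub>+\<^sub>1\<close> up to conjugation by \<open>g\<close>, and put \<open>\<tau>(v) = \<phi>(v) v\<^sup>-\<^sup>1\<close>. The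
  case \<open>n = 0\<close> of the above gives \<open>g \<in> \<gamma>\<^sub>c\<close>. In \<open>\<gamma>\<^sub>c\<^sub>+\<^sub>1 / \<gamma>\<^sub>c\<^sub>+\<^sub>2\<close> we have \<open>n \<tau>(v) = [g, v]\<close>, so \<open>g\<close> is central
  modulo \<open>n\<close> and thus \<open>g = n h\<close> in \<open>\<gamma>\<^sub>c / \<gamma>\<^sub>c\<^sub>+\<^sub>1\<close>; then \<open>\<tau>(v) = [h, v]\<close> by torsion-freeness, that is,
  \<open>\<phi>\<close> is in \<open>G\<^sub>c\<^sub>+\<^sub>1\<close> up to conjugation by \<open>h\<close>.
\<close>


section \<open>Traces\<close>

inductive swap :: "('l \<Rightarrow> 'l \<Rightarrow> bool) \<Rightarrow> 'l list \<Rightarrow> 'l list \<Rightarrow> bool" for \<theta> where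
  base: "\<theta> a b \<Longrightarrow> swap \<theta> (a # b # q) (b # a # q)"
| cons: "swap \<theta> u v \<Longrightarrow> swap \<theta> (d # u) (d # v)"

lemma swap_prepend: "swap \<theta> u v \<Longrightarrow> swap \<theta> (p @ u) (p @ v)"
  by (induct p) (auto intro: swap.cons)

lemma swap_append: "swap \<theta> u v \<Longrightarrow> swap \<theta> (u @ q) (v @ q)"
  by (induct rule: swap.induct) (auto intro: swap.intros)

lemma swapE:
  assumes "swap \<theta> u v"
  obtains p a b q where "u = p @ a # b # q" "v = p @ b # a # q" "\<theta> a b"
proof -
  from assms have "\<exists>p a b q. u = p @ a # b # q \<and> v = p @ b # a # q \<and> \<theta> a b"
  proof induct
    case (base a b q)
    then show ?case by (metis append_Nil)
  next
    case (cons u v d)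
    then show ?case by (metis append_Cons)
  qed
  then show thesis using that by blast
qed

text \<open>For an irreflexive relation this says that \<open>c\<close> is a minimal letter of the
  trace of \<open>u\<close>: its first occurrence is preceded only by letters that commute with
  it.\<close>

fun avail :: "('l \<Rightarrow> 'l \<Rightarrow> bool) \<Rightarrow> 'l \<Rightarrow> 'l list \<Rightarrow> bool" where
  "avail \<theta> c [] \<longleftrightarrow> False"
| "avail \<theta> c (d # u) \<longleftrightarrow> c = d \<or> \<theta> c d \<and> avail \<theta> c u"

lemma avail_append:
  "avail \<theta> c (u @ v) \<longleftrightarrow> avail \<theta> c u \<or> (\<forall>b\<in>set u. \<theta> c b) \<and> avail \<theta> c v"
  by (induct u) auto

lemma avail_in_set: "avail \<theta> c u \<Longrightarrow> c \<in> set u"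
  by (induct u) auto

lemma last_split_unique:
  assumes "t0 @ x # t1 = r0 @ x # r1" "x \<notin> set t1" "x \<notin> set r1"
  shows "t0 = r0 \<and> t1 = r1"
  using assms
proof (induct t0 arbitrary: r0)
  case Nil
  then show ?case by (cases r0) auto
next
  case (Cons a t0)
  then show ?case by (cases r0) auto
qed

section \<open>The trace monoid and its left cancellation\<close>

locale commutation =
  fixes \<theta> :: "'l \<Rightarrow> 'l \<Rightarrow> bool"
  assumes sym: "\<theta> a b \<Longrightarrow> \<theta> b a"
    and irrefl: "\<not> \<theta> a a"
begin

abbreviation trace_eq (infix "\<simeq>" 50) where "u \<simeq> v \<equiv> (swap \<theta>)\<^sup>*\<^sup>* u v"

lemma swap_sym: "swap \<theta> u v \<Longrightarrow> swap \<theta> v u"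
  by (induct rule: swap.induct) (auto intro: swap.intros sym)

lemma trace_sym: "u \<simeq> v \<Longrightarrow> v \<simeq> u"
  by (induct rule: rtranclp_induct) (auto intro: swap_sym converse_rtranclp_into_rtranclp)

lemma trace_append: assumes "u \<simeq> u'" "v \<simeq> v'" shows "u @ v \<simeq> u' @ v'"
proof -
  from assms(1) have "u @ v \<simeq> u' @ v"
    by (induct rule: rtranclp_induct) (auto intro: swap_append rtranclp.rtrancl_into_rtrancl)
  moreover from assms(2) have "u' @ v \<simeq> u' @ v'"
    by (induct rule: rtranclp_induct) (auto intro: swap_prepend rtranclp.rtrancl_into_rtrancl)
  ultimately show ?thesis by simp
qed

lemma trace_Cons: "u \<simeq> v \<Longrightarrow> a # u \<simeq> a # v"
  using trace_append[of "[a]" "[a]" u v] by simp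

lemma trace_mset: "u \<simeq> v \<Longrightarrow> mset u = mset v"
  by (induct rule: rtranclp_induct) (auto elim!: swapE)

lemma trace_set: "u \<simeq> v \<Longrightarrow> set u = set v"
  using trace_mset mset_eq_setD by metis

lemma trace_length: "u \<simeq> v \<Longrightarrow> length u = length v"
  using trace_mset mset_eq_length by metis

lemma trace_move:
  assumes "\<forall>b\<in>set u. \<theta> c b" shows "c # u \<simeq> u @ [c]"
  using assms
proof (induct u)
  case (Cons b u)
  have "c # b # u \<simeq> b # c # u" using Cons by (intro r_into_rtranclp swap.base) auto
  also have "b # c # u \<simeq> b # u @ [c]" using Cons by (intro trace_Cons) auto
  finally show ?case by simp
qed simp

text \<open>Deleting a minimal letter is well defined on traces. This yields left cancellation in
  \<open>trace_cancel\<close>.\<close>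

lemma swap_avail:
  assumes "swap \<theta> u v" "avail \<theta> c u"
  shows "avail \<theta> c v \<and> remove1 c u \<simeq> remove1 c v"
  using assms
proof (induct rule: swap.induct)
  case (base a b q)
  have "a \<noteq> b" using base(1) irrefl by auto
  then show ?case using base sym[of a b]
    by (auto intro: r_into_rtranclp swap.base)
next
  case (cons u v d)
  then show ?case by (auto intro: trace_Cons r_into_rtranclp)
qed

lemma trace_avail:
  assumes "u \<simeq> v" "avail \<theta> c u"
  shows "avail \<theta> c v" "remove1 c u \<simeq> remove1 c v"
proof -
  have "avail \<theta> c v \<and> remove1 c u \<simeq> remove1 c v" using assms
    by (induct rule: rtranclp_induct) (auto dest: swap_avail intro: rtranclp_trans)
  then show "avail \<theta> c v" "remove1 c u \<simeq> remove1 c v" by auto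
qed

lemma avail_front: "avail \<theta> c u \<Longrightarrow> u \<simeq> c # remove1 c u"
proof (induct u)
  case (Cons d u)
  then show ?case
  proof (cases "c = d")
    case False
    then have "\<theta> d c" "u \<simeq> c # remove1 c u" using Cons sym by auto
    then have "d # u \<simeq> d # c # remove1 c u" by (intro trace_Cons)
    also have "\<dots> \<simeq> c # d # remove1 c u"
      using \<open>\<theta> d c\<close> by (intro r_into_rtranclp swap.base)
    finally show ?thesis using False by simp
  qed simp
qed simp

lemma trace_ConsD:
  assumes "c # z \<simeq> y" shows "avail \<theta> c y" "z \<simeq> remove1 c y"
  using trace_avail[OF assms, of c] by auto

lemma trace_cancel: "p @ u \<simeq> p @ v \<Longrightarrow> u \<simeq> v"
proof (induct p)
  case (Cons c p)
  then show ?case using trace_ConsD(2)[of c "p @ u" "c # p @ v"] by auto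
qed simp

text \<open>A trace \<open>x # w\<close> such that \<open>x\<close> is its only minimal letter.\<close>

definition pyramid :: "'l \<Rightarrow> 'l list \<Rightarrow> bool" where
  "pyramid x w \<longleftrightarrow> (\<forall>c. \<theta> c x \<longrightarrow> \<not> avail \<theta> c w)"

section \<open>Pyramids\<close>

lemma pyramid_cong: "u \<simeq> v \<Longrightarrow> pyramid x u \<longleftrightarrow> pyramid x v"
  unfolding pyramid_def using trace_avail(1) trace_sym by metis

text \<open>A new minimal letter that commutes with \<open>x\<close> can only be the appended
  \<open>v\<close>, which must then pass every letter of \<open>w\<close>. This is the case in which
  bracketing with \<open>v\<close> gives zero.\<close>

lemma pyramid_snoc:
  assumes "pyramid x w" "\<not> pyramid x (w @ [v])"
  shows "\<forall>b\<in>set (x # w). \<theta> v b"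
  using assms unfolding pyramid_def by (auto simp: avail_append)

text \<open>Here \<open>s\<close> records the letters of \<open>m0\<close> that have moved behind
  the last \<open>x\<close>. A swap across this \<open>x\<close> adds a letter to \<open>s\<close>
  or takes one back: a letter leaving to the left commutes with \<open>x\<close>, so it is not
  minimal in \<open>w\<close> and must come from \<open>s\<close>. All other swaps stay inside
  \<open>t0\<close> or \<open>t1\<close>.\<close>

lemma last_pyramid_step:
  assumes pyr: "pyramid x w" and xw: "x \<notin> set w" and "swap \<theta> y z"
    and y: "y = t0 @ x # t1" "x \<notin> set t1" "t1 \<simeq> s @ w" "t0 @ s \<simeq> m0" "\<forall>b\<in>set s. \<theta> b x"
  shows "\<exists>t0 t1 s. z = t0 @ x # t1 \<and> x \<notin> set t1 \<and> t1 \<simeq> s @ w \<and> t0 @ s \<simeq> m0 \<and> (\<forall>b\<in>set s. \<theta> b x)"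
proof -
  from assms(3) obtain p a b q where s: "y = p @ a # b # q" "z = p @ b # a # q" "\<theta> a b"
    by (rule swapE)
  have ab: "a \<noteq> b" using s irrefl by auto
  have eq: "t0 @ x # t1 = p @ a # b # q" using s y by simp
  show ?thesis
  proof (cases "x \<in> set q")
    case True
    then obtain q0 q1 where q: "q = q0 @ x # q1" "x \<notin> set q1" using split_list_last by metis
    then have e: "t0 = p @ a # b # q0" "t1 = q1"
      using eq y(2) last_split_unique[of t0 x t1 "p @ a # b # q0" q1] by auto
    have "p @ b # a # q0 @ s \<simeq> p @ a # b # q0 @ s"
      using s(3) sym by (intro r_into_rtranclp swap_prepend swap.base) auto
    then have "(p @ b # a # q0) @ s \<simeq> m0" using y(4) e by auto
    then show ?thesis using q e y s by (intro exI[of _ "p @ b # a # q0"] exI[of _ q1] exI[of _ s]) auto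
  next
    case q: False
    consider "b = x" | "b \<noteq> x" "a = x" | "b \<noteq> x" "a \<noteq> x" by auto
    then show ?thesis
    proof cases
      case 1
      then have e: "t0 = p @ [a]" "t1 = q"
        using eq y(2) q last_split_unique[of t0 x t1 "p @ [a]" q] by auto
      then show ?thesis using y s ab 1
        by (intro exI[of _ p] exI[of _ "a # q"] exI[of _ "a # s"]) (auto intro: trace_Cons)
    next
      case 2
      then have e: "t0 = p" "t1 = b # q"
        using eq y(2) q last_split_unique[of t0 x t1 p "b # q"] by auto
      have av: "avail \<theta> b (s @ w)" "q \<simeq> remove1 b (s @ w)"
        using trace_ConsD[of b q "s @ w"] y(3) e by auto
      have "\<theta> b x" using s(3) 2 sym by auto
      then have "avail \<theta> b s" using av(1) pyr by (auto simp: avail_append pyramid_def)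
      then have bs: "b \<in> set s" "s \<simeq> b # remove1 b s" using avail_in_set avail_front by metis+
      have "remove1 b (s @ w) = remove1 b s @ w" using bs(1) by (simp add: remove1_append)
      then have "q \<simeq> remove1 b s @ w" using av(2) by metis
      moreover have "(p @ [b]) @ remove1 b s \<simeq> m0"
      proof -
        have "p @ (b # remove1 b s) \<simeq> p @ s" using bs(2) trace_append trace_sym by blast
        then show ?thesis using y(4) e(1) by (metis append.assoc append_Cons append_Nil rtranclp_trans)
      qed
      moreover have "z = (p @ [b]) @ x # q" using s(2) 2 by simp
      moreover have "\<forall>b\<in>set (remove1 b s). \<theta> b x"
        using y(5) set_remove1_subset[of b s] by blast
      ultimately show ?thesis using q by blast
    next
      case 3
      then have "x \<in> set p" using q eq by (metis in_set_conv_decomp set_ConsD Un_iff set_append)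
      then obtain p0 p1 where p: "p = p0 @ x # p1" "x \<notin> set p1" using split_list_last by metis
      then have e: "t0 = p0" "t1 = p1 @ a # b # q"
        using eq y(2) q 3 last_split_unique[of t0 x t1 p0 "p1 @ a # b # q"] by auto
      have "p1 @ b # a # q \<simeq> p1 @ a # b # q"
        using s(3) sym by (intro r_into_rtranclp swap_prepend swap.base) auto
      then have "p1 @ b # a # q \<simeq> s @ w" using y(3) e by auto
      then show ?thesis using p e y s q 3
        by (intro exI[of _ p0] exI[of _ "p1 @ b # a # q"] exI[of _ s]) auto
    qed
  qed
qed

lemma last_pyramid:
  assumes pyr: "pyramid x w" and xw: "x \<notin> set w" and "m0 @ x # w \<simeq> y"
  obtains t0 t1 s where "y = t0 @ x # t1" "x \<notin> set t1" "t1 \<simeq> s @ w" "t0 @ s \<simeq> m0"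
proof -
  from assms(3) have "\<exists>t0 t1 s. y = t0 @ x # t1 \<and> x \<notin> set t1 \<and> t1 \<simeq> s @ w \<and> t0 @ s \<simeq> m0 \<and> (\<forall>b\<in>set s. \<theta> b x)"
  proof (induct rule: rtranclp_induct)
    case base
    show ?case using xw by (intro exI[of _ m0] exI[of _ w] exI[of _ "[]"]) auto
  next
    case (step y z)
    then show ?case using last_pyramid_step[OF pyr xw step(2)] by blast
  qed
  then show thesis using that by blast
qed


text \<open>Such an \<open>f\<close> is, by linear extension, an integer functional on the monoid
  ring of traces. That ring is never constructed; it is seen only through these functionals.\<close>

definition invariant :: "('l list \<Rightarrow> int) \<Rightarrow> bool" where
  "invariant f \<longleftrightarrow> (\<forall>u v. u \<simeq> v \<longrightarrow> f u = f v)"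

text \<open>Every trace whose minimal letters are all equal to \<open>x\<close> has the form \<open>blocks x ws\<close> with pyramids
  \<open>x # w\<close>, and the words \<open>w\<close> are unique up to \<open>\<simeq>\<close>.\<close>

definition blocks :: "'l \<Rightarrow> 'l list list \<Rightarrow> 'l list" where
  "blocks x ws = concat (map (Cons x) ws)"

lemma blocks_simps [simp]: "blocks x [] = []" "blocks x (w # ws) = x # w @ blocks x ws"
  "blocks x (ws @ ws') = blocks x ws @ blocks x ws'"
  by (auto simp: blocks_def)

end

text \<open>The number of pairs of a letter \<open>x\<close> and a later letter different from
  \<open>x\<close>. It orders the words for the triangularity argument.\<close>

fun disp :: "'l \<Rightarrow> 'l list \<Rightarrow> nat" where
  "disp x [] = 0"
| "disp x (a # t) = (if a = x then length (filter (\<lambda>b. b \<noteq> x) t) else 0) + disp x t"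

lemma disp_append:
  "disp x (u @ v) = disp x u + disp x v + count_list u x * length (filter (\<lambda>b. b \<noteq> x) v)"
  by (induct u) (auto simp: algebra_simps)

lemma disp_free: "x \<notin> set u \<Longrightarrow> disp x u = 0"
  by (induct u) auto

section \<open>Uniqueness of the decomposition into pyramids\<close>

context commutation
begin

lemma trace_count_list: "u \<simeq> v \<Longrightarrow> count_list u x = count_list v x"
  using trace_mset by (metis count_mset)

text \<open>Among all words representing a product of pyramids over \<open>x\<close>, the product itself has the
  letters \<open>x\<close> as far to the right as possible.\<close>

lemma disp_blocks_le:
  assumes "\<forall>w\<in>set ws. pyramid x w \<and> x \<notin> set w" "blocks x ws \<simeq> t"
  shows "disp x (blocks x ws) \<le> disp x t"
  using assms
proof (induct ws arbitrary: t rule: rev_induct)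
  case (snoc w ws)
  let ?m = "blocks x ws"
  obtain t0 t1 s where t: "t = t0 @ x # t1" "x \<notin> set t1" "t1 \<simeq> s @ w" "t0 @ s \<simeq> ?m"
    using last_pyramid[of x w ?m t] snoc by auto
  have xs: "x \<notin> set s" "x \<notin> set w" using t(2,3) trace_set[of t1 "s @ w"] by auto
  have f: "filter (\<lambda>b. b \<noteq> x) u = u" if "x \<notin> set u" for u
    using that by (induct u) auto
  have c: "count_list t0 x = count_list ?m x"
    using trace_count_list[OF t(4), of x] xs by simp
  have "disp x ?m \<le> disp x (t0 @ s)" using snoc t(4) trace_sym by auto
  \<comment> \<open>As \<open>t0\<close> and \<open>?m\<close> contain equally many
    \<open>x\<close>, \<open>disp x t\<close> exceeds \<open>disp x (t0 @ s)\<close> plus the share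
    of the last block by exactly \<open>length s\<close>.\<close>
  moreover have "length t1 = length s + length w" using trace_length[OF t(3)] by simp
  ultimately show ?case using t(1,2) xs c by (simp add: disp_append disp_free f algebra_simps)
qed simp

text \<open>By \<open>last_pyramid\<close> in both directions, each of the two last blocks is a
  suffix of the other up to \<open>\<simeq>\<close>. The lengths force the extra prefixes to be
  empty, and the remaining blocks are compared by induction.\<close>

lemma blocks_unique:
  assumes "\<forall>w\<in>set ws \<union> set ws'. pyramid x w \<and> x \<notin> set w" "blocks x ws \<simeq> blocks x ws'"
  shows "list_all2 trace_eq ws ws'"
  using assms
proof (induct ws arbitrary: ws' rule: rev_induct)
  case Nil
  then have "blocks x ws' = []" using trace_length by fastforce
  then show ?case by (cases ws') auto
next
  case (snoc w ws)
  have "ws' \<noteq> []" using snoc(3) trace_length by fastforce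
  then obtain us v where ws': "ws' = us @ [v]" by (metis rev_exhaust)
  have E: "blocks x ws @ x # w \<simeq> blocks x us @ x # v" using snoc(3) ws' by simp
  have p: "pyramid x w" "x \<notin> set w" "pyramid x v" "x \<notin> set v" using snoc(2) ws' by auto
  obtain s where s: "v \<simeq> s @ w" "blocks x us @ s \<simeq> blocks x ws"
    using last_pyramid[OF p(1,2) E] last_split_unique p(4) by metis
  obtain s' where s': "w \<simeq> s' @ v"
    using last_pyramid[OF p(3,4) trace_sym[OF E]] last_split_unique p(2) by metis
  have "s = []" using trace_length[OF s(1)] trace_length[OF s'] by auto
  then have "list_all2 trace_eq ws us" "w \<simeq> v" using s snoc(1)[of us] snoc(2) ws'
    by (auto intro: trace_sym)
  then show ?case using ws' by (simp add: list_all2_appendI)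
qed

end


section \<open>The free associative ring modulo commutation relations\<close>

text \<open>With concatenation as the addition of exponents, the convolution product of finitely
  supported functions on lists is that of the free associative ring.\<close>

instantiation list :: (type) monoid_add
begin
definition "0 = []"
definition "u + v = u @ v" for u v :: "'a list"
instance by standard (auto simp: zero_list_def plus_list_def)
end

type_synonym 'l ncpoly = "'l list \<Rightarrow>\<^sub>0 int"

lemma frag_of_mult: "frag_of u * frag_of v = frag_of (u @ v :: 'l list)"
  by (simp add: mult_single plus_list_def)

lemma one_frag: "(1 :: 'l ncpoly) = frag_of []"
  by (metis single_one zero_list_def)

lemma keys_mult_append:
  assumes "t \<in> Poly_Mapping.keys (P * Q :: 'l ncpoly)"
  obtains u v where "u \<in> Poly_Mapping.keys P" "v \<in> Poly_Mapping.keys Q" "t = u @ v"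
  using assms keys_mult[of P Q] unfolding plus_list_def by blast

section \<open>Integer functionals on the free ring\<close>

definition pair :: "('b \<Rightarrow> int) \<Rightarrow> ('b \<Rightarrow>\<^sub>0 int) \<Rightarrow> int" where
  "pair f P = (\<Sum>w\<in>Poly_Mapping.keys P. Poly_Mapping.lookup P w * f w)"

lemma pair_superset:
  assumes "finite A" "Poly_Mapping.keys P \<subseteq> A"
  shows "pair f P = (\<Sum>w\<in>A. Poly_Mapping.lookup P w * f w)"
  unfolding pair_def using assms
  by (intro sum.mono_neutral_left) (auto simp: in_keys_iff)

lemma pair_0 [simp]: "pair f 0 = 0"
  by (simp add: pair_def)

lemma pair_of [simp]: "pair f (frag_of w) = f w"
  by (simp add: pair_def)

lemma pair_add: "pair f (P + Q) = pair f P + pair f Q"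
proof -
  let ?A = "Poly_Mapping.keys P \<union> Poly_Mapping.keys Q"
  have "Poly_Mapping.keys (P + Q) \<subseteq> ?A" by (rule Poly_Mapping.keys_add)
  then show ?thesis
    by (simp add: pair_superset[of ?A] lookup_add algebra_simps sum.distrib)
qed

lemma pair_uminus: "pair f (- P) = - pair f P"
  using pair_add[of f P "- P"] by simp

lemma pair_diff: "pair f (P - Q) = pair f P - pair f Q"
  using pair_add[of f P "- Q"] by (simp add: pair_uminus)

lemma pair_cmul: "pair f (frag_cmul c P) = c * pair f P"
  using pair_superset[OF finite_keys keys_cmul, of f c P]
  by (simp add: pair_def sum_distrib_left mult.assoc)

lemma pair_cong: "(\<And>w. w \<in> Poly_Mapping.keys P \<Longrightarrow> f w = g w) \<Longrightarrow> pair f P = pair g P"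
  by (simp add: pair_def)

lemma pair_zero: "(\<And>w. w \<in> Poly_Mapping.keys P \<Longrightarrow> f w = 0) \<Longrightarrow> pair f P = 0"
  by (simp add: pair_def)

lemma pair_fun_add: "pair (\<lambda>w. f w + g w) P = pair f P + pair g P"
  by (simp add: pair_def algebra_simps sum.distrib)

lemma ncpoly_induct [case_names zero one diff]:
  assumes "Q 0" "\<And>w. Q (frag_of w)" "\<And>a b. Q a \<Longrightarrow> Q b \<Longrightarrow> Q (a - b)"
  shows "Q (P :: 'b \<Rightarrow>\<^sub>0 int)"
  using frag_induction[of P UNIV Q] assms by auto

lemma pair_mult: "pair f (P * Q) = pair (\<lambda>u. pair (\<lambda>v. f (u @ v)) Q) P"
proof (induct P rule: ncpoly_induct)
  case (one u)
  show ?case by (induct Q rule: ncpoly_induct) (simp_all add: frag_of_mult algebra_simps pair_diff)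
qed (simp_all add: algebra_simps pair_diff)

section \<open>Substitution and brackets\<close>

definition evalw :: "('m \<Rightarrow> 'l ncpoly) \<Rightarrow> 'm list \<Rightarrow> 'l ncpoly" where
  "evalw E w = prod_list (map E w)"

lemma evalw_simps [simp]: "evalw E [] = 1" "evalw E (a # w) = E a * evalw E w"
  "evalw E (u @ v) = evalw E u * evalw E v"
  by (simp_all add: evalw_def)

definition subst :: "('m \<Rightarrow> 'l ncpoly) \<Rightarrow> 'm ncpoly \<Rightarrow> 'l ncpoly" where
  "subst E P = frag_extend (evalw E) P"

lemma subst_simps [simp]: "subst E 0 = 0" "subst E (frag_of w) = evalw E w"
  "subst E (P + Q) = subst E P + subst E Q" "subst E (- P) = - subst E P"
  "subst E (P - Q) = subst E P - subst E Q"
  by (simp_all add: subst_def frag_extend_add frag_extend_minus frag_extend_diff)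

lemma subst_mult [simp]: "subst E (P * Q) = subst E P * subst E Q"
proof (induct P rule: ncpoly_induct)
  case (one u)
  show ?case by (induct Q rule: ncpoly_induct) (simp_all add: frag_of_mult algebra_simps)
qed (simp_all add: algebra_simps)

lemma pair_subst: "pair f (subst E P) = pair (\<lambda>w. pair f (evalw E w)) P"
  by (induct P rule: ncpoly_induct) (simp_all add: pair_diff)

definition brk :: "'l ncpoly \<Rightarrow> 'l ncpoly \<Rightarrow> 'l ncpoly" where
  "brk P Q = P * Q - Q * P"

lemma brk_simps:
  "brk 0 Q = 0" "brk P 0 = 0" "brk (P + P') Q = brk P Q + brk P' Q" "brk P (Q + Q') = brk P Q + brk P Q'"
  "brk (- P) Q = - brk P Q" "brk P (- Q) = - brk P Q"
  "brk (P - P') Q = brk P Q - brk P' Q" "brk P (Q - Q') = brk P Q - brk P Q'"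
  by (simp_all add: brk_def algebra_simps)

lemma brk_jacobi: "brk (brk P Q) R = brk (brk P R) Q + brk P (brk Q R)"
  by (simp add: brk_def algebra_simps)

lemma brk_anti: "brk Q P = - brk P Q"
  by (simp add: brk_def)

lemma subst_brk: "subst E (brk P Q) = brk (subst E P) (subst E Q)"
  by (simp add: brk_def)

lemma keys_brk:
  "t \<in> Poly_Mapping.keys (brk P Q) \<Longrightarrow>
    \<exists>u\<in>Poly_Mapping.keys P. \<exists>v\<in>Poly_Mapping.keys Q. t = u @ v \<or> t = v @ u"
  using keys_diff[of "P * Q" "Q * P"] unfolding brk_def by (blast elim: keys_mult_append)

section \<open>Left-normed brackets and their leading words\<close>

definition lnb :: "'l \<Rightarrow> 'l list \<Rightarrow> 'l ncpoly" where
  "lnb x w = foldl (\<lambda>P v. brk P (frag_of [v])) (frag_of [x]) w"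

lemma lnb_simps [simp]: "lnb x [] = frag_of [x]" "lnb x (w @ [v]) = brk (lnb x w) (frag_of [v])"
  by (simp_all add: lnb_def)

lemma keys_lnb: "t \<in> Poly_Mapping.keys (lnb x w) \<Longrightarrow> mset t = mset (x # w)"
proof (induct w arbitrary: t rule: rev_induct)
  case (snoc v w)
  then show ?case using keys_brk[of t "lnb x w" "frag_of [v]"] by auto
qed simp

text \<open>Unitriangularity: since all other words have smaller \<open>disp\<close>, the word
  \<open>l\<close> has coefficient one. The two letter counts are carried along because they enter
  \<open>disp_append\<close>; with them the relation is multiplicative.\<close>

definition lead :: "'l \<Rightarrow> 'l ncpoly \<Rightarrow> 'l list \<Rightarrow> bool" where
  "lead x P l \<longleftrightarrow> (\<forall>t\<in>Poly_Mapping.keys (P - frag_of l). count_list t x = count_list l x \<and>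
     length (filter (\<lambda>b. b \<noteq> x) t) = length (filter (\<lambda>b. b \<noteq> x) l) \<and> disp x t < disp x l)"

lemma lead_mult:
  assumes "lead x P l" "lead x P' l'" shows "lead x (P * P') (l @ l')"
proof -
  define Q Q' where Q: "Q = P - frag_of l" "Q' = P' - frag_of l'"
  have "P * P' - frag_of (l @ l') = frag_of l * Q' + Q * frag_of l' + Q * Q'"
    by (simp add: Q algebra_simps frag_of_mult)
  then have "\<exists>u v. t = u @ v \<and> (u = l \<and> v \<in> Poly_Mapping.keys Q' \<or> u \<in> Poly_Mapping.keys Q \<and> v = l' \<or>
      u \<in> Poly_Mapping.keys Q \<and> v \<in> Poly_Mapping.keys Q')"
    if "t \<in> Poly_Mapping.keys (P * P' - frag_of (l @ l'))" for t
  proof -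
    have "t \<in> Poly_Mapping.keys (frag_of l * Q') \<or> t \<in> Poly_Mapping.keys (Q * frag_of l')
        \<or> t \<in> Poly_Mapping.keys (Q * Q')"
      using that Poly_Mapping.keys_add \<open>P * P' - frag_of (l @ l') = _\<close>
      by (metis (no_types, lifting) Un_iff subsetD)
    then show ?thesis by (elim disjE keys_mult_append) auto
  qed
  then show ?thesis using assms unfolding lead_def Q[symmetric]
    by (fastforce simp: disp_append)
qed

text \<open>In the bracket with \<open>v\<close>, the words \<open>t @ [v]\<close> have
  \<open>v\<close> behind the letter \<open>x\<close>, whereas the words \<open>v # t\<close> lose
  this pair and are smaller.\<close>

lemma lead_lnb: "x \<notin> set w \<Longrightarrow> lead x (lnb x w) (x # w)"
proof (induct w rule: rev_induct)
  case (snoc v w)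
  have f: "filter (\<lambda>b. b \<noteq> x) u = u" if "x \<notin> set u" for u
    using that by (induct u) auto
  have l: "lead x (lnb x w) (x # w)" using snoc by auto
  define Q where Q: "Q = lnb x w - frag_of (x # w)"
  have vx: "v \<noteq> x" "x \<notin> set w" using snoc by auto
  have "lnb x (w @ [v]) - frag_of (x # w @ [v]) = Q * frag_of [v] - frag_of [v] * Q - frag_of (v # x # w)"
    by (simp add: Q brk_def algebra_simps frag_of_mult)
  then have "t \<in> Poly_Mapping.keys (Q * frag_of [v]) \<or> t \<in> Poly_Mapping.keys (frag_of [v] * Q) \<or> t = v # x # w"
    if "t \<in> Poly_Mapping.keys (lnb x (w @ [v]) - frag_of (x # w @ [v]))" for t
    using that keys_diff[of "Q * frag_of [v] - frag_of [v] * Q" "frag_of (v # x # w)"]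
      keys_diff[of "Q * frag_of [v]" "frag_of [v] * Q"] by auto
  then have "(\<exists>u\<in>Poly_Mapping.keys Q. t = u @ [v] \<or> t = v # u) \<or> t = v # x # w"
    if "t \<in> Poly_Mapping.keys (lnb x (w @ [v]) - frag_of (x # w @ [v]))" for t
    using that by (fastforce elim!: keys_mult_append)
  then show ?case using l vx unfolding lead_def Q[symmetric]
    by (fastforce simp: disp_append disp_free f)
qed (simp add: lead_def)

section \<open>The ring of traces, seen through its functionals\<close>

context commutation
begin

text \<open>This says that \<open>P\<close> vanishes in the monoid ring of traces: that ring is free
  as an abelian group, so its integer functionals separate its elements.\<close>

definition null :: "'l ncpoly \<Rightarrow> bool" where
  "null P \<longleftrightarrow> (\<forall>f. invariant f \<longrightarrow> pair f P = 0)"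

lemma invariantD: "invariant f \<Longrightarrow> u \<simeq> v \<Longrightarrow> f u = f v"
  by (simp add: invariant_def)

lemma invariant_left: "invariant f \<Longrightarrow> invariant (\<lambda>v. f (u @ v))"
  unfolding invariant_def using trace_append by blast

lemma invariant_right: "invariant f \<Longrightarrow> invariant (\<lambda>u. pair (\<lambda>v. f (u @ v)) Q)"
  unfolding invariant_def by (auto intro!: pair_cong dest: trace_append)

lemma null_0 [simp]: "null 0"
  by (simp add: null_def)

lemma null_add: "null P \<Longrightarrow> null Q \<Longrightarrow> null (P + Q)"
  by (simp add: null_def pair_add)

lemma null_diff: "null P \<Longrightarrow> null Q \<Longrightarrow> null (P - Q)"
  by (simp add: null_def pair_diff)

lemma null_uminus: "null P \<Longrightarrow> null (- P)"
  by (simp add: null_def pair_uminus)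

lemma null_mult_left: "null Q \<Longrightarrow> null (P * Q)"
  unfolding null_def pair_mult using invariant_left by (metis (no_types, lifting) pair_zero)

lemma null_mult_right: "null P \<Longrightarrow> null (P * Q)"
  unfolding null_def by (auto simp: pair_mult intro!: invariant_right)

lemma null_brk_left: "null P \<Longrightarrow> null (brk P Q)"
  unfolding brk_def by (intro null_diff null_mult_left null_mult_right)

lemma null_brk_right: "null P \<Longrightarrow> null (brk Q P)"
  unfolding brk_def by (intro null_diff null_mult_left null_mult_right)

lemma null_brk_letter:
  assumes "\<And>t. t \<in> Poly_Mapping.keys P \<Longrightarrow> \<forall>a\<in>set t. \<theta> v a"
  shows "null (brk P (frag_of [v]))"
  unfolding null_def brk_def pair_diff pair_mult
proof (intro allI impI)
  fix f assume "invariant f"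
  then have "f (t @ [v]) = f (v # t)" if "t \<in> Poly_Mapping.keys P" for t
    using trace_move[OF assms[OF that]] by (simp add: invariantD)
  then show "pair (\<lambda>u. pair (\<lambda>v. f (u @ v)) (frag_of [v])) P -
      pair (\<lambda>u. pair (\<lambda>v. f (u @ v)) P) (frag_of [v]) = 0"
    by (simp cong: pair_cong)
qed

text \<open>By the Jacobi identity, exchanging two adjacent letters changes the bracket by one that
  contains the bracket of these letters, which is null if they commute. The brackets that follow
  preserve this.\<close>

lemma null_lnb_trace:
  assumes "u \<simeq> v" shows "null (lnb x u - lnb x v)"
proof -
  have fold_null: "null (foldl (\<lambda>P v. brk P (frag_of [v])) P w - foldl (\<lambda>P v. brk P (frag_of [v])) Q w)"
    if "null (P - Q)" for P Q w
    using that
  proof (induct w arbitrary: P Q)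
    case (Cons a w)
    have "null (brk P (frag_of [a]) - brk Q (frag_of [a]))"
      using null_brk_left[OF Cons(2)] by (simp add: brk_simps)
    then show ?case using Cons(1) by simp
  qed simp
  have "null (lnb x u - lnb x v)" if s: "swap \<theta> u v" for u v
  proof -
    obtain p a b q where u: "u = p @ a # b # q" "v = p @ b # a # q" "\<theta> a b"
      using s by (rule swapE)
    let ?P = "lnb x p"
    have "null (brk (frag_of [a]) (frag_of [b]))"
      using u(3) sym by (intro null_brk_letter) auto
    then have "null (brk (brk ?P (frag_of [a])) (frag_of [b]) - brk (brk ?P (frag_of [b])) (frag_of [a]))"
      using brk_jacobi[of ?P "frag_of [a]" "frag_of [b]"] null_brk_right by auto
    from fold_null[OF this, of q] show ?thesis by (simp add: u lnb_def)
  qed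
  note sw = this
  from assms show ?thesis
  proof (induct rule: rtranclp_induct)
    case (step y z)
    then show ?case using null_add[OF step(3) sw[OF step(2)]] by simp
  qed simp
qed

section \<open>Duality for the substitution of pyramids\<close>

lemma blocks_inj:
  assumes W: "\<And>a. a \<in> W \<Longrightarrow> pyramid x (wd a) \<and> x \<notin> set (wd a)"
    and inj: "\<And>a b. a \<in> W \<Longrightarrow> b \<in> W \<Longrightarrow> wd a \<simeq> wd b \<Longrightarrow> a = b"
    and m: "m \<in> lists W" "m' \<in> lists W" "blocks x (map wd m) \<simeq> blocks x (map wd m')"
  shows "m = m'"
proof -
  have "list_all2 trace_eq (map wd m) (map wd m')"
    using m W by (intro blocks_unique[of _ _ x]) auto
  then have "list_all2 (\<lambda>a b. wd a \<simeq> wd b) m m'" by (simp add: list.rel_map)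
  then have "list_all2 (=) m m'" using m(1,2) inj
    by (induct rule: list_all2_induct) auto
  then show ?thesis by (simp add: list.rel_eq)
qed

text \<open>Dually to the substitution \<open>subst\<close> being injective with torsion-free cokernel: modulo terms with
  smaller \<open>disp\<close>, it maps a product of pyramids to itself, so that \<open>f\<close> can be found by recursion.\<close>

lemma subst_dual_surj:
  fixes W :: "'m set" and wd :: "'m \<Rightarrow> 'l list" and f' :: "'m list \<Rightarrow> int"
  assumes W: "\<And>a. a \<in> W \<Longrightarrow> pyramid x (wd a) \<and> x \<notin> set (wd a)"
    and inj: "\<And>a b. a \<in> W \<Longrightarrow> b \<in> W \<Longrightarrow> wd a \<simeq> wd b \<Longrightarrow> a = b"
    and E: "\<And>a. a \<in> W \<Longrightarrow> E a = lnb x (wd a)"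
  obtains f where "invariant f" "\<And>m. m \<in> lists W \<Longrightarrow> pair f (evalw E m) = f' m"
    "\<And>t. t \<noteq> [] \<Longrightarrow> x \<notin> set t \<Longrightarrow> f t = 0"
proof -
  define flat where "flat m = blocks x (map wd m)" for m
  have uniq: "m = m'" if "m \<in> lists W" "m' \<in> lists W" "flat m \<simeq> flat m'" for m m'
    by (rule blocks_inj[OF W inj that(1,2) that(3)[unfolded flat_def]])
  have ld: "lead x (evalw E m) (flat m)" if "m \<in> lists W" for m
    using that
  proof (induct m)
    case Nil
    then show ?case by (simp add: flat_def lead_def one_frag)
  next
    case (Cons a m)
    then have "lead x (E a * evalw E m) ((x # wd a) @ flat m)"
      using W E by (intro lead_mult) (auto simp: lead_lnb)
    then show ?case by (simp add: flat_def)
  qed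
  \<comment> \<open>\<open>ext g\<close> transports \<open>g\<close> from words over
    \<open>W\<close> to traces, which is unambiguous by \<open>uniq\<close>. Traces that are not
    products of pyramids named by \<open>W\<close> get the value 0.\<close>
  define ext where "ext g t = (if \<exists>m\<in>lists W. flat m \<simeq> t then g (THE m. m \<in> lists W \<and> flat m \<simeq> t) else 0)"
    for g :: "'m list \<Rightarrow> int" and t
  have the: "(THE m. m \<in> lists W \<and> flat m \<simeq> t) = m" if "m \<in> lists W" "flat m \<simeq> t" for m t
  proof (rule the_equality)
    show "m \<in> lists W \<and> flat m \<simeq> t" using that by simp
    fix m' assume m': "m' \<in> lists W \<and> flat m' \<simeq> t"
    then have "flat m' \<simeq> flat m" using trace_sym[OF that(2)] by auto
    then show "m' = m" using uniq m' that(1) by auto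
  qed
  have ext_eq: "ext g t = g m" if "m \<in> lists W" "flat m \<simeq> t" for g m t
    using that the[OF that] unfolding ext_def by auto
  \<comment> \<open>This is the required equation \<open>pair f (evalw E m) = f' m\<close>, solved
    for the value of \<open>f\<close> at the leading word \<open>flat m\<close>.\<close>
  define step where "step g m = f' m - pair (ext g) (evalw E m - frag_of (flat m))" for g m
  define r where "r = measure (\<lambda>m. disp x (flat m))"
  define val where "val = wfrec r step"
  have val: "val m = step val m" if m: "m \<in> lists W" for m
  proof -
    have "val m = step (cut val r m) m" unfolding val_def by (rule wfrec) (simp add: r_def)
    also have "\<dots> = step val m"
    proof -
      \<comment> \<open>The recursion only calls smaller arguments: \<open>t\<close> need not be the
        word \<open>flat m'\<close> itself, but \<open>disp_blocks_le\<close> gives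
        \<open>disp x (flat m') \<le> disp x t\<close>.\<close>
      have "ext (cut val r m) t = ext val t"
        if "t \<in> Poly_Mapping.keys (evalw E m - frag_of (flat m))" for t
      proof (cases "\<exists>m\<in>lists W. flat m \<simeq> t")
        case True
        then obtain m' where m': "m' \<in> lists W" "flat m' \<simeq> t" by auto
        then have "disp x (flat m') \<le> disp x t"
          using W unfolding flat_def by (intro disp_blocks_le) auto
        also have "disp x t < disp x (flat m)" using ld[OF m] that by (auto simp: lead_def)
        finally show ?thesis using ext_eq[OF m'] by (simp add: cut_def r_def)
      qed (simp add: ext_def)
      then show ?thesis unfolding step_def by (simp cong: pair_cong)
    qed
    finally show ?thesis .
  qed
  show thesis
  proof (rule that)
    show "invariant (ext val)" unfolding invariant_def
    proof (intro allI impI)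
      fix u v assume uv: "u \<simeq> v"
      show "ext val u = ext val v"
      proof (cases "\<exists>m\<in>lists W. flat m \<simeq> u")
        case True
        then obtain m where m: "m \<in> lists W" "flat m \<simeq> u" by auto
        then have "flat m \<simeq> v" using uv by auto
        then show ?thesis using ext_eq m by metis
      next
        case False
        then have "\<not> (\<exists>m\<in>lists W. flat m \<simeq> v)"
          using trace_sym[OF uv] by (auto dest: rtranclp_trans)
        then show ?thesis using False by (simp add: ext_def)
      qed
    qed
    show "pair (ext val) (evalw E m) = f' m" if m: "m \<in> lists W" for m
      using val[OF m] ext_eq[OF m, of "flat m" val] by (simp add: step_def pair_diff)
    show "ext val t = 0" if t: "t \<noteq> []" "x \<notin> set t" for t
    proof -
      have "\<not> flat m \<simeq> t" for m
        using t trace_set[of "flat m" t] by (cases m) (auto simp: flat_def)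
      then show ?thesis by (simp add: ext_def)
    qed
  qed
qed

end


section \<open>The lower central series\<close>

declare lower_central.simps [simp del]

context group
begin

abbreviation \<gamma> :: "nat \<Rightarrow> 'a set" where "\<gamma> \<equiv> lower_central G"

definition gcomm :: "'a \<Rightarrow> 'a \<Rightarrow> 'a" where
  "gcomm g h = g \<otimes> h \<otimes> inv g \<otimes> inv h"

lemma gcomm_closed [simp]: "g \<in> carrier G \<Longrightarrow> h \<in> carrier G \<Longrightarrow> gcomm g h \<in> carrier G"
  by (simp add: gcomm_def)

lemma inv_cancel [simp]:
  "x \<in> carrier G \<Longrightarrow> y \<in> carrier G \<Longrightarrow> x \<otimes> (inv x \<otimes> y) = y"
  "x \<in> carrier G \<Longrightarrow> y \<in> carrier G \<Longrightarrow> inv x \<otimes> (x \<otimes> y) = y"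
  by (simp_all flip: m_assoc)

lemma gcomm_mult_left:
  "\<lbrakk>x \<in> carrier G; y \<in> carrier G; z \<in> carrier G\<rbrakk> \<Longrightarrow>
    gcomm (x \<otimes> y) z = x \<otimes> gcomm y z \<otimes> inv x \<otimes> gcomm x z"
  by (simp add: gcomm_def m_assoc inv_mult_group)

lemma gcomm_mult_right:
  "\<lbrakk>x \<in> carrier G; y \<in> carrier G; z \<in> carrier G\<rbrakk> \<Longrightarrow>
    gcomm x (y \<otimes> z) = gcomm x y \<otimes> (y \<otimes> gcomm x z \<otimes> inv y)"
  by (simp add: gcomm_def m_assoc inv_mult_group)

lemma inv_gcomm: "\<lbrakk>x \<in> carrier G; y \<in> carrier G\<rbrakk> \<Longrightarrow> inv (gcomm x y) = gcomm y x"
  by (simp add: gcomm_def m_assoc inv_mult_group)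

lemma conj_gcomm: "\<lbrakk>x \<in> carrier G; y \<in> carrier G\<rbrakk> \<Longrightarrow> x \<otimes> y \<otimes> inv x = gcomm x y \<otimes> y"
  by (simp add: gcomm_def m_assoc)

text \<open>Both sides are the conjugate of \<open>gcomm a b\<close> by \<open>c\<close>. This
  identity is the source of both \<open>\<gamma>_gcomm\<close> and the Jacobi identity
  \<open>gr_jacobi\<close>.\<close>

lemma gcomm_gcomm:
  assumes "a \<in> carrier G" "b \<in> carrier G" "c \<in> carrier G"
  shows "gcomm c (gcomm a b) \<otimes> gcomm a b = gcomm (gcomm c a \<otimes> a) (gcomm c b \<otimes> b)"
  using assms by (simp add: gcomm_def m_assoc inv_mult_group)

lemma \<gamma>_subgroup: "subgroup (\<gamma> k) G"
  using lower_central_normal normal_imp_subgroup by blast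

lemma \<gamma>_carrier: "g \<in> \<gamma> k \<Longrightarrow> g \<in> carrier G"
  using \<gamma>_subgroup subgroup.subset by blast

lemma \<gamma>_1 [simp]: "\<gamma> (Suc 0) = carrier G" "\<gamma> 0 = carrier G"
  by (simp_all add: lower_central.simps)

lemma \<gamma>_mult: "g \<in> \<gamma> k \<Longrightarrow> h \<in> \<gamma> k \<Longrightarrow> g \<otimes> h \<in> \<gamma> k"
  and \<gamma>_inv: "g \<in> \<gamma> k \<Longrightarrow> inv g \<in> \<gamma> k"
  and \<gamma>_one: "\<one> \<in> \<gamma> k"
  using \<gamma>_subgroup[of k] by (auto simp: subgroup.m_closed subgroup.m_inv_closed subgroup.one_closed)

lemma \<gamma>_conj: "g \<in> carrier G \<Longrightarrow> h \<in> \<gamma> k \<Longrightarrow> g \<otimes> h \<otimes> inv g \<in> \<gamma> k"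
  by (rule normal.inv_op_closed2[OF lower_central_normal])

lemma \<gamma>_antimono: "i \<le> j \<Longrightarrow> \<gamma> j \<subseteq> \<gamma> i"
  by (rule lift_Suc_antimono_le) (rule lower_central_decseq)

lemma \<gamma>_mono: "g \<in> \<gamma> j \<Longrightarrow> i \<le> j \<Longrightarrow> g \<in> \<gamma> i"
  using \<gamma>_antimono by blast

lemma \<gamma>_Suc: "k \<ge> 1 \<Longrightarrow> \<gamma> (Suc k) = generate G {gcomm h g | h g. h \<in> \<gamma> k \<and> g \<in> carrier G}"
  by (cases k) (auto simp: lower_central.simps comm_subgroup_def gcomm_def intro!: arg_cong[of _ _ "generate G"])

lemma \<gamma>_gcomm_Suc: "k \<ge> 1 \<Longrightarrow> h \<in> \<gamma> k \<Longrightarrow> g \<in> carrier G \<Longrightarrow> gcomm h g \<in> \<gamma> (Suc k)"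
  by (subst \<gamma>_Suc) (auto intro: generate.incl)

lemma \<gamma>_Suc_induct [consumes 2, case_names gcomm mult inv]:
  assumes "x \<in> \<gamma> (Suc k)" "k \<ge> 1"
    and "\<And>h g. h \<in> \<gamma> k \<Longrightarrow> g \<in> carrier G \<Longrightarrow> P (gcomm h g)"
    and "\<And>x y. x \<in> \<gamma> (Suc k) \<Longrightarrow> y \<in> \<gamma> (Suc k) \<Longrightarrow> P x \<Longrightarrow> P y \<Longrightarrow> P (x \<otimes> y)"
    and "\<And>x. x \<in> \<gamma> (Suc k) \<Longrightarrow> P x \<Longrightarrow> P (inv x)"
  shows "P x"
proof -
  let ?S = "{gcomm h g | h g. h \<in> \<gamma> k \<and> g \<in> carrier G}"
  have "x \<in> generate G ?S" using assms(1,2) \<gamma>_Suc by auto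
  then have "x \<in> \<gamma> (Suc k) \<and> P x"
  proof induct
    case one
    \<comment> \<open>The unit is itself a commutator, so the induction rule has no separate case
      for it.\<close>
    have "gcomm \<one> \<one> = \<one>" by (simp add: gcomm_def)
    then show ?case using assms(3)[of \<one> \<one>] \<gamma>_one by auto
  next
    case (eng h1 h2)
    then show ?case using assms(4) \<gamma>_mult by auto
  qed (use assms(2,3,5) \<gamma>_gcomm_Suc \<gamma>_inv in auto)
  then show ?thesis by simp
qed

section \<open>Graded pieces of the lower central series\<close>

definition gr :: "nat \<Rightarrow> 'a \<Rightarrow> 'a set" where
  "gr k g = \<gamma> (Suc k) #> g"

text \<open>This is the whole quotient by \<open>\<gamma> (Suc k)\<close>, not just the graded
  piece. The piece consists of the classes of elements of \<open>\<gamma> k\<close> and is central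
  by \<open>gr_central\<close>.\<close>

definition Gr :: "nat \<Rightarrow> 'a set monoid" where
  "Gr k = G Mod \<gamma> (Suc k)"

lemma gr_group: "group (Gr k)"
  unfolding Gr_def by (rule normal.factorgroup_is_group[OF lower_central_normal])

lemma gr_hom: "group_hom G (Gr k) (gr k)"
  using normal.r_coset_hom_Mod[OF lower_central_normal] gr_group is_group
  unfolding group_hom_def group_hom_axioms_def gr_def[abs_def] Gr_def by auto

lemma gr_closed [simp]: "g \<in> carrier G \<Longrightarrow> gr k g \<in> carrier (Gr k)"
  using group_hom.hom_closed[OF gr_hom] .

lemma gr_mult [simp]: "g \<in> carrier G \<Longrightarrow> h \<in> carrier G \<Longrightarrow> gr k (g \<otimes> h) = gr k g \<otimes>\<^bsub>Gr k\<^esub> gr k h"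
  using group_hom.hom_mult[OF gr_hom] .

lemma gr_inv [simp]: "g \<in> carrier G \<Longrightarrow> gr k (inv g) = inv\<^bsub>Gr k\<^esub> gr k g"
  using group_hom.hom_inv[OF gr_hom] .

lemma gr_one [simp]: "gr k \<one> = \<one>\<^bsub>Gr k\<^esub>"
  using group_hom.hom_one[OF gr_hom] .

lemma gr_eq_one_iff: "g \<in> carrier G \<Longrightarrow> gr k g = \<one>\<^bsub>Gr k\<^esub> \<longleftrightarrow> g \<in> \<gamma> (Suc k)"
  using coset_join1[OF _ _ \<gamma>_subgroup] coset_join2[OF _ \<gamma>_subgroup]
  unfolding gr_def Gr_def FactGroup_def by fastforce

lemma gr_eq_iff:
  assumes "g \<in> carrier G" "h \<in> carrier G"
  shows "gr k g = gr k h \<longleftrightarrow> g \<otimes> inv h \<in> \<gamma> (Suc k)"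
proof -
  interpret Q: group "Gr k" by (rule gr_group)
  have "g \<otimes> inv h \<in> \<gamma> (Suc k) \<longleftrightarrow> gr k g \<otimes>\<^bsub>Gr k\<^esub> inv\<^bsub>Gr k\<^esub> gr k h = \<one>\<^bsub>Gr k\<^esub>"
    using assms by (simp flip: gr_eq_one_iff)
  also have "\<dots> \<longleftrightarrow> gr k g = gr k h"
    using assms Q.inv_solve_right'[of "\<one>\<^bsub>Gr k\<^esub>" "gr k g" "gr k h"] by auto
  finally show ?thesis by simp
qed

lemma gr_mem:
  assumes "gr k g = gr k h" "g \<in> carrier G" "h \<in> \<gamma> j" "j \<le> Suc k" shows "g \<in> \<gamma> j"
proof -
  have "g \<otimes> inv h \<in> \<gamma> j" using assms gr_eq_iff[of g h k] \<gamma>_carrier[OF assms(3)] \<gamma>_mono by auto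
  then have "g \<otimes> inv h \<otimes> h \<in> \<gamma> j" using assms \<gamma>_mult by blast
  then show ?thesis using assms(2) \<gamma>_carrier[OF assms(3)] by (simp add: m_assoc)
qed

lemma gr_central:
  assumes "g \<in> \<gamma> k" "h \<in> carrier G"
  shows "gr k g \<otimes>\<^bsub>Gr k\<^esub> gr k h = gr k h \<otimes>\<^bsub>Gr k\<^esub> gr k g"
proof (cases k)
  \<comment> \<open>\<open>\<gamma> 0\<close> and \<open>\<gamma> (Suc 0)\<close> are both the whole
    group, so \<open>Gr 0\<close> is trivial.\<close>
  case 0
  then have "gr k x = \<one>\<^bsub>Gr k\<^esub>" if "x \<in> carrier G" for x
    using that gr_eq_one_iff[of x k] by simp
  then show ?thesis using assms \<gamma>_carrier by simp
next
  case (Suc n)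
  have g: "g \<in> carrier G" using assms \<gamma>_carrier by auto
  have "(g \<otimes> h) \<otimes> inv (h \<otimes> g) \<in> \<gamma> (Suc k)"
    using \<gamma>_gcomm_Suc[OF _ assms] Suc g assms(2) by (simp add: gcomm_def inv_mult_group m_assoc)
  then show ?thesis using gr_eq_iff[of "g \<otimes> h" "h \<otimes> g" k] g assms by simp
qed

lemma gr_conj:
  assumes "g \<in> \<gamma> k" "h \<in> carrier G" shows "gr k (h \<otimes> g \<otimes> inv h) = gr k g"
proof -
  interpret Q: group "Gr k" by (rule gr_group)
  have g: "g \<in> carrier G" using assms \<gamma>_carrier by auto
  have "gr k (h \<otimes> g \<otimes> inv h) = gr k g \<otimes>\<^bsub>Gr k\<^esub> gr k h \<otimes>\<^bsub>Gr k\<^esub> inv\<^bsub>Gr k\<^esub> gr k h"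
    using g assms gr_central[OF assms] by simp
  then show ?thesis using g assms by (simp add: Q.m_assoc)
qed

text \<open>Induction on \<open>j\<close>. For a generator \<open>gcomm b c\<close> of
  \<open>\<gamma> (Suc j)\<close>, conjugation by \<open>a\<close> multiplies \<open>b\<close> and
  \<open>c\<close> on the left by \<open>gcomm a b\<close> and \<open>gcomm a c\<close>, and neither
  factor changes the commutator modulo \<open>\<gamma> (Suc (i + j))\<close>.\<close>

lemma \<gamma>_gcomm:
  "i \<ge> 1 \<Longrightarrow> j \<ge> 1 \<Longrightarrow> a \<in> \<gamma> i \<Longrightarrow> b \<in> \<gamma> j \<Longrightarrow> gcomm a b \<in> \<gamma> (i + j)"
proof (induct j arbitrary: i a b)
  case (Suc j)
  show ?case
  proof (cases "j = 0")
    case True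
    then show ?thesis using Suc \<gamma>_gcomm_Suc[of i a b] \<gamma>_carrier by simp
  next
    case False
    let ?k = "i + j"
    interpret Q: group "Gr ?k" by (rule gr_group)
    have IH: "\<And>i a b. 1 \<le> i \<Longrightarrow> a \<in> \<gamma> i \<Longrightarrow> b \<in> \<gamma> j \<Longrightarrow> gcomm a b \<in> \<gamma> (i + j)"
      using Suc(1) False by simp
    have j: "1 \<le> j" "1 \<le> i" using Suc(2) False by auto
    have a: "a \<in> \<gamma> i" "a \<in> carrier G" using Suc(4) \<gamma>_carrier by auto
    have "gcomm a b \<in> \<gamma> (Suc ?k)" using Suc(5) j(1)
    proof (induct rule: \<gamma>_Suc_induct)
      case (gcomm b c)
      have c: "b \<in> carrier G" "c \<in> carrier G" using gcomm \<gamma>_carrier by auto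
      let ?x = "gcomm a b" and ?y = "gcomm a c" and ?bc = "local.gcomm b c"
      have x: "?x \<in> \<gamma> ?k" using IH j a gcomm by auto
      have y: "?y \<in> \<gamma> (Suc i)" using \<gamma>_gcomm_Suc j a c by auto
      have bc: "?bc \<in> \<gamma> j" using \<gamma>_gcomm_Suc[OF j(1)] gcomm \<gamma>_mono[of _ "Suc j" j] by auto
      have car: "?x \<in> carrier G" "?y \<in> carrier G" "?bc \<in> carrier G" using a c by auto
      have 1: "gr ?k (local.gcomm ?x (?y \<otimes> c)) = \<one>\<^bsub>Gr ?k\<^esub>"
        using \<gamma>_gcomm_Suc[OF _ x, of "?y \<otimes> c"] j car c by (subst gr_eq_one_iff) auto
      have 2: "gr ?k (local.gcomm b ?y) = \<one>\<^bsub>Gr ?k\<^esub>"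
      proof -
        \<comment> \<open>Here the induction hypothesis is applied with \<open>Suc i\<close>, which
          is why \<open>i\<close> is kept arbitrary.\<close>
        have "local.gcomm ?y b \<in> \<gamma> (Suc ?k)" using IH[of "Suc i" ?y b] y gcomm by auto
        then have "local.gcomm b ?y \<in> \<gamma> (Suc ?k)" using \<gamma>_inv inv_gcomm[of ?y b] car c by metis
        then show ?thesis using car c by (subst gr_eq_one_iff) auto
      qed
      have 3: "gr ?k (local.gcomm ?y ?bc) = \<one>\<^bsub>Gr ?k\<^esub>"
        using IH[OF _ y bc] car by (subst gr_eq_one_iff) auto
      have 4: "gr ?k (local.gcomm b (?y \<otimes> c)) = gr ?k ?bc"
        using car c 2 3 by (simp add: gcomm_mult_right conj_gcomm)
      have "gr ?k (local.gcomm a ?bc \<otimes> ?bc) = gr ?k (local.gcomm (?x \<otimes> b) (?y \<otimes> c))"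
        using a c by (simp add: gcomm_gcomm)
      also have "\<dots> = gr ?k (?x \<otimes> local.gcomm b (?y \<otimes> c) \<otimes> inv ?x)"
        using car c 1 by (simp add: gcomm_mult_left)
      also have "\<dots> = gr ?k ?bc"
        using car c 4 gr_central[OF x, of "local.gcomm b (?y \<otimes> c)"] by (simp add: Q.m_assoc)
      finally have "gr ?k (local.gcomm a ?bc) = \<one>\<^bsub>Gr ?k\<^esub>" using a car by simp
      then show ?case using a car by (subst (asm) gr_eq_one_iff) auto
    next
      case (mult x y)
      then show ?case using a \<gamma>_carrier by (simp add: gcomm_mult_right \<gamma>_mult \<gamma>_conj)
    next
      case (inv x)
      have x: "x \<in> carrier G" using inv \<gamma>_carrier by auto
      have "gcomm a (inv x) = inv x \<otimes> inv (gcomm a x) \<otimes> inv (inv x)"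
        using a x by (simp add: gcomm_def m_assoc inv_mult_group)
      then show ?case using inv x \<gamma>_conj[of "inv x"] \<gamma>_inv by simp
    qed
    then show ?thesis by simp
  qed
qed simp

section \<open>The commutator as a Lie bracket on the graded pieces\<close>

lemma gr_gcomm_one:
  assumes "i \<ge> 1" "j \<ge> 1" "a \<in> \<gamma> i" "b \<in> \<gamma> j" "i + j > k"
  shows "gr k (gcomm a b) = \<one>\<^bsub>Gr k\<^esub>"
  using \<gamma>_mono[OF \<gamma>_gcomm[OF assms(1-4)], of "Suc k"] assms \<gamma>_carrier
  by (subst gr_eq_one_iff) auto

lemma gr_gcomm_mult_left:
  assumes "i \<ge> 1" "j \<ge> 1" "a \<in> \<gamma> i" "a' \<in> \<gamma> i" "b \<in> \<gamma> j"
  shows "gr (i + j) (gcomm (a \<otimes> a') b) = gr (i + j) (gcomm a b) \<otimes>\<^bsub>Gr (i + j)\<^esub> gr (i + j) (gcomm a' b)"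
proof -
  have c: "a \<in> carrier G" "a' \<in> carrier G" "b \<in> carrier G" using assms \<gamma>_carrier by auto
  have "gr (i + j) (a \<otimes> gcomm a' b \<otimes> inv a) = gr (i + j) (gcomm a' b)"
    using assms c by (intro gr_conj \<gamma>_gcomm) auto
  then have "gr (i + j) (gcomm (a \<otimes> a') b) = gr (i + j) (gcomm a' b) \<otimes>\<^bsub>Gr (i + j)\<^esub> gr (i + j) (gcomm a b)"
    using c gcomm_mult_left[of a a' b] gr_mult[of "a \<otimes> gcomm a' b \<otimes> inv a" "gcomm a b" "i + j"]
    by (simp del: gr_mult)
  then show ?thesis using assms c gr_central[OF \<gamma>_gcomm[of i j a b], of "gcomm a' b"] by simp
qed

lemma gr_gcomm_mult_right:
  assumes "i \<ge> 1" "j \<ge> 1" "a \<in> \<gamma> i" "b \<in> \<gamma> j" "b' \<in> \<gamma> j"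
  shows "gr (i + j) (gcomm a (b \<otimes> b')) = gr (i + j) (gcomm a b) \<otimes>\<^bsub>Gr (i + j)\<^esub> gr (i + j) (gcomm a b')"
proof -
  have c: "a \<in> carrier G" "b \<in> carrier G" "b' \<in> carrier G" using assms \<gamma>_carrier by auto
  have "gr (i + j) (b \<otimes> gcomm a b' \<otimes> inv b) = gr (i + j) (gcomm a b')"
    using assms c by (intro gr_conj \<gamma>_gcomm) auto
  then show ?thesis
    using c gcomm_mult_right[of a b b'] gr_mult[of "gcomm a b" "b \<otimes> gcomm a b' \<otimes> inv b" "i + j"]
    by (simp del: gr_mult)
qed

lemma gr_gcomm_inv_left:
  assumes "i \<ge> 1" "j \<ge> 1" "a \<in> \<gamma> i" "b \<in> \<gamma> j"
  shows "gr (i + j) (gcomm (inv a) b) = inv\<^bsub>Gr (i + j)\<^esub> gr (i + j) (gcomm a b)"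
proof -
  interpret Q: group "Gr (i + j)" by (rule gr_group)
  have c: "a \<in> carrier G" "b \<in> carrier G" using assms \<gamma>_carrier by auto
  have "gcomm \<one> b = \<one>" using c by (simp add: gcomm_def)
  then have "gr (i + j) (gcomm (inv a) b) \<otimes>\<^bsub>Gr (i + j)\<^esub> gr (i + j) (gcomm a b) = \<one>\<^bsub>Gr (i + j)\<^esub>"
    using gr_gcomm_mult_left[OF assms(1,2) \<gamma>_inv[OF assms(3)] assms(3,4)] c by simp
  then show ?thesis using c Q.inv_equality by auto
qed

lemma gr_gcomm_inv_right:
  assumes "i \<ge> 1" "j \<ge> 1" "a \<in> \<gamma> i" "b \<in> \<gamma> j"
  shows "gr (i + j) (gcomm a (inv b)) = inv\<^bsub>Gr (i + j)\<^esub> gr (i + j) (gcomm a b)"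
proof -
  have c: "a \<in> carrier G" "b \<in> carrier G" using assms \<gamma>_carrier by auto
  have "gr (i + j) (gcomm a (inv b)) = inv\<^bsub>Gr (i + j)\<^esub> gr (i + j) (gcomm (inv b) a)"
    using c gr_inv[of "gcomm (inv b) a" "i + j"] inv_gcomm[of "inv b" a] by simp
  also have "gr (i + j) (gcomm (inv b) a) = inv\<^bsub>Gr (i + j)\<^esub> gr (i + j) (gcomm b a)"
    using gr_gcomm_inv_left[OF assms(2,1,4,3)] by (simp add: add.commute)
  also have "\<dots> = gr (i + j) (gcomm a b)"
    using c gr_inv[of "gcomm b a" "i + j"] inv_gcomm[of b a] by simp
  finally show ?thesis .
qed

text \<open>The arguments differ by an element of \<open>\<gamma> (Suc i)\<close>, whose commutator
  with \<open>b\<close> has degree above \<open>i + j\<close>. So the bracket is well defined on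
  graded pieces.\<close>

lemma gr_gcomm_cong_left:
  assumes "i \<ge> 1" "j \<ge> 1" "a \<in> \<gamma> i" "a' \<in> \<gamma> i" "b \<in> \<gamma> j" "gr i a = gr i a'"
  shows "gr (i + j) (gcomm a b) = gr (i + j) (gcomm a' b)"
proof -
  interpret Q: group "Gr (i + j)" by (rule gr_group)
  have c: "a \<in> carrier G" "a' \<in> carrier G" "b \<in> carrier G" using assms \<gamma>_carrier by auto
  have d: "a \<otimes> inv a' \<in> \<gamma> (Suc i)" using assms(6) c gr_eq_iff by auto
  have "gr (i + j) (gcomm (a \<otimes> inv a' \<otimes> a') b) =
      gr (i + j) (gcomm (a \<otimes> inv a') b) \<otimes>\<^bsub>Gr (i + j)\<^esub> gr (i + j) (gcomm a' b)"
    using assms \<gamma>_mult \<gamma>_inv by (intro gr_gcomm_mult_left) auto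
  also have "gr (i + j) (gcomm (a \<otimes> inv a') b) = \<one>\<^bsub>Gr (i + j)\<^esub>"
    using assms(2,5) d by (intro gr_gcomm_one[of "Suc i" j]) auto
  finally show ?thesis using c by (simp add: m_assoc)
qed

lemma gr_gcomm_cong_right:
  assumes "i \<ge> 1" "j \<ge> 1" "a \<in> \<gamma> i" "b \<in> \<gamma> j" "b' \<in> \<gamma> j" "gr j b = gr j b'"
  shows "gr (i + j) (gcomm a b) = gr (i + j) (gcomm a b')"
proof -
  have c: "a \<in> carrier G" "b \<in> carrier G" "b' \<in> carrier G" using assms \<gamma>_carrier by auto
  have "gr (j + i) (gcomm b a) = gr (j + i) (gcomm b' a)"
    using assms by (intro gr_gcomm_cong_left) auto
  then have "gr (i + j) (inv (gcomm b a)) = gr (i + j) (inv (gcomm b' a))"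
    using c by (simp add: add.commute)
  then show ?thesis using c by (simp only: inv_gcomm)
qed

text \<open>Both sides of \<open>gcomm_gcomm\<close> are expanded modulo
  \<open>\<gamma> (Suc N)\<close>. The commutators in facts \<open>1\<close>, \<open>2\<close> and
  \<open>3\<close> have degree above \<open>N\<close> and disappear; this leaves
  \<open>gcomm c (gcomm a b)\<close> as a product of two commutators, and taking inverses puts the
  arguments in the stated order.\<close>

lemma gr_jacobi:
  assumes ijk: "i \<ge> 1" "j \<ge> 1" "k \<ge> 1" and abc: "a \<in> \<gamma> i" "b \<in> \<gamma> j" "c \<in> \<gamma> k" and N: "N = i + j + k"
  shows "gr N (gcomm (gcomm a b) c) = gr N (gcomm (gcomm a c) b) \<otimes>\<^bsub>Gr N\<^esub> gr N (gcomm a (gcomm b c))"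
proof -
  interpret Q: group "Gr N" by (rule gr_group)
  have car: "a \<in> carrier G" "b \<in> carrier G" "c \<in> carrier G" using abc \<gamma>_carrier by auto
  let ?x = "gcomm c a" and ?y = "gcomm c b"
  let ?z = "?y \<otimes> b"
  have x: "?x \<in> \<gamma> (k + i)" and y: "?y \<in> \<gamma> (k + j)" and ab: "gcomm a b \<in> \<gamma> (i + j)"
    using ijk abc \<gamma>_gcomm by auto
  have z: "?z \<in> \<gamma> j" using y abc \<gamma>_mult \<gamma>_mono[of _ "k + j" j] by auto
  have cx: "?x \<in> carrier G" "?y \<in> carrier G" "gcomm a b \<in> carrier G" "?z \<in> carrier G" using car by auto
  have "gcomm a ?z \<in> \<gamma> (i + j)" using ijk abc z \<gamma>_gcomm by auto
  then have 1: "gr N (gcomm ?x (gcomm a ?z)) = \<one>\<^bsub>Gr N\<^esub>"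
    using ijk x by (intro gr_gcomm_one[of "k + i" "i + j"]) (auto simp: N)
  have 2: "gr N (gcomm ?x ?y) = \<one>\<^bsub>Gr N\<^esub>"
    using ijk x y by (intro gr_gcomm_one[of "k + i" "k + j"]) (auto simp: N)
  have 3: "gr N (gcomm ?y (gcomm a b)) = \<one>\<^bsub>Gr N\<^esub>"
    using ijk y ab by (intro gr_gcomm_one[of "k + j" "i + j"]) (auto simp: N)
  have 5: "gr N (?y \<otimes> gcomm ?x b \<otimes> inv ?y) = gr N (gcomm ?x b)"
    using \<gamma>_gcomm[of "k + i" j ?x b] ijk x abc car by (intro gr_conj) (auto simp: N ac_simps)
  have xb: "gcomm ?x b \<in> \<gamma> N" using \<gamma>_gcomm[of "k + i" j ?x b] ijk x abc by (simp add: N ac_simps)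
  have xz: "gr N (gcomm ?x ?z) = gr N (gcomm ?x b)"
    using cx car 2 5 gcomm_mult_right[of ?x ?y b] gr_mult[of "gcomm ?x ?y" "?y \<otimes> gcomm ?x b \<otimes> inv ?y" N]
    by (simp del: gr_mult)
  have az: "gr N (gcomm a ?z) = gr N (gcomm a ?y) \<otimes>\<^bsub>Gr N\<^esub> gr N (gcomm a b)"
    using cx car 3 by (simp add: gcomm_mult_right conj_gcomm)
  have "gr N (gcomm c (gcomm a b)) \<otimes>\<^bsub>Gr N\<^esub> gr N (gcomm a b) = gr N (gcomm (?x \<otimes> a) ?z)"
    using car cx by (simp flip: gr_mult add: gcomm_gcomm)
  also have "\<dots> = gr N (gcomm a ?z) \<otimes>\<^bsub>Gr N\<^esub> gr N (gcomm ?x ?z)"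
    using cx car 1 by (simp add: gcomm_mult_left conj_gcomm)
  also have "\<dots> = gr N (gcomm a ?y) \<otimes>\<^bsub>Gr N\<^esub> (gr N (gcomm a b) \<otimes>\<^bsub>Gr N\<^esub> gr N (gcomm ?x b))"
    using cx car az xz by (simp add: Q.m_assoc)
  also have "\<dots> = gr N (gcomm a ?y) \<otimes>\<^bsub>Gr N\<^esub> gr N (gcomm ?x b) \<otimes>\<^bsub>Gr N\<^esub> gr N (gcomm a b)"
    using cx car gr_central[OF xb cx(3)] by (simp add: Q.m_assoc)
  finally have "gr N (gcomm c (gcomm a b)) = gr N (gcomm a ?y) \<otimes>\<^bsub>Gr N\<^esub> gr N (gcomm ?x b)"
    using cx car by simp
  then have "inv\<^bsub>Gr N\<^esub> gr N (gcomm c (gcomm a b)) =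
      inv\<^bsub>Gr N\<^esub> gr N (gcomm ?x b) \<otimes>\<^bsub>Gr N\<^esub> inv\<^bsub>Gr N\<^esub> gr N (gcomm a ?y)"
    using cx car by (simp add: Q.inv_mult_group)
  moreover have "inv\<^bsub>Gr N\<^esub> gr N (gcomm c (gcomm a b)) = gr N (gcomm (gcomm a b) c)"
    using cx car inv_gcomm[of c "gcomm a b"] gr_inv[of "gcomm c (gcomm a b)" N] by simp
  moreover have "inv\<^bsub>Gr N\<^esub> gr N (gcomm ?x b) = gr N (gcomm (gcomm a c) b)"
    using gr_gcomm_inv_left[of "k + i" j ?x b] ijk x abc car inv_gcomm[of c a] by (simp add: N ac_simps)
  moreover have "inv\<^bsub>Gr N\<^esub> gr N (gcomm a ?y) = gr N (gcomm a (gcomm b c))"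
    using gr_gcomm_inv_right[of i "k + j" a ?y] ijk y abc car inv_gcomm[of c b] by (simp add: N ac_simps)
  ultimately show ?thesis by simp
qed

end


section \<open>Lazard elimination\<close>

context group
begin

text \<open>\<open>Rep e d X k g P\<close>: the class of \<open>g\<close> in \<open>\<gamma> k / \<gamma> (Suc k)\<close> is the value of a Lie
  expression in the letters \<open>X\<close>, a letter \<open>x\<close> having degree \<open>d x\<close> and value \<open>e x\<close>, and \<open>P\<close> is the
  same expression in the free associative ring.\<close>

inductive Rep :: "('l \<Rightarrow> 'a) \<Rightarrow> ('l \<Rightarrow> nat) \<Rightarrow> 'l set \<Rightarrow> nat \<Rightarrow> 'a \<Rightarrow> 'l ncpoly \<Rightarrow> bool"
  for e d X where
  low: "k \<ge> 1 \<Longrightarrow> g \<in> \<gamma> (Suc k) \<Longrightarrow> Rep e d X k g 0"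
| letter: "x \<in> X \<Longrightarrow> Rep e d X (d x) (e x) (frag_of [x])"
| mult: "Rep e d X k g P \<Longrightarrow> Rep e d X k h Q \<Longrightarrow> Rep e d X k (g \<otimes> h) (P + Q)"
| inv: "Rep e d X k g P \<Longrightarrow> Rep e d X k (inv g) (- P)"
| gcomm: "Rep e d X i g P \<Longrightarrow> Rep e d X j h Q \<Longrightarrow> Rep e d X (i + j) (gcomm g h) (brk P Q)"

definition graded :: "('l \<Rightarrow> 'a) \<Rightarrow> ('l \<Rightarrow> nat) \<Rightarrow> 'l set \<Rightarrow> bool" where
  "graded e d X \<longleftrightarrow> (\<forall>x\<in>X. d x \<ge> 1 \<and> e x \<in> \<gamma> (d x))"

lemma Rep_mem:
  assumes "Rep e d X k g P" "graded e d X"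
  shows "k \<ge> 1 \<and> g \<in> \<gamma> k"
  using assms
proof induct
  case (low k g)
  then show ?case using \<gamma>_mono[of g "Suc k" k] by simp
qed (auto simp: graded_def \<gamma>_mult \<gamma>_inv \<gamma>_gcomm)

lemma Rep_keys:
  assumes "Rep e d X k g P" "graded e d X" "w \<in> Poly_Mapping.keys P"
  shows "w \<in> lists X \<and> w \<noteq> [] \<and> sum_list (map d w) = k"
  using assms
proof (induct arbitrary: w)
  case (mult k g P h Q)
  then show ?case using Poly_Mapping.keys_add[of P Q] by blast
next
  case (gcomm i g P j h Q)
  obtain u v where uv: "u \<in> Poly_Mapping.keys P" "v \<in> Poly_Mapping.keys Q" "w = u @ v \<or> w = v @ u"
    using keys_brk[OF gcomm(6)] by auto
  show ?case using gcomm(2)[OF gcomm(5) uv(1)] gcomm(4)[OF gcomm(5) uv(2)] uv(3) by auto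
qed auto

text \<open>The quotient of the two elements enters through the rule \<open>low\<close>, with
  polynomial 0.\<close>

lemma Rep_cong:
  assumes "Rep e d X k g P" "graded e d X" "g' \<in> carrier G" "gr k g' = gr k g"
  shows "Rep e d X k g' P"
proof -
  have g: "k \<ge> 1" "g \<in> carrier G" using Rep_mem[OF assms(1,2)] \<gamma>_carrier by auto
  then have "g' \<otimes> inv g \<in> \<gamma> (Suc k)" using assms gr_eq_iff by auto
  then have "Rep e d X k (g' \<otimes> inv g \<otimes> g) (0 + P)" using g assms by (intro Rep.mult Rep.low)
  then show ?thesis using g assms by (simp add: m_assoc)
qed

end

text \<open>The elements of \<open>W\<close> are names for the pyramids \<open>x # w\<close>:
  \<open>wd_ex\<close> and \<open>wd_inj\<close> make them a system of representatives for the
  traces. How the names are realised is left open here; \<open>Rep_divisible\<close> uses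
  trees.\<close>

locale elimination = group G + commutation \<theta>
  for G (structure) and \<theta> :: "'l \<Rightarrow> 'l \<Rightarrow> bool" +
  fixes e :: "'l \<Rightarrow> 'a" and d :: "'l \<Rightarrow> nat" and X :: "'l set" and x :: 'l
    and e' :: "'m \<Rightarrow> 'a" and d' :: "'m \<Rightarrow> nat" and W :: "'m set" and wd :: "'m \<Rightarrow> 'l list"
  assumes gradedX: "graded e d X"
    and comm: "\<And>a b. a \<in> X \<Longrightarrow> b \<in> X \<Longrightarrow> \<theta> a b \<Longrightarrow> gcomm (e a) (e b) \<in> \<gamma> (Suc (d a + d b))"
    and xX: "x \<in> X"
    and wd: "\<And>a. a \<in> W \<Longrightarrow> wd a \<in> lists (X - {x}) \<and> pyramid x (wd a)"
    and wd_ex: "\<And>w. w \<in> lists (X - {x}) \<Longrightarrow> pyramid x w \<Longrightarrow> \<exists>a\<in>W. wd a \<simeq> w"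
    and wd_inj: "\<And>a b. a \<in> W \<Longrightarrow> b \<in> W \<Longrightarrow> wd a \<simeq> wd b \<Longrightarrow> a = b"
    and e': "\<And>a. a \<in> W \<Longrightarrow> e' a = foldl gcomm (e x) (map e (wd a))"
    and d': "\<And>a. a \<in> W \<Longrightarrow> d' a = d x + sum_list (map d (wd a))"
begin

abbreviation lg :: "'l list \<Rightarrow> 'a" where "lg w \<equiv> foldl gcomm (e x) (map e w)"

abbreviation dw :: "'l list \<Rightarrow> nat" where "dw w \<equiv> d x + sum_list (map d w)"

abbreviation E :: "'m \<Rightarrow> 'l ncpoly" where "E a \<equiv> lnb x (wd a)"

abbreviation Y :: "'l set" where "Y \<equiv> X - {x}"

section \<open>The iterated commutator of a pyramid\<close>

lemma letterD: "a \<in> X \<Longrightarrow> d a \<ge> 1" "a \<in> X \<Longrightarrow> e a \<in> \<gamma> (d a)"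
  using gradedX by (auto simp: graded_def)

lemma gradedY: "graded e d Y"
  using gradedX by (auto simp: graded_def)

lemma fold_mem:
  "i \<ge> 1 \<Longrightarrow> g \<in> \<gamma> i \<Longrightarrow> w \<in> lists X \<Longrightarrow> foldl gcomm g (map e w) \<in> \<gamma> (i + sum_list (map d w))"
proof (induct w arbitrary: g i)
  case (Cons a w)
  then have "gcomm g (e a) \<in> \<gamma> (i + d a)" using letterD by (intro \<gamma>_gcomm) auto
  then show ?case using Cons(1)[of "i + d a" "gcomm g (e a)"] Cons(2-) by (simp add: add.assoc)
qed simp

lemma fold_cong:
  "i \<ge> 1 \<Longrightarrow> g \<in> \<gamma> i \<Longrightarrow> g' \<in> \<gamma> i \<Longrightarrow> gr i g = gr i g' \<Longrightarrow> w \<in> lists X \<Longrightarrow>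
    gr (i + sum_list (map d w)) (foldl gcomm g (map e w)) = gr (i + sum_list (map d w)) (foldl gcomm g' (map e w))"
proof (induct w arbitrary: g g' i)
  case (Cons a w)
  then have "gcomm g (e a) \<in> \<gamma> (i + d a)" "gcomm g' (e a) \<in> \<gamma> (i + d a)"
    using letterD by (auto intro!: \<gamma>_gcomm)
  moreover have "gr (i + d a) (gcomm g (e a)) = gr (i + d a) (gcomm g' (e a))"
    using Cons letterD by (intro gr_gcomm_cong_left) simp_all
  ultimately show ?case using Cons(1)[of "i + d a" "gcomm g (e a)" "gcomm g' (e a)"] Cons(2-)
    by (simp add: add.assoc)
qed simp

lemma lg_mem: "w \<in> lists X \<Longrightarrow> lg w \<in> \<gamma> (dw w)"
  using fold_mem[of "d x" "e x" w] letterD[OF xX] by auto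

text \<open>The group counterpart of the exchange argument in \<open>null_lnb_trace\<close>, again
  by Jacobi.\<close>

lemma lg_swap:
  assumes "p \<in> lists X" "a \<in> X" "b \<in> X" "q \<in> lists X" "\<theta> a b"
  shows "gr (dw (p @ a # b # q)) (lg (p @ a # b # q)) = gr (dw (p @ a # b # q)) (lg (p @ b # a # q))"
proof -
  let ?k = "dw p + d a + d b"
  interpret Q: group "Gr ?k" by (rule gr_group)
  have p: "lg p \<in> \<gamma> (dw p)" using lg_mem assms by auto
  note ab = letterD[OF assms(2)] letterD[OF assms(3)] letterD[OF xX]
  have m: "gcomm (gcomm (lg p) (e a)) (e b) \<in> \<gamma> ?k" "gcomm (gcomm (lg p) (e b)) (e a) \<in> \<gamma> ?k"
    using ab \<gamma>_gcomm[OF _ _ \<gamma>_gcomm[OF _ _ p ab(2)] ab(4)] \<gamma>_gcomm[OF _ _ \<gamma>_gcomm[OF _ _ p ab(4)] ab(2)]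
    by (simp_all add: ac_simps)
  have "gr ?k (gcomm (lg p) (gcomm (e a) (e b))) = \<one>\<^bsub>Gr ?k\<^esub>"
    using p ab comm[OF assms(2,3,5)] by (intro gr_gcomm_one[of "dw p" "Suc (d a + d b)"]) auto
  then have "gr ?k (gcomm (gcomm (lg p) (e a)) (e b)) = gr ?k (gcomm (gcomm (lg p) (e b)) (e a))"
    using gr_jacobi[of "dw p" "d a" "d b" "lg p" "e a" "e b" ?k] p ab m \<gamma>_carrier gr_closed by simp
  then have "gr (?k + sum_list (map d q)) (foldl gcomm (gcomm (gcomm (lg p) (e a)) (e b)) (map e q))
     = gr (?k + sum_list (map d q)) (foldl gcomm (gcomm (gcomm (lg p) (e b)) (e a)) (map e q))"
    using m ab assms(4) by (intro fold_cong) auto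
  then show ?thesis by (simp add: add.assoc)
qed

lemma lg_cong:
  assumes "u \<simeq> v" "u \<in> lists X" shows "gr (dw u) (lg u) = gr (dw u) (lg v)"
  using assms(1)
proof (induct rule: rtranclp_induct)
  case (step y z)
  have y: "y \<in> lists X" using trace_set[OF step(1)] assms(2) by auto
  have s: "dw y = dw u"
    using trace_mset[OF step(1)] by (metis mset_map sum_mset_sum_list)
  obtain p a b q where "y = p @ a # b # q" "z = p @ b # a # q" "\<theta> a b" using step(2) by (rule swapE)
  then show ?case using lg_swap[of p a b q] y step(3) s by auto
qed simp

text \<open>On graded pieces, bracketing with \<open>v\<close> is a derivation. It kills every
  letter of \<open>x # w\<close>, hence the whole iterated bracket.\<close>

lemma lg_commute:
  assumes "v \<in> X" "w \<in> lists X" "\<forall>b\<in>set (x # w). \<theta> v b"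
  shows "gcomm (lg w) (e v) \<in> \<gamma> (Suc (dw w + d v))"
  using assms(2,3)
proof (induct w rule: rev_induct)
  case Nil
  then show ?case using comm[OF xX assms(1)] sym by auto
next
  case (snoc b w)
  let ?k = "dw (w @ [b]) + d v"
  interpret Q: group "Gr ?k" by (rule gr_group)
  have bw: "b \<in> X" "w \<in> lists X" "\<theta> b v" using snoc sym by auto
  note bv = letterD[OF bw(1)] letterD[OF assms(1)] letterD[OF xX]
  have w: "lg w \<in> \<gamma> (dw w)" using lg_mem bw by auto
  have "gr ?k (gcomm (gcomm (lg w) (e v)) (e b)) = \<one>\<^bsub>Gr ?k\<^esub>"
    using snoc bv bw by (intro gr_gcomm_one[of "Suc (dw w + d v)" "d b"]) auto
  moreover have "gr ?k (gcomm (lg w) (gcomm (e b) (e v))) = \<one>\<^bsub>Gr ?k\<^esub>"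
    using w bv comm[OF bw(1) assms(1) bw(3)] by (intro gr_gcomm_one[of "dw w" "Suc (d b + d v)"]) auto
  ultimately have "gr ?k (gcomm (gcomm (lg w) (e b)) (e v)) = \<one>\<^bsub>Gr ?k\<^esub>"
    using gr_jacobi[of "dw w" "d b" "d v" "lg w" "e b" "e v" ?k] w bv Q.r_one[OF Q.one_closed] by simp
  then show ?case using w bv \<gamma>_carrier by (subst (asm) gr_eq_one_iff) auto
qed

section \<open>Splitting off a letter\<close>

lemma gradedW: "graded e' d' W"
  unfolding graded_def
proof
  fix a assume a: "a \<in> W"
  then have "wd a \<in> lists X" using wd by auto
  from lg_mem[OF this] show "1 \<le> d' a \<and> e' a \<in> \<gamma> (d' a)"
    using e'[OF a] d'[OF a] letterD[OF xX] by auto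
qed

text \<open>The Lie subring generated by \<open>W\<close> is stable under the letters of
  \<open>Y\<close>. For a name \<open>a\<close>, appending \<open>v\<close> to \<open>wd a\<close>
  either gives a pyramid again, with a name in \<open>W\<close>, or \<open>v\<close> commutes with
  everything and the bracket vanishes both in the group and in the associative ring. The derivation
  rule does the rest.\<close>

lemma Rep_act_letter:
  assumes "Rep e' d' W i g P" "v \<in> Y"
  shows "\<exists>P'. Rep e' d' W (i + d v) (gcomm g (e v)) P' \<and> null (subst E P' - brk (subst E P) (frag_of [v]))"
  using assms(1)
proof induct
  case (low k g)
  have v: "d v \<ge> 1" "e v \<in> \<gamma> (d v)" using letterD assms(2) by auto
  have "gcomm g (e v) \<in> \<gamma> (Suc k + d v)" using low v by (intro \<gamma>_gcomm) auto
  then have "Rep e' d' W (k + d v) (gcomm g (e v)) 0" using low by (intro Rep.low) auto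
  then show ?case by (intro exI[of _ 0]) (simp add: brk_simps)
next
  case (letter a)
  have vX: "v \<in> X" using assms(2) by auto
  have v: "d v \<ge> 1" "e v \<in> \<gamma> (d v)" using letterD vX by auto
  let ?w = "wd a @ [v]"
  have w: "wd a \<in> lists Y" "pyramid x (wd a)" "?w \<in> lists Y" "?w \<in> lists X"
    using wd[OF letter] assms(2) by auto
  have g: "gcomm (e' a) (e v) = lg ?w" "d' a + d v = dw ?w" using e'[OF letter] d'[OF letter] by auto
  show ?case
  proof (cases "pyramid x ?w")
    case True
    then obtain b where b: "b \<in> W" "wd b \<simeq> ?w" using wd_ex w(3) by blast
    have db: "dw (wd b) = dw ?w" using trace_mset[OF b(2)] by (metis mset_map sum_mset_sum_list)
    have "Rep e' d' W (dw ?w) (lg ?w) (frag_of [b])"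
    proof (rule Rep_cong[OF _ gradedW])
      show "Rep e' d' W (dw ?w) (e' b) (frag_of [b])" using Rep.letter[of b W e' d'] b(1) d'[OF b(1)] db by simp
      show "lg ?w \<in> carrier G" using lg_mem[OF w(4)] \<gamma>_carrier by blast
      show "gr (dw ?w) (lg ?w) = gr (dw ?w) (e' b)"
        using lg_cong[OF trace_sym[OF b(2)] w(4)] e'[OF b(1)] by simp
    qed
    moreover have "null (subst E (frag_of [b]) - brk (subst E (frag_of [a])) (frag_of [v]))"
      using null_lnb_trace[OF b(2), of x] by simp
    ultimately show ?thesis unfolding g by blast
  next
    case False
    then have c: "\<forall>b\<in>set (x # wd a). \<theta> v b" using pyramid_snoc w(2) by blast
    have "lg ?w \<in> \<gamma> (Suc (dw ?w))" using lg_commute[OF vX _ c] w by (simp add: add.assoc)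
    then have "Rep e' d' W (dw ?w) (lg ?w) 0" using v by (intro Rep.low) auto
    moreover have "null (brk (E a) (frag_of [v]))"
    proof (rule null_brk_letter)
      fix t assume "t \<in> Poly_Mapping.keys (E a)"
      then have "set t = set (x # wd a)" using keys_lnb mset_eq_setD by metis
      then show "\<forall>a\<in>set t. \<theta> v a" using c by simp
    qed
    ultimately have "Rep e' d' W (dw ?w) (lg ?w) 0 \<and>
        null (subst E 0 - brk (subst E (frag_of [a])) (frag_of [v]))" by (simp add: null_uminus)
    then show ?thesis unfolding g by blast
  qed
next
  case (mult k g P h Q)
  then obtain P' Q' where PQ: "Rep e' d' W (k + d v) (gcomm g (e v)) P'" "Rep e' d' W (k + d v) (gcomm h (e v)) Q'"
    "null (subst E P' - brk (subst E P) (frag_of [v]))" "null (subst E Q' - brk (subst E Q) (frag_of [v]))" by auto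
  have m: "k \<ge> 1" "g \<in> \<gamma> k" "h \<in> \<gamma> k" "d v \<ge> 1" "e v \<in> \<gamma> (d v)"
    using Rep_mem[OF mult(1) gradedW] Rep_mem[OF mult(3) gradedW] letterD assms(2) by auto
  have "Rep e' d' W (k + d v) (gcomm (g \<otimes> h) (e v)) (P' + Q')"
    using m \<gamma>_carrier gr_gcomm_mult_left[OF m(1,4,2,3,5)]
    by (intro Rep_cong[OF Rep.mult[OF PQ(1,2)] gradedW]) auto
  moreover have "null (subst E (P' + Q') - brk (subst E (P + Q)) (frag_of [v]))"
    using null_add[OF PQ(3,4)] by (simp add: brk_simps algebra_simps)
  ultimately show ?case by blast
next
  case (inv k g P)
  then obtain P' where P: "Rep e' d' W (k + d v) (gcomm g (e v)) P'"
    "null (subst E P' - brk (subst E P) (frag_of [v]))" by auto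
  have m: "k \<ge> 1" "g \<in> \<gamma> k" "d v \<ge> 1" "e v \<in> \<gamma> (d v)"
    using Rep_mem[OF inv(1) gradedW] letterD assms(2) by auto
  have "Rep e' d' W (k + d v) (gcomm (inv g) (e v)) (- P')"
    using m \<gamma>_carrier gr_gcomm_inv_left[OF m(1,3,2,4)]
    by (intro Rep_cong[OF Rep.inv[OF P(1)] gradedW]) auto
  moreover have "null (subst E (- P') - brk (subst E (- P)) (frag_of [v]))"
    using null_uminus[OF P(2)] by (simp add: brk_simps)
  ultimately show ?case by blast
next
  case (gcomm i g P j h Q)
  then obtain P' Q' where PQ: "Rep e' d' W (i + d v) (gcomm g (e v)) P'" "Rep e' d' W (j + d v) (gcomm h (e v)) Q'"
    "null (subst E P' - brk (subst E P) (frag_of [v]))" "null (subst E Q' - brk (subst E Q) (frag_of [v]))" by auto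
  have m: "i \<ge> 1" "j \<ge> 1" "d v \<ge> 1" "g \<in> \<gamma> i" "h \<in> \<gamma> j" "e v \<in> \<gamma> (d v)"
    using Rep_mem[OF gcomm(1) gradedW] Rep_mem[OF gcomm(3) gradedW] letterD assms(2) by auto
  let ?k = "i + j + d v"
  have c: "g \<in> carrier G" "h \<in> carrier G" "e v \<in> carrier G" using m \<gamma>_carrier by auto
  have "Rep e' d' W ?k (local.gcomm (local.gcomm g (e v)) h) (brk P' Q)"
    using Rep.gcomm[OF PQ(1) gcomm(3)] by (simp add: ac_simps)
  moreover have "Rep e' d' W ?k (local.gcomm g (local.gcomm h (e v))) (brk P Q')"
    using Rep.gcomm[OF gcomm(1) PQ(2)] by (simp add: ac_simps)
  ultimately have R: "Rep e' d' W ?k (local.gcomm (local.gcomm g (e v)) h \<otimes> local.gcomm g (local.gcomm h (e v))) (brk P' Q + brk P Q')"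
    by (rule Rep.mult)
  have eq: "gr ?k (local.gcomm (local.gcomm g h) (e v)) =
      gr ?k (local.gcomm (local.gcomm g (e v)) h \<otimes> local.gcomm g (local.gcomm h (e v)))"
    using gr_jacobi[OF m HOL.refl] c by simp
  have "Rep e' d' W ?k (local.gcomm (local.gcomm g h) (e v)) (brk P' Q + brk P Q')"
    using Rep_cong[OF R gradedW _ eq] c by simp
  moreover have "null (subst E (brk P' Q + brk P Q') - brk (subst E (brk P Q)) (frag_of [v]))"
    using null_add[OF null_brk_left[OF PQ(3), of "subst E Q"] null_brk_right[OF PQ(4), of "subst E P"]]
    by (simp add: subst_brk brk_jacobi[of "subst E P" "subst E Q"] brk_simps algebra_simps)
  ultimately show ?case by blast
qed

text \<open>By Jacobi, a bracket \<open>gcomm h1 h2\<close> acts as the commutator of the actions of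
  \<open>h1\<close> and \<open>h2\<close>; so stability under letters is enough.\<close>

lemma Rep_act:
  assumes "Rep e d Y j h Q"
  shows "Rep e' d' W i g P \<Longrightarrow>
    \<exists>P'. Rep e' d' W (i + j) (gcomm g h) P' \<and> null (subst E P' - brk (subst E P) Q)"
  using assms
proof (induct arbitrary: i g P)
  case (low k h)
  have m: "i \<ge> 1" "g \<in> \<gamma> i" using Rep_mem[OF low(3) gradedW] by auto
  have "gcomm g h \<in> \<gamma> (i + Suc k)" using low m by (intro \<gamma>_gcomm) auto
  then have "Rep e' d' W (i + k) (gcomm g h) 0" using low by (intro Rep.low) auto
  then show ?case by (intro exI[of _ 0]) (simp add: brk_simps)
next
  case (letter v)
  then show ?case using Rep_act_letter by blast
next
  case (mult k h Q h' Q')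
  obtain P1 P2 where P: "Rep e' d' W (i + k) (gcomm g h) P1" "Rep e' d' W (i + k) (gcomm g h') P2"
    "null (subst E P1 - brk (subst E P) Q)" "null (subst E P2 - brk (subst E P) Q')"
    using mult(2)[OF mult(5)] mult(4)[OF mult(5)] by auto
  have m: "i \<ge> 1" "k \<ge> 1" "g \<in> \<gamma> i" "h \<in> \<gamma> k" "h' \<in> \<gamma> k"
    using Rep_mem[OF mult(5) gradedW] Rep_mem[OF mult(1) gradedY] Rep_mem[OF mult(3) gradedY] by auto
  have "Rep e' d' W (i + k) (gcomm g (h \<otimes> h')) (P1 + P2)"
    using m \<gamma>_carrier gr_gcomm_mult_right[OF m]
    by (intro Rep_cong[OF Rep.mult[OF P(1,2)] gradedW]) auto
  moreover have "null (subst E (P1 + P2) - brk (subst E P) (Q + Q'))"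
    using null_add[OF P(3,4)] by (simp add: brk_simps algebra_simps)
  ultimately show ?case by blast
next
  case (inv k h Q)
  obtain P1 where P: "Rep e' d' W (i + k) (gcomm g h) P1" "null (subst E P1 - brk (subst E P) Q)"
    using inv(2)[OF inv(3)] by auto
  have m: "i \<ge> 1" "k \<ge> 1" "g \<in> \<gamma> i" "h \<in> \<gamma> k"
    using Rep_mem[OF inv(3) gradedW] Rep_mem[OF inv(1) gradedY] by auto
  have "Rep e' d' W (i + k) (gcomm g (inv h)) (- P1)"
    using m \<gamma>_carrier gr_gcomm_inv_right[OF m]
    by (intro Rep_cong[OF Rep.inv[OF P(1)] gradedW]) auto
  moreover have "null (subst E (- P1) - brk (subst E P) (- Q))"
    using null_uminus[OF P(2)] by (simp add: brk_simps)
  ultimately show ?case by blast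
next
  case (gcomm j1 h1 Q1 j2 h2 Q2)
  obtain P1 where P1: "Rep e' d' W (i + j1) (local.gcomm g h1) P1" "null (subst E P1 - brk (subst E P) Q1)"
    using gcomm(2)[OF gcomm(5)] by auto
  obtain P2 where P2: "Rep e' d' W (i + j2) (local.gcomm g h2) P2" "null (subst E P2 - brk (subst E P) Q2)"
    using gcomm(4)[OF gcomm(5)] by auto
  obtain P12 where P12: "Rep e' d' W (i + j1 + j2) (local.gcomm (local.gcomm g h1) h2) P12"
    "null (subst E P12 - brk (subst E P1) Q2)" using gcomm(4)[OF P1(1)] by auto
  obtain P21 where P21: "Rep e' d' W (i + j2 + j1) (local.gcomm (local.gcomm g h2) h1) P21"
    "null (subst E P21 - brk (subst E P2) Q1)" using gcomm(2)[OF P2(1)] by auto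
  have m: "i \<ge> 1" "j1 \<ge> 1" "j2 \<ge> 1" "g \<in> \<gamma> i" "h1 \<in> \<gamma> j1" "h2 \<in> \<gamma> j2"
    using Rep_mem[OF gcomm(5) gradedW] Rep_mem[OF gcomm(1) gradedY] Rep_mem[OF gcomm(3) gradedY] by auto
  let ?k = "i + (j1 + j2)"
  interpret Q: group "Gr ?k" by (rule gr_group)
  have c: "g \<in> carrier G" "h1 \<in> carrier G" "h2 \<in> carrier G" using m \<gamma>_carrier by auto
  let ?a = "local.gcomm (local.gcomm g h1) h2" and ?b = "local.gcomm (local.gcomm g h2) h1"
    and ?c = "local.gcomm g (local.gcomm h1 h2)"
  have "?b \<in> \<gamma> ?k" using \<gamma>_gcomm[OF _ _ \<gamma>_gcomm[OF m(1,3,4,6)] m(5)] m by (simp add: ac_simps)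
  then have "gr ?k ?b \<otimes>\<^bsub>Gr ?k\<^esub> gr ?k ?c = gr ?k ?c \<otimes>\<^bsub>Gr ?k\<^esub> gr ?k ?b" using c by (intro gr_central) auto
  then have "gr ?k ?a = gr ?k ?c \<otimes>\<^bsub>Gr ?k\<^esub> gr ?k ?b"
    using gr_jacobi[OF m, of ?k] by (simp only: add.assoc)
  then have eq: "gr ?k ?c = gr ?k (?a \<otimes> inv ?b)"
    using Q.inv_solve_right[of "gr ?k ?c" "gr ?k ?a" "gr ?k ?b"] c by simp
  have R: "Rep e' d' W ?k (?a \<otimes> inv ?b) (P12 + - P21)"
    using P12(1) P21(1) by (intro Rep.mult Rep.inv) (simp_all add: ac_simps)
  have "Rep e' d' W ?k ?c (P12 + - P21)" using Rep_cong[OF R gradedW _ eq] c by simp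
  moreover have "null (subst E (P12 + - P21) - brk (subst E P) (brk Q1 Q2))"
  proof -
    have "null ((subst E P12 - brk (subst E P1) Q2) + brk (subst E P1 - brk (subst E P) Q1) Q2
       - ((subst E P21 - brk (subst E P2) Q1) + brk (subst E P2 - brk (subst E P) Q2) Q1))"
      by (rule null_diff[OF null_add[OF P12(2) null_brk_left[OF P1(2)]] null_add[OF P21(2) null_brk_left[OF P2(2)]]])
    then show ?thesis using brk_jacobi[of "subst E P" Q1 Q2] by (simp add: brk_simps algebra_simps)
  qed
  ultimately show ?case by blast
qed

text \<open>The sum of the subrings generated by \<open>Y\<close> and by \<open>W\<close> contains
  all letters, and it is closed under brackets because \<open>Rep_act\<close> puts the mixed ones
  into the part of \<open>W\<close>.\<close>

lemma Rep_split:
  assumes "Rep e d X k g P"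
  shows "\<exists>g1 P1 g2 P2. Rep e d Y k g1 P1 \<and> Rep e' d' W k g2 P2 \<and> gr k g = gr k (g1 \<otimes> g2) \<and>
    null (P - (P1 + subst E P2))"
  using assms
proof induct
  case (low k g)
  have "Rep e d Y k g 0" "Rep e' d' W k \<one> 0" using low \<gamma>_one by (auto intro: Rep.low)
  moreover have "g \<in> carrier G" using low \<gamma>_carrier by auto
  ultimately show ?case by (intro exI[of _ g] exI[of _ 0] exI[of _ \<one>]) auto
next
  case (letter y)
  have y: "d y \<ge> 1" "e y \<in> carrier G" using letterD[OF letter] \<gamma>_carrier by auto
  show ?case
  proof (cases "y = x")
    case True
    \<comment> \<open>The letter \<open>x\<close> itself is the pyramid with empty tail.\<close>
    have "pyramid x []" by (simp add: pyramid_def)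
    then obtain a where a: "a \<in> W" "wd a \<simeq> []" using wd_ex[of "[]"] by auto
    then have "wd a = []" using trace_length[OF a(2)] by simp
    then have "Rep e' d' W (d y) (e y) (frag_of [a])" "E a = frag_of [x]"
      using Rep.letter[of a W e' d'] a(1) e'[OF a(1)] d'[OF a(1)] True by auto
    moreover have "Rep e d Y (d y) \<one> 0" using y \<gamma>_one by (auto intro: Rep.low)
    ultimately show ?thesis using y True
      by (intro exI[of _ \<one>] exI[of _ 0] exI[of _ "e y"] exI[of _ "frag_of [a]"]) auto
  next
    case False
    then have "Rep e d Y (d y) (e y) (frag_of [y])" "Rep e' d' W (d y) \<one> 0"
      using letter y \<gamma>_one by (auto intro: Rep.letter Rep.low)
    then show ?thesis using y
      by (intro exI[of _ "e y"] exI[of _ "frag_of [y]"] exI[of _ \<one>] exI[of _ 0]) auto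
  qed
next
  case (mult k g P h Q)
  then obtain g1 P1 g2 P2 h1 Q1 h2 Q2 where I: "Rep e d Y k g1 P1" "Rep e' d' W k g2 P2"
    "Rep e d Y k h1 Q1" "Rep e' d' W k h2 Q2" "gr k g = gr k (g1 \<otimes> g2)" "gr k h = gr k (h1 \<otimes> h2)"
    "null (P - (P1 + subst E P2))" "null (Q - (Q1 + subst E Q2))" by blast
  interpret Q: group "Gr k" by (rule gr_group)
  have m: "g2 \<in> \<gamma> k" "g1 \<in> carrier G" "g2 \<in> carrier G" "h1 \<in> carrier G" "h2 \<in> carrier G"
    "g \<in> carrier G" "h \<in> carrier G"
    using Rep_mem[OF I(1) gradedY] Rep_mem[OF I(3) gradedY] Rep_mem[OF I(2) gradedW] Rep_mem[OF I(4) gradedW]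
      Rep_mem[OF mult(1) gradedX] Rep_mem[OF mult(3) gradedX] \<gamma>_carrier by auto
  have "gr k (g \<otimes> h) = gr k g1 \<otimes>\<^bsub>Gr k\<^esub> (gr k g2 \<otimes>\<^bsub>Gr k\<^esub> gr k h1) \<otimes>\<^bsub>Gr k\<^esub> gr k h2"
    using m I by (simp add: Q.m_assoc)
  also have "gr k g2 \<otimes>\<^bsub>Gr k\<^esub> gr k h1 = gr k h1 \<otimes>\<^bsub>Gr k\<^esub> gr k g2" using m by (intro gr_central)
  finally have "gr k (g \<otimes> h) = gr k ((g1 \<otimes> h1) \<otimes> (g2 \<otimes> h2))" using m by (simp add: Q.m_assoc)
  moreover have "null (P + Q - ((P1 + Q1) + subst E (P2 + Q2)))"
    using null_add[OF I(7,8)] by (simp add: algebra_simps)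
  ultimately show ?case using Rep.mult[OF I(1,3)] Rep.mult[OF I(2,4)] by blast
next
  case (inv k g P)
  then obtain g1 P1 g2 P2 where I: "Rep e d Y k g1 P1" "Rep e' d' W k g2 P2"
    "gr k g = gr k (g1 \<otimes> g2)" "null (P - (P1 + subst E P2))" by blast
  interpret Q: group "Gr k" by (rule gr_group)
  have m: "g2 \<in> \<gamma> k" "g1 \<in> carrier G" "g2 \<in> carrier G" "g \<in> carrier G"
    using Rep_mem[OF I(1) gradedY] Rep_mem[OF I(2) gradedW]
      Rep_mem[OF inv(1) gradedX] \<gamma>_carrier by auto
  have "gr k (inv g) = gr k (inv g2) \<otimes>\<^bsub>Gr k\<^esub> gr k (inv g1)"
    using m I by (simp add: Q.inv_mult_group)
  also have "\<dots> = gr k (inv g1) \<otimes>\<^bsub>Gr k\<^esub> gr k (inv g2)" using m \<gamma>_inv by (intro gr_central) auto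
  finally have "gr k (inv g) = gr k (inv g1 \<otimes> inv g2)" using m by simp
  moreover have "null (- P - (- P1 + subst E (- P2)))"
    using null_uminus[OF I(4)] by (simp add: algebra_simps)
  ultimately show ?case using Rep.inv[OF I(1)] Rep.inv[OF I(2)] by blast
next
  case (gcomm i g P j h Q)
  then obtain g1 P1 g2 P2 h1 Q1 h2 Q2 where I: "Rep e d Y i g1 P1" "Rep e' d' W i g2 P2"
    "Rep e d Y j h1 Q1" "Rep e' d' W j h2 Q2" "gr i g = gr i (g1 \<otimes> g2)" "gr j h = gr j (h1 \<otimes> h2)"
    "null (P - (P1 + subst E P2))" "null (Q - (Q1 + subst E Q2))" by blast
  let ?k = "i + j"
  interpret Q: group "Gr ?k" by (rule gr_group)
  obtain R1 where R1: "Rep e' d' W (i + j) (local.gcomm g2 h1) R1" "null (subst E R1 - brk (subst E P2) Q1)"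
    using Rep_act[OF I(3,2)] by auto
  obtain R2 where R2: "Rep e' d' W (j + i) (local.gcomm h2 g1) R2" "null (subst E R2 - brk (subst E Q2) P1)"
    using Rep_act[OF I(1,4)] by auto
  have m: "i \<ge> 1" "j \<ge> 1" "g1 \<in> \<gamma> i" "g2 \<in> \<gamma> i" "h1 \<in> \<gamma> j" "h2 \<in> \<gamma> j" "g \<in> \<gamma> i" "h \<in> \<gamma> j"
    using Rep_mem[OF I(1) gradedY] Rep_mem[OF I(3) gradedY] Rep_mem[OF I(2) gradedW] Rep_mem[OF I(4) gradedW]
      Rep_mem[OF gcomm(1) gradedX] Rep_mem[OF gcomm(3) gradedX] by auto
  have c: "g1 \<in> carrier G" "g2 \<in> carrier G" "h1 \<in> carrier G" "h2 \<in> carrier G" "g \<in> carrier G" "h \<in> carrier G"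
    using m \<gamma>_carrier by auto
  \<comment> \<open>The \<open>W\<close>-part of the bracket of the two sums. \<open>Rep_act\<close>
    has the element of \<open>Y\<close> on the right, so the commutator of \<open>g1\<close> and
    \<open>h2\<close> enters as an inverse.\<close>
  let ?g2 = "(inv (local.gcomm h2 g1) \<otimes> local.gcomm g2 h1) \<otimes> local.gcomm g2 h2"
  have "gr ?k (local.gcomm g h) = gr ?k (local.gcomm (g1 \<otimes> g2) h)"
    using m I(5) \<gamma>_mult by (intro gr_gcomm_cong_left) auto
  also have "\<dots> = gr ?k (local.gcomm (g1 \<otimes> g2) (h1 \<otimes> h2))"
    using m I(6) \<gamma>_mult by (intro gr_gcomm_cong_right) auto
  also have "\<dots> = gr ?k (local.gcomm g1 (h1 \<otimes> h2)) \<otimes>\<^bsub>Gr ?k\<^esub> gr ?k (local.gcomm g2 (h1 \<otimes> h2))"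
    using m \<gamma>_mult by (intro gr_gcomm_mult_left) auto
  also have "\<dots> = gr ?k (local.gcomm g1 h1) \<otimes>\<^bsub>Gr ?k\<^esub> gr ?k (local.gcomm g1 h2) \<otimes>\<^bsub>Gr ?k\<^esub>
      (gr ?k (local.gcomm g2 h1) \<otimes>\<^bsub>Gr ?k\<^esub> gr ?k (local.gcomm g2 h2))"
    using m by (simp add: gr_gcomm_mult_right)
  also have "\<dots> = gr ?k (local.gcomm g1 h1 \<otimes> ?g2)"
    using c inv_gcomm[of h2 g1] by (simp add: Q.m_assoc del: gr_inv)
  finally have g: "gr ?k (local.gcomm g h) = gr ?k (local.gcomm g1 h1 \<otimes> ?g2)" .
  have "Rep e' d' W ?k ?g2 (- R2 + R1 + brk P2 Q2)"
    using R1(1) R2(1) Rep.gcomm[OF I(2,4)] by (intro Rep.mult Rep.inv) (simp_all add: ac_simps)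
  moreover have "null (brk P Q - (brk P1 Q1 + subst E (- R2 + R1 + brk P2 Q2)))"
  proof -
    have "null (brk (P - (P1 + subst E P2)) Q + brk (P1 + subst E P2) (Q - (Q1 + subst E Q2))
        + (subst E R2 - brk (subst E Q2) P1) - (subst E R1 - brk (subst E P2) Q1))"
      by (rule null_diff[OF null_add[OF null_add[OF null_brk_left[OF I(7)] null_brk_right[OF I(8)]] R2(2)] R1(2)])
    then show ?thesis using brk_anti[of "subst E Q2" P1] by (simp add: brk_simps subst_brk algebra_simps)
  qed
  ultimately show ?case using g Rep.gcomm[OF I(1,3)] by blast
qed

end


section \<open>Lie elements divisible in the associative ring\<close>

text \<open>All alphabets of the iterated elimination live in this one type, so that
  \<open>Rep_divisible\<close> can be proved by induction over alphabets. \<open>Nd (x # w)\<close>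
  names the left-normed bracket of \<open>x\<close> with the letters of \<open>w\<close>.\<close>

datatype 'v tree = Lf 'v | Nd "'v tree list"

primrec tdeg :: "'v tree \<Rightarrow> nat" where
  "tdeg (Lf v) = 1"
| "tdeg (Nd ts) = sum_list (map tdeg ts)"

fun node_tail :: "'v tree \<Rightarrow> 'v tree list" where
  "node_tail (Nd ts) = tl ts"
| "node_tail (Lf v) = []"

context group
begin

fun lnc :: "'a list \<Rightarrow> 'a" where
  "lnc [] = \<one>"
| "lnc (g # gs) = foldl gcomm g gs"

primrec tval :: "('v \<Rightarrow> 'a) \<Rightarrow> 'v tree \<Rightarrow> 'a" where
  "tval gen (Lf v) = gen v"
| "tval gen (Nd ts) = lnc (map (tval gen) ts)"

text \<open>A single letter has only vanishing brackets, so its multiples are all that remains. This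
  is the case where the iteration of eliminations stops.\<close>

lemma Rep_single_letter:
  assumes "Rep e d X j g P" "graded e d X" "j \<le> k"
    and uniq: "\<And>x y. x \<in> X \<Longrightarrow> y \<in> X \<Longrightarrow> d x \<le> k \<Longrightarrow> d y \<le> k \<Longrightarrow> x = y"
  shows "P = 0 \<and> g \<in> \<gamma> (Suc j) \<or>
    (\<exists>x\<in>X. d x = j \<and> (\<exists>c::int. P = frag_cmul c (frag_of [x]) \<and> gr j g = gr j (e x [^] c)))"
  using assms(1,3)
proof induct
  case (letter x)
  then have "e x \<in> carrier G" using assms(2) \<gamma>_carrier by (auto simp: graded_def)
  then show ?case using letter by (intro disjI2 bexI[of _ x] conjI exI[of _ 1]) (auto simp: int_pow_1)
next
  case (mult j g P h Q)
  interpret Q: group "Gr j" by (rule gr_group)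
  have c: "g \<in> carrier G" "h \<in> carrier G"
    using Rep_mem[OF mult(1) assms(2)] Rep_mem[OF mult(3) assms(2)] \<gamma>_carrier by auto
  have e: "e x \<in> carrier G" if "x \<in> X" for x using that assms(2) \<gamma>_carrier by (auto simp: graded_def)
  from mult(2)[OF mult(5)] show ?case
  proof (elim disjE bexE conjE exE)
    assume P: "P = 0" "g \<in> \<gamma> (Suc j)"
    then have "gr j (g \<otimes> h) = gr j h" using gr_eq_one_iff[of g j] c by simp
    then show ?thesis using mult(4)[OF mult(5)] P \<gamma>_mult by auto
  next
    fix x b assume x: "x \<in> X" "d x = j" "P = frag_cmul b (frag_of [x])" "gr j g = gr j (e x [^] b)"
    from mult(4)[OF mult(5)] show ?thesis
    proof (elim disjE bexE conjE exE)
      assume Q: "Q = 0" "h \<in> \<gamma> (Suc j)"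
      then have "gr j (g \<otimes> h) = gr j g" using gr_eq_one_iff[of h j] c by simp
      then show ?thesis using x Q by auto
    next
      fix y b' assume y: "y \<in> X" "d y = j" "Q = frag_cmul b' (frag_of [y])" "gr j h = gr j (e y [^] b')"
      have "y = x" using uniq x y mult(5) by auto
      then have "P + Q = frag_cmul (b + b') (frag_of [x])" "gr j (g \<otimes> h) = gr j (e x [^] (b + b'))"
        using x y c e[of x] by (simp_all add: frag_cmul_distrib int_pow_mult)
      then show ?thesis using x by blast
    qed
  qed
next
  case (inv j g P)
  have c: "g \<in> carrier G"
    using Rep_mem[OF inv(1) assms(2)] \<gamma>_carrier by auto
  from inv(2)[OF inv(3)] show ?case
  proof (elim disjE bexE conjE exE)
    fix x b assume x: "x \<in> X" "d x = j" "P = frag_cmul b (frag_of [x])" "gr j g = gr j (e x [^] b)"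
    have e: "e x \<in> carrier G" using x assms(2) \<gamma>_carrier by (auto simp: graded_def)
    have "- P = frag_cmul (- b) (frag_of [x])" "gr j (inv g) = gr j (e x [^] (- b))"
      using x c e by (simp_all add: int_pow_neg)
    then show ?thesis using x by blast
  qed (auto intro: \<gamma>_inv)
next
  case (gcomm i g P j h Q)
  have m: "i \<ge> 1" "j \<ge> 1" "g \<in> \<gamma> i" "h \<in> \<gamma> j"
    using Rep_mem[OF gcomm(1) assms(2)] Rep_mem[OF gcomm(3) assms(2)] by auto
  have le: "i \<le> k" "j \<le> k" using gcomm(5) by auto
  from gcomm(2)[OF le(1)] show ?case
  proof (elim disjE bexE conjE exE)
    assume "P = 0" "g \<in> \<gamma> (Suc i)"
    then show ?thesis using \<gamma>_gcomm[of "Suc i" j g h] m by (simp add: brk_simps)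
  next
    fix x b assume x: "x \<in> X" "d x = i" "P = frag_cmul b (frag_of [x])" "gr i g = gr i (e x [^] b)"
    from gcomm(4)[OF le(2)] show ?thesis
    proof (elim disjE bexE conjE exE)
      assume "Q = 0" "h \<in> \<gamma> (Suc j)"
      then show ?thesis using \<gamma>_gcomm[of i "Suc j" g h] m by (simp add: brk_simps)
    next
      fix y b' assume y: "y \<in> X" "d y = j" "Q = frag_cmul b' (frag_of [y])" "gr j h = gr j (e y [^] b')"
      have xy: "y = x" using uniq x y le by auto
      have e: "e x \<in> \<gamma> i" "e x \<in> carrier G" using x assms(2) \<gamma>_carrier by (auto simp: graded_def)
      have pw: "e x [^] b \<in> \<gamma> i" "e x [^] b' \<in> \<gamma> j" for b b' :: int
        using e y x xy \<gamma>_subgroup[of i] by (auto intro: subgroup_int_pow_closed)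
      have "gr (i + j) (local.gcomm g h) = gr (i + j) (local.gcomm (e x [^] b) h)"
        using m pw x by (intro gr_gcomm_cong_left) auto
      also have "\<dots> = gr (i + j) (local.gcomm (e x [^] b) (e x [^] b'))"
        using m pw y xy by (intro gr_gcomm_cong_right) auto
      also have "local.gcomm (e x [^] b) (e x [^] b') = \<one>"
      proof -
        have "e x [^] b \<otimes> e x [^] b' = e x [^] b' \<otimes> e x [^] b"
          using e by (simp add: int_pow_mult[symmetric] add.commute)
        then show ?thesis unfolding gcomm_def using e by (simp add: m_assoc)
      qed
      finally have "local.gcomm g h \<in> \<gamma> (Suc (i + j))"
        using m \<gamma>_carrier gr_eq_one_iff[of "local.gcomm g h" "i + j"] by simp
      moreover have "brk P Q = 0"
      proof -
        have "frag_cmul b (frag_of [x]) * frag_cmul b' (frag_of [x]) =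
          frag_cmul b' (frag_of [x]) * frag_cmul b (frag_of [x])" for b b'
        proof -
          have c: "frag_cmul b (frag_of w) = Poly_Mapping.single w b" for b and w :: "_ list"
            by (rule poly_mapping_eqI) (simp add: lookup_single when_def)
          show ?thesis by (simp add: c mult_single mult.commute)
        qed
        then show ?thesis using x y xy by (simp add: brk_def)
      qed
      ultimately show ?thesis by simp
    qed
  qed
qed simp

lemma gr_pow [simp]: "g \<in> carrier G \<Longrightarrow> gr k (g [^] (n::nat)) = gr k g [^]\<^bsub>Gr k\<^esub> n"
  by (rule group_hom.hom_nat_pow[OF gr_hom])

text \<open>For \<open>n = 0\<close> this is injectivity of the map from the Lie ring to the ring of
  traces, for \<open>n > 0\<close> torsion-freeness of its cokernel. If two letters have degree at
  most \<open>k\<close>, one of them is eliminated; suitable functionals separate the two summands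
  of \<open>Rep_split\<close>, so that divisibility passes to each of them.\<close>

theorem Rep_divisible:
  fixes X :: "'v tree set" and \<theta> :: "'v tree \<Rightarrow> 'v tree \<Rightarrow> bool" and n :: nat
  assumes "commutation \<theta>" "graded (tval gen) tdeg X"
    and "\<And>a b. a \<in> X \<Longrightarrow> b \<in> X \<Longrightarrow> \<theta> a b \<Longrightarrow> gcomm (tval gen a) (tval gen b) \<in> \<gamma> (Suc (tdeg a + tdeg b))"
    and "finite {w \<in> lists X. sum_list (map tdeg w) \<le> k}"
    and "Rep (tval gen) tdeg X k g P"
    and "\<And>f. commutation.invariant \<theta> f \<Longrightarrow> int n dvd pair f P"
  shows "\<exists>h\<in>\<gamma> k. gr k g = gr k (h [^] n)"
  using assms
proof (induct "card {w \<in> lists X. sum_list (map tdeg w) \<le> k}" arbitrary: X \<theta> g P rule: less_induct)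
  case less
  let ?e = "tval gen" and ?wds = "\<lambda>X. {w \<in> lists X. sum_list (map tdeg w) \<le> k}"
  interpret commutation \<theta> by fact
  interpret Q: group "Gr k" by (rule gr_group)
  have gC: "k \<ge> 1" "g \<in> \<gamma> k" "g \<in> carrier G" using Rep_mem[OF less(6,3)] \<gamma>_carrier by auto
  show ?case
  proof (cases "\<exists>x\<in>X. \<exists>y\<in>X. x \<noteq> y \<and> tdeg x \<le> k \<and> tdeg y \<le> k")
    case False
    from Rep_single_letter[OF less(6,3) order.refl] False
    consider "P = 0" "g \<in> \<gamma> (Suc k)"
      | x c where "x \<in> X" "tdeg x = k" "P = frag_cmul c (frag_of [x])" "gr k g = gr k (?e x [^] (c::int))"
      by blast
    then show ?thesis
    proof cases
      case 1
      then have "gr k g = gr k (\<one> [^] n)" using gr_eq_one_iff gC by simp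
      then show ?thesis using \<gamma>_one by blast
    next
      case 2
      have x: "?e x \<in> \<gamma> k" "?e x \<in> carrier G" using 2 less(3) \<gamma>_carrier by (auto simp: graded_def)
      \<comment> \<open>The coefficient of the one-letter word \<open>[x]\<close> is a functional on
        traces, and it reads off \<open>c\<close>.\<close>
      have "w = [x] \<longleftrightarrow> w' = [x]" if "(swap \<theta>)\<^sup>*\<^sup>* w w'" for w w'
        using trace_mset[OF that] by (metis mset_single_iff_right mset_single_iff)
      then have "invariant (\<lambda>w. if w = [x] then 1 else 0)" unfolding invariant_def by auto
      from less(7)[OF this] 2 have "int n dvd c"
        by (simp add: pair_cmul)
      then obtain q where q: "c = q * int n" by (metis dvd_def mult.commute)
      then have "gr k g = gr k ((?e x [^] q) [^] n)"
        using 2 x by (simp only: int_pow_int[symmetric] int_pow_pow)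
      moreover have "?e x [^] q \<in> \<gamma> k" using x \<gamma>_subgroup by (auto intro: subgroup_int_pow_closed)
      ultimately show ?thesis by blast
    qed
  next
    case True
    then obtain x y where xy: "x \<in> X" "y \<in> X" "x \<noteq> y" "tdeg x \<le> k" "tdeg y \<le> k" by auto
    \<comment> \<open>One word is chosen in each trace, so that each pyramid has exactly one tree in
      \<open>W\<close>.\<close>
    define nf where "nf w = (SOME w'. (swap \<theta>)\<^sup>*\<^sup>* w' w)" for w
    have nf: "(swap \<theta>)\<^sup>*\<^sup>* (nf w) w" for w unfolding nf_def by (rule someI[of _ w]) simp
    have nf_cong: "nf w = nf w'" if "(swap \<theta>)\<^sup>*\<^sup>* w w'" for w w'
    proof -
      have "(\<lambda>u. (swap \<theta>)\<^sup>*\<^sup>* u w) = (\<lambda>u. (swap \<theta>)\<^sup>*\<^sup>* u w')" using that trace_sym[OF that] by (auto dest: rtranclp_trans)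
      then show ?thesis by (simp add: nf_def)
    qed
    define W where "W = (\<lambda>w. Nd (x # nf w)) ` {w \<in> lists (X - {x}). pyramid x w}"
    have WD: "\<exists>w. a = Nd (x # nf w) \<and> w \<in> lists (X - {x}) \<and> pyramid x w" if "a \<in> W" for a
      using that by (auto simp: W_def)
    interpret el: elimination G \<theta> ?e tdeg X x ?e tdeg W node_tail
    proof
      show "graded ?e tdeg X" "x \<in> X" by fact+
      show "gcomm (?e a) (?e b) \<in> \<gamma> (Suc (tdeg a + tdeg b))" if "a \<in> X" "b \<in> X" "\<theta> a b" for a b
        using less(4) that by blast
      show "node_tail a \<in> lists (X - {x}) \<and> pyramid x (node_tail a)" if a: "a \<in> W" for a
      proof -
        obtain w where w: "a = Nd (x # nf w)" "w \<in> lists (X - {x})" "pyramid x w" using WD[OF a] by blast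
        have "set (nf w) = set w" using trace_set[OF nf] .
        then show ?thesis using w pyramid_cong[OF nf[of w], of x] by (simp add: in_lists_conv_set)
      qed
      show "\<exists>a\<in>W. (swap \<theta>)\<^sup>*\<^sup>* (node_tail a) w" if "w \<in> lists (X - {x})" "pyramid x w" for w
        using that nf[of w] by (intro bexI[of _ "Nd (x # nf w)"]) (auto simp: W_def)
      show "a = b" if a: "a \<in> W" "b \<in> W" "(swap \<theta>)\<^sup>*\<^sup>* (node_tail a) (node_tail b)" for a b
      proof -
        obtain u v where uv: "a = Nd (x # nf u)" "b = Nd (x # nf v)" using WD[OF a(1)] WD[OF a(2)] by blast
        then have "(swap \<theta>)\<^sup>*\<^sup>* (nf u) (nf v)" using a(3) by simp
        then have "(swap \<theta>)\<^sup>*\<^sup>* u v" using nf[of v] trace_sym[OF nf[of u]] by (metis rtranclp_trans)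
        then show ?thesis using uv nf_cong by simp
      qed
      show "?e a = foldl gcomm (?e x) (map ?e (node_tail a))" if "a \<in> W" for a
        using WD[OF that] by auto
      show "tdeg a = tdeg x + sum_list (map tdeg (node_tail a))" if "a \<in> W" for a
        using WD[OF that] by auto
    qed
    let ?E = "\<lambda>a. lnb x (node_tail a)" and ?Y = "X - {x}"
    obtain g1 P1 g2 P2 where S: "Rep ?e tdeg ?Y k g1 P1" "Rep ?e tdeg W k g2 P2"
      "gr k g = gr k (g1 \<otimes> g2)" "null (P - (P1 + subst ?E P2))"
      using el.Rep_split[OF less(6)] by blast
    have pairP: "pair f P = pair f P1 + pair f (subst ?E P2)" if "invariant f" for f
      using S(4) that by (simp add: null_def pair_diff pair_add)
    have K1: "w \<in> lists ?Y \<and> w \<noteq> []" if "w \<in> Poly_Mapping.keys P1" for w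
      using Rep_keys[OF S(1) el.gradedY that] by simp
    have K2: "m \<in> lists W \<and> m \<noteq> []" if "m \<in> Poly_Mapping.keys P2" for m
      using Rep_keys[OF S(2) el.gradedW that] by simp
    have Wpyr: "pyramid x (node_tail a) \<and> x \<notin> set (node_tail a)" if "a \<in> W" for a
      using el.wd[OF that] by auto
    have "\<exists>h\<in>\<gamma> k. gr k g1 = gr k (h [^] n)"
    proof (rule less(1))
      have "?wds ?Y \<subseteq> ?wds X" "[x] \<in> ?wds X" "[x] \<notin> ?wds ?Y" using xy by auto
      then have "?wds ?Y \<subset> ?wds X" by blast
      then show "card (?wds ?Y) < card (?wds X)" by (rule psubset_card_mono[OF less(5)])
      show "finite (?wds ?Y)" using less(5) \<open>?wds ?Y \<subseteq> ?wds X\<close> by (rule rev_finite_subset)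
      show "commutation \<theta>" "graded ?e tdeg ?Y" "Rep ?e tdeg ?Y k g1 P1"
        by (fact commutation_axioms el.gradedY S(1))+
      show "gcomm (?e a) (?e b) \<in> \<gamma> (Suc (tdeg a + tdeg b))" if "a \<in> ?Y" "b \<in> ?Y" "\<theta> a b" for a b
        using less(4) that by blast
      show "int n dvd pair f P1" if f: "invariant f" for f
      proof -
        \<comment> \<open>Ignoring words with \<open>x\<close> isolates \<open>P1\<close>: the words
          of \<open>P2\<close> are nonempty, and every term of each \<open>?E a\<close> contains
          \<open>x\<close>.\<close>
        define f1 where "f1 w = (if x \<in> set w then 0 else f w)" for w
        have inv: "invariant f1" using f trace_set unfolding invariant_def f1_def by metis
        have "pair f1 (evalw ?E m) = 0" if m: "m \<in> Poly_Mapping.keys P2" for m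
        proof (rule pair_zero)
          fix t assume t: "t \<in> Poly_Mapping.keys (evalw ?E m)"
          obtain a m' where "m = a # m'" using K2[OF m] by (cases m) auto
          then obtain u v where u: "u \<in> Poly_Mapping.keys (?E a)" "t = u @ v"
            using t by (auto elim: keys_mult_append)
          then have "x \<in> set t" using mset_eq_setD[OF keys_lnb[OF u(1)]] by auto
          then show "f1 t = 0" by (simp add: f1_def)
        qed
        then have "pair f1 (subst ?E P2) = 0" unfolding pair_subst by (rule pair_zero)
        moreover have "pair f1 P1 = pair f P1" using K1 by (intro pair_cong) (auto simp: f1_def)
        ultimately show ?thesis using less(7)[OF inv] pairP[OF inv] by simp
      qed
    qed
    moreover have "\<exists>h\<in>\<gamma> k. gr k g2 = gr k (h [^] n)"
    proof (rule less(1)[of W "\<lambda>_ _. False"])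
      \<comment> \<open>Spelling out the pyramids embeds the words over \<open>W\<close> into those
        over \<open>X\<close> with the same degree. The word \<open>[y]\<close> is missed, because a
        nonempty image begins with \<open>x\<close>.\<close>
      let ?b = "\<lambda>m. blocks x (map node_tail m)"
      have inj: "inj_on ?b (?wds W)"
        using blocks_inj[of W x node_tail, OF Wpyr el.wd_inj] by (intro inj_onI) auto
      have B: "sum_list (map tdeg (?b m)) = sum_list (map tdeg m) \<and> ?b m \<in> lists X" if "m \<in> lists W" for m
        using that
      proof induct
        case (Cons a m)
        then show ?case using el.wd[of a] el.d'[of a] xy by auto
      qed simp
      have sub: "?b ` ?wds W \<subseteq> ?wds X"
      proof (rule image_subsetI)
        fix m assume "m \<in> ?wds W"
        then have m: "m \<in> lists W" "sum_list (map tdeg m) \<le> k" by auto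
        show "?b m \<in> ?wds X" using B[OF m(1)] m(2) by simp
      qed
      have "[y] \<noteq> ?b m" for m using xy by (cases m) auto
      then have "[y] \<notin> ?b ` ?wds W" by auto
      moreover have "[y] \<in> ?wds X" using xy by auto
      ultimately have "?b ` ?wds W \<subset> ?wds X" using sub by blast
      then have "card (?b ` ?wds W) < card (?wds X)" by (rule psubset_card_mono[OF less(5)])
      then show "card (?wds W) < card (?wds X)" using card_image[OF inj] by simp
      show "finite (?wds W)" using finite_subset[OF sub less(5)] inj by (simp add: finite_image_iff)
      show "commutation (\<lambda>_ _. False :: bool)" by standard auto
      show "graded ?e tdeg W" "Rep ?e tdeg W k g2 P2" by (fact el.gradedW S(2))+
      show "int n dvd pair f' P2" for f'
      proof -
        \<comment> \<open>Without commutation relations on \<open>W\<close>, the functional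
          \<open>f'\<close> is arbitrary. It is extended to traces so as to vanish on
          \<open>P1\<close>, whose words are nonempty and free of \<open>x\<close>.\<close>
        obtain f where f: "invariant f" "\<And>m. m \<in> lists W \<Longrightarrow> pair f (evalw ?E m) = f' m"
          "\<And>t. t \<noteq> [] \<Longrightarrow> x \<notin> set t \<Longrightarrow> f t = 0"
          using subst_dual_surj[of W x node_tail ?E, OF Wpyr el.wd_inj] by blast
        have "pair f P1 = 0" using f(3) K1 by (intro pair_zero) auto
        moreover have "pair f (subst ?E P2) = pair f' P2"
          unfolding pair_subst using f(2) K2 by (intro pair_cong) auto
        ultimately show ?thesis using less(7)[OF f(1)] pairP[OF f(1)] by simp
      qed
    qed simp
    ultimately obtain h1 h2 where h: "h1 \<in> \<gamma> k" "gr k g1 = gr k (h1 [^] n)" "h2 \<in> \<gamma> k" "gr k g2 = gr k (h2 [^] n)"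
      by blast
    have c: "h1 \<in> carrier G" "h2 \<in> carrier G" "g1 \<in> carrier G" "g2 \<in> carrier G"
      using h Rep_mem[OF S(1) el.gradedY] Rep_mem[OF S(2) el.gradedW] \<gamma>_carrier by auto
    have "gr k ((h1 \<otimes> h2) [^] n) = gr k g"
      using c h(2,4) S(3) Q.pow_mult_distrib[OF gr_central[OF h(1) c(2)]] by simp
    then show ?thesis using \<gamma>_mult[OF h(1,3)] by metis
  qed
qed

end


section \<open>Magnus expansions\<close>

context commutation
begin

text \<open>\<open>highdeg k P\<close>: modulo the commutation relations, \<open>P\<close> only has terms of degree at least \<open>k\<close>.\<close>

definition highdeg :: "nat \<Rightarrow> 'l ncpoly \<Rightarrow> bool" where
  "highdeg k P \<longleftrightarrow> (\<forall>f. invariant f \<longrightarrow> (\<forall>w. length w \<ge> k \<longrightarrow> f w = 0) \<longrightarrow> pair f P = 0)"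

lemma highdeg_0 [simp]: "highdeg 0 P" "highdeg k 0"
  by (auto simp: highdeg_def intro: pair_zero)

lemma highdeg_add: "highdeg k P \<Longrightarrow> highdeg k Q \<Longrightarrow> highdeg k (P + Q)"
  by (simp add: highdeg_def pair_add)

lemma highdeg_diff: "highdeg k P \<Longrightarrow> highdeg k Q \<Longrightarrow> highdeg k (P - Q)"
  by (simp add: highdeg_def pair_diff)

lemma highdeg_uminus: "highdeg k P \<Longrightarrow> highdeg k (- P)"
  by (simp add: highdeg_def pair_uminus)

lemma highdeg_mono: "highdeg k P \<Longrightarrow> j \<le> k \<Longrightarrow> highdeg j P"
  unfolding highdeg_def by (meson order.trans)

lemma highdeg_null: "null P \<Longrightarrow> highdeg k P"
  by (simp add: highdeg_def null_def)

lemma highdeg_of: "length w \<ge> k \<Longrightarrow> highdeg k (frag_of w)"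
  by (simp add: highdeg_def)

lemma highdeg_mult:
  assumes "highdeg i P" "highdeg j Q" shows "highdeg (i + j) (P * Q)"
  unfolding highdeg_def pair_mult
proof (intro allI impI)
  fix f assume f: "invariant f" "\<forall>w. i + j \<le> length w \<longrightarrow> f w = 0"
  have "pair (\<lambda>v. f (u @ v)) Q = 0" if "i \<le> length u" for u
    using assms(2) invariant_left[OF f(1), of u] f(2) that by (simp add: highdeg_def)
  then show "pair (\<lambda>u. pair (\<lambda>v. f (u @ v)) Q) P = 0"
    using assms(1) invariant_right[OF f(1), of Q] by (simp add: highdeg_def)
qed

lemma highdeg_mult_left: "highdeg k Q \<Longrightarrow> highdeg k (P * Q)"
  using highdeg_mult[of 0 P k Q] by simp

lemma highdeg_mult_right: "highdeg k P \<Longrightarrow> highdeg k (P * Q)"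
  using highdeg_mult[of k P 0 Q] by simp

lemma highdeg_power: "highdeg 1 P \<Longrightarrow> highdeg k (P ^ k)"
proof (induct k)
  case (Suc k)
  then show ?case using highdeg_mult[of 1 P k "P ^ k"] by simp
qed simp

lemma highdeg_brk: "highdeg i P \<Longrightarrow> highdeg j Q \<Longrightarrow> highdeg (i + j) (brk P Q)"
  unfolding brk_def using highdeg_mult[of i P j Q] highdeg_mult[of j Q i P]
  by (simp add: highdeg_diff add.commute)

text \<open>A functional on traces can be cut off to words of length \<open>k\<close>, since the
  relations preserve length.\<close>

lemma highdeg_homogeneous:
  assumes "highdeg (Suc k) P" "\<And>w. w \<in> Poly_Mapping.keys P \<Longrightarrow> length w = k"
  shows "null P"
  unfolding null_def
proof (intro allI impI)
  fix f assume f: "invariant f"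
  define f' where "f' w = (if length w = k then f w else 0)" for w
  have "invariant f'" using f trace_length unfolding invariant_def f'_def by metis
  then have "pair f' P = 0" using assms(1) by (simp add: highdeg_def f'_def)
  moreover have "pair f P = pair f' P" using assms(2) by (intro pair_cong) (simp add: f'_def)
  ultimately show "pair f P = 0" by simp
qed

end

text \<open>A Magnus expansion with values in the quotient of the free ring by \<open>highdeg K\<close>.\<close>

locale magnus = group G + commutation \<theta>
  for G (structure) and \<theta> :: "'l \<Rightarrow> 'l \<Rightarrow> bool" +
  fixes \<mu> :: "'a \<Rightarrow> 'l ncpoly" and K :: nat
  assumes \<mu>_mult: "g \<in> carrier G \<Longrightarrow> h \<in> carrier G \<Longrightarrow> highdeg K (\<mu> (g \<otimes> h) - \<mu> g * \<mu> h)"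
    and \<mu>_one: "highdeg K (\<mu> \<one> - 1)"
    and \<mu>_1: "g \<in> carrier G \<Longrightarrow> highdeg 1 (\<mu> g - 1)"
begin

section \<open>Leading terms of Magnus expansions\<close>

lemma \<mu>_inv: "g \<in> carrier G \<Longrightarrow> highdeg K (\<mu> g * \<mu> (inv g) - 1)"
  using highdeg_diff[OF \<mu>_one \<mu>_mult[of g "inv g"]] by simp

text \<open>Let \<open>A\<close>, \<open>B\<close> be the images of \<open>g\<close>,
  \<open>h\<close> and \<open>A'\<close>, \<open>B'\<close> those of their inverses. Up to degree
  \<open>K\<close>, the expansion of the commutator minus 1 is
  \<open>(A * B - B * A) * (A' * B')\<close>. The first factor is
  \<open>brk (A - 1) (B - 1)\<close>, and the second is 1 plus terms of positive degree.\<close>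

lemma \<mu>_gcomm:
  assumes g: "g \<in> carrier G" "highdeg i (\<mu> g - 1)" and h: "h \<in> carrier G" "highdeg j (\<mu> h - 1)"
    and k: "k \<le> K" "k \<le> Suc (i + j)"
  shows "highdeg k (\<mu> (gcomm g h) - 1 - brk (\<mu> g - 1) (\<mu> h - 1))"
proof -
  define A B A' B' where AB: "A = \<mu> g" "B = \<mu> h" "A' = \<mu> (inv g)" "B' = \<mu> (inv h)"
  have 1: "highdeg K (\<mu> (gcomm g h) - \<mu> (g \<otimes> h \<otimes> inv g) * B')"
    using \<mu>_mult[of "g \<otimes> h \<otimes> inv g" "inv h"] g h by (simp add: AB gcomm_def)
  have 2: "highdeg K ((\<mu> (g \<otimes> h \<otimes> inv g) - \<mu> (g \<otimes> h) * A') * B')"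
    using \<mu>_mult[of "g \<otimes> h" "inv g"] g h by (simp add: AB highdeg_mult_right)
  have 3: "highdeg K ((\<mu> (g \<otimes> h) - A * B) * (A' * B'))"
    using \<mu>_mult[of g h] g h by (simp add: AB highdeg_mult_right)
  have 4: "highdeg K (B * ((A * A' - 1) * B'))"
    using \<mu>_inv[of g] g by (simp add: AB highdeg_mult_right highdeg_mult_left)
  have 5: "highdeg K (B * B' - 1)" using \<mu>_inv[of h] h by (simp add: AB)
  have "highdeg 1 ((A' - 1) * B' + (B' - 1))"
    using \<mu>_1[of "inv g"] \<mu>_1[of "inv h"] g h by (simp add: AB highdeg_add highdeg_mult_right)
  moreover have "highdeg (i + j) (brk (A - 1) (B - 1))" using g h highdeg_brk by (simp add: AB)
  ultimately have "highdeg (i + j + 1) (brk (A - 1) (B - 1) * ((A' - 1) * B' + (B' - 1)))"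
    using highdeg_mult by blast
  then have 6: "highdeg k (brk (A - 1) (B - 1) * (A' * B' - 1))"
    using k highdeg_mono by (simp add: algebra_simps)
  have eq: "\<mu> (gcomm g h) - 1 - brk (A - 1) (B - 1) =
      (\<mu> (gcomm g h) - \<mu> (g \<otimes> h \<otimes> inv g) * B') + (\<mu> (g \<otimes> h \<otimes> inv g) - \<mu> (g \<otimes> h) * A') * B'
      + (\<mu> (g \<otimes> h) - A * B) * (A' * B') + B * ((A * A' - 1) * B') + (B * B' - 1)
      + brk (A - 1) (B - 1) * (A' * B' - 1)"
    by (simp add: brk_def algebra_simps)
  have "highdeg k (\<mu> (gcomm g h) - 1 - brk (A - 1) (B - 1))"
    unfolding eq using 6 k(1) highdeg_mono[OF 1] highdeg_mono[OF 2] highdeg_mono[OF 3] highdeg_mono[OF 4] highdeg_mono[OF 5]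
    by (simp add: highdeg_add)
  then show ?thesis by (simp add: AB)
qed

lemma \<mu>_inv_eq: "\<mu> (inv g) - 1 = (\<mu> g * \<mu> (inv g) - 1) - (\<mu> g - 1) - (\<mu> g - 1) * (\<mu> (inv g) - 1)"
  by (simp add: algebra_simps)

lemma \<mu>_\<gamma>: "k \<ge> 1 \<Longrightarrow> k \<le> K \<Longrightarrow> g \<in> \<gamma> k \<Longrightarrow> highdeg k (\<mu> g - 1)"
proof (induct k arbitrary: g)
  case (Suc k)
  show ?case
  proof (cases "k = 0")
    case True
    then show ?thesis using Suc \<mu>_1 by simp
  next
    case False
    then have k: "k \<ge> 1" by simp
    from Suc(4) k show ?thesis
    proof (induct rule: \<gamma>_Suc_induct)
      case (gcomm h g)
      have h: "h \<in> carrier G" "highdeg k (\<mu> h - 1)" using Suc k gcomm \<gamma>_carrier by auto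
      have "highdeg (Suc k) (\<mu> (local.gcomm h g) - 1 - brk (\<mu> h - 1) (\<mu> g - 1))"
        using Suc(3) h gcomm \<mu>_1 by (intro \<mu>_gcomm[of _ k _ 1]) auto
      moreover have "highdeg (Suc k) (brk (\<mu> h - 1) (\<mu> g - 1))"
        using highdeg_brk[OF h(2) \<mu>_1[OF gcomm(2)]] by simp
      ultimately show ?case using highdeg_add by fastforce
    next
      case (mult x y)
      have c: "x \<in> carrier G" "y \<in> carrier G" using mult \<gamma>_carrier by auto
      have eq: "\<mu> (x \<otimes> y) - 1 = (\<mu> (x \<otimes> y) - \<mu> x * \<mu> y) + (\<mu> x - 1) * \<mu> y + (\<mu> y - 1)"
        by (simp add: algebra_simps)
      show ?case unfolding eq using highdeg_mono[OF \<mu>_mult[OF c] Suc(3)] mult highdeg_mult_right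
        by (simp add: highdeg_add)
    next
      case (inv x)
      have c: "x \<in> carrier G" using inv \<gamma>_carrier by auto
      show ?case
        by (subst \<mu>_inv_eq) (rule highdeg_diff[OF highdeg_diff[OF
          highdeg_mono[OF \<mu>_inv[OF c] Suc(3)] inv(2)] highdeg_mult_right[OF inv(2)]])
    qed
  qed
qed simp

text \<open>The leading term of the expansion is computed by the same Lie expression: for products
  and inverses, the cross terms have degree at least \<open>k + k\<close>, which is above
  \<open>k\<close>.\<close>

lemma \<mu>_Rep:
  assumes "Rep e d X k g P" "graded e d X" "Suc k \<le> K"
    and "\<And>x. x \<in> X \<Longrightarrow> highdeg (Suc (d x)) (\<mu> (e x) - 1 - frag_of [x])"
  shows "highdeg (Suc k) (\<mu> g - 1 - P)"
  using assms(1,3)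
proof induct
  case (low k g)
  then show ?case using \<mu>_\<gamma>[of "Suc k" g] by simp
next
  case (letter x)
  then show ?case using assms(4) by simp
next
  case (mult k g P h Q)
  have m: "k \<ge> 1" "g \<in> \<gamma> k" "h \<in> \<gamma> k" "g \<in> carrier G" "h \<in> carrier G"
    using Rep_mem[OF mult(1) assms(2)] Rep_mem[OF mult(3) assms(2)] \<gamma>_carrier by auto
  have "highdeg (k + k) ((\<mu> g - 1) * (\<mu> h - 1))"
    using m mult(5) by (intro highdeg_mult \<mu>_\<gamma>) auto
  then have 1: "highdeg (Suc k) ((\<mu> g - 1) * (\<mu> h - 1))" using m by (elim highdeg_mono) simp
  have eq: "\<mu> (g \<otimes> h) - 1 - (P + Q) = (\<mu> (g \<otimes> h) - \<mu> g * \<mu> h) + (\<mu> g - 1) * (\<mu> h - 1)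
      + (\<mu> g - 1 - P) + (\<mu> h - 1 - Q)"
    by (simp add: algebra_simps)
  show ?case unfolding eq using 1 highdeg_mono[OF \<mu>_mult[OF m(4,5)] mult(5)] mult(2,4,5)
    by (simp add: highdeg_add)
next
  case (inv k g P)
  have m: "k \<ge> 1" "g \<in> \<gamma> k" "g \<in> carrier G"
    using Rep_mem[OF inv(1) assms(2)] \<gamma>_carrier by auto
  have "highdeg (k + k) ((\<mu> g - 1) * (\<mu> (inv g) - 1))"
    using m inv(3) \<gamma>_inv by (intro highdeg_mult \<mu>_\<gamma>) auto
  then have 1: "highdeg (Suc k) ((\<mu> g - 1) * (\<mu> (inv g) - 1))" using m by (elim highdeg_mono) simp
  have eq: "\<mu> (inv g) - 1 - (- P) = (\<mu> g * \<mu> (inv g) - 1) - (\<mu> g - 1 - P) - (\<mu> g - 1) * (\<mu> (inv g) - 1)"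
    by (simp add: algebra_simps)
  show ?case unfolding eq
    by (rule highdeg_diff[OF highdeg_diff[OF highdeg_mono[OF \<mu>_inv[OF m(3)] inv(3)] inv(2)[OF inv(3)]] 1])
next
  case (gcomm i g P j h Q)
  have m: "i \<ge> 1" "j \<ge> 1" "g \<in> \<gamma> i" "h \<in> \<gamma> j" "g \<in> carrier G" "h \<in> carrier G"
    using Rep_mem[OF gcomm(1) assms(2)] Rep_mem[OF gcomm(3) assms(2)] \<gamma>_carrier by auto
  let ?a = "\<mu> g - 1" and ?b = "\<mu> h - 1"
  have ab: "highdeg i ?a" "highdeg j ?b" using m gcomm(5) by (auto intro!: \<mu>_\<gamma>)
  have d: "highdeg (Suc i) (?a - P)" "highdeg (Suc j) (?b - Q)" using gcomm by auto
  have P: "highdeg i P" using highdeg_diff[OF ab(1) highdeg_mono[OF d(1)]] by simp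
  have "highdeg (Suc (i + j)) (\<mu> (local.gcomm g h) - 1 - brk ?a ?b)"
    using m ab gcomm(5) by (intro \<mu>_gcomm) auto
  note 1 = this
  have 2: "highdeg (Suc (i + j)) (brk (?a - P) ?b)" "highdeg (Suc (i + j)) (brk P (?b - Q))"
    using highdeg_brk[OF d(1) ab(2)] highdeg_brk[OF P d(2)] by simp_all
  have eq: "\<mu> (local.gcomm g h) - 1 - brk P Q =
      (\<mu> (local.gcomm g h) - 1 - brk ?a ?b) + brk (?a - P) ?b + brk P (?b - Q)"
    by (simp add: brk_simps)
  show ?case unfolding eq by (rule highdeg_add[OF highdeg_add[OF 1 2(1)] 2(2)])
qed

end

lemma (in group) Rep_exists:
  assumes k: "k \<ge> 1" and g: "g \<in> \<gamma> k"
    and X: "\<And>x. x \<in> X \<Longrightarrow> d x = 1 \<and> e x \<in> carrier G" and gen: "carrier G = generate G (e ` X)"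
  shows "\<exists>P. Rep e d X k g P"
proof -
  have gr: "graded e d X" using X by (auto simp: graded_def)
  have 1: "\<exists>P. Rep e d X 1 g P" if "g \<in> carrier G" for g
    using that unfolding gen
  proof induct
    case one
    then show ?case using Rep.low[of 1 \<one>] \<gamma>_one by auto
  next
    case (incl h)
    then show ?case using Rep.letter X by (metis imageE)
  next
    case (inv h)
    then show ?case using Rep.inv Rep.letter X by (metis imageE)
  next
    case (eng h1 h2)
    then show ?case using Rep.mult by blast
  qed
  show ?thesis using k g
  proof (induct k arbitrary: g)
    case (Suc k)
    show ?case
    proof (cases "k = 0")
      case True
      then show ?thesis using Suc 1 by simp
    next
      case False
      then have k: "k \<ge> 1" by simp
      from Suc(3) k show ?thesis
      proof (induct rule: \<gamma>_Suc_induct)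
        case (gcomm h g)
        then obtain P Q where "Rep e d X k h P" "Rep e d X 1 g Q" using Suc(1) False 1 by fastforce
        from Rep.gcomm[OF this] show ?case by auto
      next
        case (mult x y)
        then show ?case using Rep.mult by blast
      next
        case (inv x)
        then show ?case using Rep.inv by blast
      qed
    qed
  qed simp
qed

section \<open>Elements commuting with every letter\<close>

text \<open>If \<open>v\<close> and \<open>w\<close> do not commute, then \<open>w\<^sup>N t\<close> and \<open>t' w\<^sup>N\<close> are different traces when \<open>v\<close> occurs
  in \<open>t\<close> and \<open>N\<close> is large. So an element commuting with \<open>w\<close> does not involve \<open>v\<close>.\<close>

context commutation
begin

lemma trace_filter_pair:
  assumes "u \<simeq> u'" "\<not> \<theta> v w"
  shows "filter (\<lambda>a. a = v \<or> a = w) u = filter (\<lambda>a. a = v \<or> a = w) u'"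
  using assms(1)
proof (induct rule: rtranclp_induct)
  case (step y z)
  from step(2) have "filter (\<lambda>a. a = v \<or> a = w) y = filter (\<lambda>a. a = v \<or> a = w) z"
    using assms(2) sym irrefl by (elim swapE) auto
  then show ?case using step(3) by simp
qed simp

lemma not_trace_conj:
  assumes vw: "\<not> \<theta> v w" "v \<noteq> w" and t: "v \<in> set t" "length t < N"
  shows "\<not> t @ replicate N w \<simeq> replicate N w @ t'"
proof
  let ?F = "filter (\<lambda>a. a = v \<or> a = w)"
  assume "t @ replicate N w \<simeq> replicate N w @ t'"
  from trace_filter_pair[OF this vw(1)]
  have eq: "?F t @ replicate N w = replicate N w @ ?F t'" by simp
  have "v \<in> set (?F t)" using t by simp
  then obtain i where i: "i < length (?F t)" "?F t ! i = v" unfolding in_set_conv_nth by blast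
  have "i < N" by (rule less_trans[OF less_le_trans[OF i(1) length_filter_le] t(2)])
  then have "(replicate N w @ ?F t') ! i = w" by (simp add: nth_append)
  moreover have "(?F t @ replicate N w) ! i = v" using i by (simp add: nth_append)
  ultimately show False using eq vw(2) by simp
qed

lemma central_divisible:
  fixes P :: "'l ncpoly" and n :: int
  assumes keys: "\<And>t. t \<in> Poly_Mapping.keys P \<Longrightarrow> t \<in> lists X \<and> t \<noteq> [] \<and> length t = k"
    and X: "\<And>v. v \<in> X \<Longrightarrow> \<exists>w\<in>X. v \<noteq> w \<and> \<not> \<theta> v w"
    and fin: "finite X"
    and central: "\<And>f w. invariant f \<Longrightarrow> w \<in> X \<Longrightarrow> n dvd pair f (brk P (frag_of [w]))"
    and f: "invariant f"
  shows "n dvd pair f P"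
proof -
  have pow: "n dvd pair f (brk P (frag_of (replicate N w)))" if f: "invariant f" and w: "w \<in> X" for f w N
    using f
  proof (induct N arbitrary: f)
    case 0
    then show ?case by (simp add: brk_def flip: one_frag)
  next
    case (Suc N)
    let ?w = "frag_of [w]" and ?u = "frag_of (replicate N w)"
    have W: "frag_of (replicate (Suc N) w) = ?w * ?u" by (simp add: frag_of_mult)
    have "brk P (frag_of (replicate (Suc N) w)) = brk P ?w * ?u + ?w * brk P ?u"
      unfolding W by (simp add: brk_def algebra_simps)
    moreover have "pair f (brk P ?w * ?u) = pair (\<lambda>u. f (u @ replicate N w)) (brk P ?w)"
      by (simp add: pair_mult)
    moreover have "invariant (\<lambda>u. f (u @ replicate N w))"
      using invariant_right[OF Suc(2), of ?u] by simp
    moreover have "pair f (?w * brk P ?u) = pair (\<lambda>u. f ([w] @ u)) (brk P ?u)"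
      by (simp add: pair_mult)
    ultimately show ?case using central[OF _ w] Suc(1)[OF invariant_left[OF Suc(2), of "[w]"]]
      by (simp add: pair_add del: append_Cons append_Nil)
  qed
  have one: "n dvd pair f P"
    if f: "invariant f" and v: "v \<in> X" and fv: "\<And>t. v \<notin> set t \<Longrightarrow> f t = 0" for f v
  proof -
    obtain w where w: "w \<in> X" "v \<noteq> w" "\<not> \<theta> v w" using X[OF v] by auto
    \<comment> \<open>The exponent \<open>Suc k\<close> exceeds the length of all words of
      \<open>P\<close>, as \<open>not_trace_conj\<close> requires.\<close>
    let ?W = "replicate (Suc k) w"
    \<comment> \<open>\<open>F\<close> removes the prefix \<open>?W\<close>, uniquely by left
      cancellation. On \<open>frag_of ?W * P\<close> it gives \<open>pair f P\<close>; on
      \<open>P * frag_of ?W\<close> it gives 0, because \<open>f\<close> only sees words containing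
      \<open>v\<close>.\<close>
    define F where "F s = (if \<exists>t. s \<simeq> ?W @ t then f (SOME t. s \<simeq> ?W @ t) else 0)" for s
    have F: "F s = f t" if s: "s \<simeq> ?W @ t" for s t
    proof -
      have ex: "\<exists>t. s \<simeq> ?W @ t" using s by auto
      then have "s \<simeq> ?W @ (SOME t. s \<simeq> ?W @ t)" by (rule someI_ex)
      then have "?W @ t \<simeq> ?W @ (SOME t. s \<simeq> ?W @ t)" using trace_sym[OF s] by (metis rtranclp_trans)
      then have "t \<simeq> (SOME t. s \<simeq> ?W @ t)" by (rule trace_cancel)
      then show ?thesis using ex invariantD[OF f] by (simp add: F_def)
    qed
    have invF: "invariant F" unfolding invariant_def
    proof (intro allI impI)
      fix u u' assume u: "u \<simeq> u'"
      have "(\<lambda>t. u \<simeq> ?W @ t) = (\<lambda>t. u' \<simeq> ?W @ t)"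
        using u trace_sym[OF u] by (metis rtranclp_trans)
      then show "F u = F u'" by (simp add: F_def)
    qed
    have 1: "F (t @ ?W) = 0" if t: "t \<in> Poly_Mapping.keys P" for t
    proof (cases "\<exists>t'. t @ ?W \<simeq> ?W @ t'")
      case True
      then obtain t' where t': "t @ ?W \<simeq> ?W @ t'" by auto
      have "v \<notin> set t" using not_trace_conj[OF w(3,2), of t "Suc k" t'] t' keys[OF t] by auto
      moreover have "set t' \<subseteq> set (t @ ?W)" using trace_set[OF t'] by auto
      ultimately have "v \<notin> set t'" using w(2) by auto
      then show ?thesis using F[OF t'] fv by simp
    next
      case False
      then show ?thesis by (simp add: F_def)
    qed
    have "pair F (P * frag_of ?W) = 0" using 1 by (simp add: pair_mult pair_zero)
    moreover have "pair F (frag_of ?W * P) = pair f P"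
      using F[OF rtranclp.rtrancl_refl] by (simp add: pair_mult del: replicate_Suc)
    ultimately have "pair F (brk P (frag_of ?W)) = - pair f P" by (simp add: brk_def pair_diff)
    then show ?thesis using pow[OF invF w(1), of "Suc k"] by simp
  qed
  \<comment> \<open>A general functional is peeled off letter by letter: the part supported on words
    containing \<open>v\<close> is settled by \<open>one\<close>, the rest by induction.\<close>
  have "n dvd pair f P" if "finite Z" "Z \<subseteq> X" "invariant f" "\<And>t. set t \<inter> Z = {} \<Longrightarrow> f t = 0" for f Z
    using that
  proof (induct arbitrary: f rule: finite_induct)
    case empty
    then show ?case by (simp add: pair_zero)
  next
    case (insert v Z)
    define f1 f2 where f12: "f1 t = (if v \<in> set t then f t else 0)" "f2 t = (if v \<in> set t then 0 else f t)" for t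
    have "invariant f1" "invariant f2"
      using insert(5) trace_set unfolding f12 invariant_def by metis+
    moreover have "f2 t = 0" if "set t \<inter> Z = {}" for t using that insert(6)[of t] by (auto simp: f12)
    ultimately have "n dvd pair f1 P" "n dvd pair f2 P"
      using insert one[of f1 v] by (auto simp: f12)
    moreover have "f = (\<lambda>t. f1 t + f2 t)" by (auto simp: f12)
    then have "pair f P = pair f1 P + pair f2 P" by (simp add: pair_fun_add)
    ultimately show ?case by simp
  qed
  note Z = this
  define f' where "f' t = (if set t \<inter> X = {} then 0 else f t)" for t
  have "invariant f'" using f trace_set unfolding f'_def invariant_def by metis
  then have "n dvd pair f' P" using Z[OF fin, of f'] by (auto simp: f'_def)
  moreover have "pair f P = pair f' P"
  proof (rule pair_cong)
    fix t assume "t \<in> Poly_Mapping.keys P"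
    then have "t \<in> lists X" "t \<noteq> []" using keys by auto
    then have "set t \<inter> X \<noteq> {}" by (cases t) auto
    then show "f t = f' t" by (simp add: f'_def)
  qed
  ultimately show ?thesis by simp
qed

end


section \<open>Right-angled Artin groups\<close>

lemma geometric_left: "(1 + x) * (\<Sum>i<K. (- x) ^ i) = 1 - (- x :: 'r::ring_1) ^ K"
  by (induct K) (simp_all add: algebra_simps)

lemma geometric_right: "(\<Sum>i<K. (- x) ^ i) * (1 + x) = 1 - (- x :: 'r::ring_1) ^ K"
proof (induct K)
  case (Suc K)
  then show ?case using power_commutes[of "- x" K] by (simp add: algebra_simps)
qed simp

text \<open>A relation on trees, since the letters in \<open>Rep_divisible\<close> are trees; the
  vertices enter as leaves.\<close>

definition adj :: "('a, 'b) pre_digraph \<Rightarrow> 'a tree \<Rightarrow> 'a tree \<Rightarrow> bool" where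
  "adj \<Gamma> a b \<longleftrightarrow> (\<exists>u v. a = Lf u \<and> b = Lf v \<and> (u, v) \<in> arcs_ends \<Gamma>)"

lemma adj_Lf [simp]: "adj \<Gamma> (Lf u) (Lf v) \<longleftrightarrow> (u, v) \<in> arcs_ends \<Gamma>"
  by (auto simp: adj_def)

abbreviation adj_words :: "('a, 'b) pre_digraph \<Rightarrow> 'a word set" where
  "adj_words \<Gamma> \<equiv> {comm_word v w | v w. (v, w) \<in> arcs_ends \<Gamma>}"

definition raag_class :: "('a, 'b) pre_digraph \<Rightarrow> 'a word \<Rightarrow> 'a word set" where
  "raag_class \<Gamma> u = pres_rel (verts \<Gamma>) (adj_words \<Gamma>) `` {u}"

definition raag_gen :: "('a, 'b) pre_digraph \<Rightarrow> 'a \<Rightarrow> 'a word set" where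
  "raag_gen \<Gamma> v = raag_class \<Gamma> [(v, True)]"

text \<open>\<open>1 + v\<close> is not invertible in the free ring; the truncated geometric series
  inverts it up to terms of degree at least \<open>K\<close>.\<close>

fun magnus_letter :: "nat \<Rightarrow> 'a \<times> bool \<Rightarrow> 'a tree ncpoly" where
  "magnus_letter K (v, True) = 1 + frag_of [Lf v]"
| "magnus_letter K (v, False) = (\<Sum>i<K. (- frag_of [Lf v]) ^ i)"

definition magnus_word :: "nat \<Rightarrow> 'a word \<Rightarrow> 'a tree ncpoly" where
  "magnus_word K u = prod_list (map (magnus_letter K) u)"

lemma magnus_word_simps [simp]: "magnus_word K [] = 1"
  "magnus_word K (a # u) = magnus_letter K a * magnus_word K u"
  "magnus_word K (u @ v) = magnus_word K u * magnus_word K v"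
  by (simp_all add: magnus_word_def)

text \<open>The value depends on the chosen word, but by \<open>magnus_exp_cls\<close> only modulo
  \<open>highdeg K\<close>.\<close>

definition magnus_exp :: "nat \<Rightarrow> 'a word set \<Rightarrow> 'a tree ncpoly" where
  "magnus_exp K g = magnus_word K (SOME u. u \<in> g)"

locale raag_graph =
  fixes \<Gamma> :: "('a, 'b) pre_digraph"
  assumes graph: "graph \<Gamma>"
begin

abbreviation "V \<equiv> verts \<Gamma>"
abbreviation "gen \<equiv> raag_gen \<Gamma>"
abbreviation "cls \<equiv> raag_class \<Gamma>"

lemma adj_verts: "(u, v) \<in> arcs_ends \<Gamma> \<Longrightarrow> u \<in> V \<and> v \<in> V"
  using graph wf_digraph.adj_in_verts unfolding graph_def digraph_def fin_digraph_def by metis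

lemma adj_words: "adj_words \<Gamma> \<subseteq> words V"
  using adj_verts by (auto simp: comm_word_def)

lemma finite_V: "finite V"
  using graph unfolding graph_def digraph_def by (simp add: fin_digraph.finite_verts)

sublocale commutation "adj \<Gamma>"
proof
  have s: "symmetric \<Gamma>" using graph unfolding graph_def pseudo_graph_def by (simp add: sym_digraph.sym_arcs)
  show "adj \<Gamma> a b \<Longrightarrow> adj \<Gamma> b a" for a b
    using s unfolding symmetric_def sym_def adj_def by blast
  have l: "loopfree_digraph \<Gamma>" using graph unfolding graph_def digraph_def by simp
  show "\<not> adj \<Gamma> a a" for a
    using loopfree_digraph.no_loops[OF l] by (auto simp: adj_def arcs_ends_conv)
qed

sublocale group "raag \<Gamma>"
  using graph wf_digraph.group_raag unfolding graph_def digraph_def fin_digraph_def by blast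

lemma carrier_eq: "carrier (raag \<Gamma>) = cls ` words V"
  by (auto simp: raag_def presented_group_def quotient_def raag_class_def)

lemma cls_closed: "u \<in> words V \<Longrightarrow> cls u \<in> carrier (raag \<Gamma>)"
  by (simp add: carrier_eq)

lemma cls_mult: "u \<in> words V \<Longrightarrow> v \<in> words V \<Longrightarrow> cls u \<otimes>\<^bsub>raag \<Gamma>\<^esub> cls v = cls (u @ v)"
  using presented_mult[OF _ _ adj_words] by (simp add: raag_def raag_class_def)

lemma cls_one: "\<one>\<^bsub>raag \<Gamma>\<^esub> = cls []"
  by (simp add: raag_def presented_group_def raag_class_def)

lemma cls_eqI: "(u, v) \<in> pres_rel V (adj_words \<Gamma>) \<Longrightarrow> cls u = cls v"
  unfolding raag_class_def by (rule equiv_class_eq[OF equiv_pres_rel[OF adj_words]])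

lemma gen_closed [simp]: "v \<in> V \<Longrightarrow> gen v \<in> carrier (raag \<Gamma>)"
  by (simp add: raag_gen_def cls_closed)

lemma inv_gen: "v \<in> V \<Longrightarrow> inv\<^bsub>raag \<Gamma>\<^esub> gen v = cls [(v, False)]"
proof (rule inv_equality)
  assume v: "v \<in> V"
  have "([] @ [(v, False), (v, \<not> False)] @ [], [] @ []) \<in> pres_rel V (adj_words \<Gamma>)"
    using v by (intro pres_rel.cancel) auto
  from cls_eqI[OF this] show "cls [(v, False)] \<otimes>\<^bsub>raag \<Gamma>\<^esub> gen v = \<one>\<^bsub>raag \<Gamma>\<^esub>"
    using v by (simp add: raag_gen_def cls_mult cls_one)
  show "cls [(v, False)] \<in> carrier (raag \<Gamma>)" using v by (simp add: cls_closed)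
qed simp

lemma generated: "carrier (raag \<Gamma>) = generate (raag \<Gamma>) (gen ` V)"
proof
  have "cls u \<in> generate (raag \<Gamma>) (gen ` V)" if "u \<in> words V" for u
    using that
  proof (induct u)
    case Nil
    then show ?case using generate.one by (simp flip: cls_one)
  next
    case (Cons a u)
    obtain v b where a: "a = (v, b)" "v \<in> V" using Cons by (cases a) auto
    have "cls [a] \<in> generate (raag \<Gamma>) (gen ` V)"
    proof (cases b)
      case True
      then have "cls [a] = gen v" using a by (simp add: raag_gen_def)
      then show ?thesis using a by (simp add: generate.incl)
    next
      case False
      then have "cls [a] = inv\<^bsub>raag \<Gamma>\<^esub> gen v" using a by (simp add: inv_gen)
      then show ?thesis using a by (simp add: generate.inv)
    qed
    then have "cls [a] \<otimes>\<^bsub>raag \<Gamma>\<^esub> cls u \<in> generate (raag \<Gamma>) (gen ` V)"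
      using Cons by (intro generate.eng) auto
    then show ?case using Cons a by (simp add: cls_mult)
  qed
  then show "carrier (raag \<Gamma>) \<subseteq> generate (raag \<Gamma>) (gen ` V)" by (auto simp: carrier_eq)
  show "generate (raag \<Gamma>) (gen ` V) \<subseteq> carrier (raag \<Gamma>)"
    by (rule generate_incl) auto
qed

lemma generated_induct [consumes 1, case_names one gen inv mult]:
  assumes "g \<in> carrier (raag \<Gamma>)" "P \<one>\<^bsub>raag \<Gamma>\<^esub>" "\<And>v. v \<in> V \<Longrightarrow> P (gen v)"
    and "\<And>v. v \<in> V \<Longrightarrow> P (inv\<^bsub>raag \<Gamma>\<^esub> gen v)"
    and "\<And>x y. x \<in> carrier (raag \<Gamma>) \<Longrightarrow> y \<in> carrier (raag \<Gamma>) \<Longrightarrow> P x \<Longrightarrow> P y \<Longrightarrow> P (x \<otimes>\<^bsub>raag \<Gamma>\<^esub> y)"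
  shows "P g"
  using assms(1) unfolding generated
proof induct
  case (eng x y)
  then show ?case using assms(5) generated by blast
qed (use assms in auto)

lemma gen_commute: "(u, v) \<in> arcs_ends \<Gamma> \<Longrightarrow> gcomm (gen u) (gen v) = \<one>\<^bsub>raag \<Gamma>\<^esub>"
proof -
  assume uv: "(u, v) \<in> arcs_ends \<Gamma>"
  then have V: "u \<in> V" "v \<in> V" using adj_verts by auto
  have "([] @ comm_word u v @ [], [] @ []) \<in> pres_rel V (adj_words \<Gamma>)"
    using uv by (intro pres_rel.relator) auto
  from cls_eqI[OF this] show ?thesis
    using V unfolding gcomm_def inv_gen[OF V(1)] inv_gen[OF V(2)]
    by (simp add: raag_gen_def cls_mult cls_one comm_word_def)
qed

section \<open>The Magnus expansion respects the relators\<close>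

lemma highdeg_cong_mult:
  assumes "highdeg K (P - P')" shows "highdeg K (A * P * B - A * P' * B)"
proof -
  have "A * P * B - A * P' * B = A * ((P - P') * B)" by (simp add: algebra_simps)
  then show ?thesis using assms highdeg_mult_left highdeg_mult_right by simp
qed

lemma magnus_cancel: "highdeg K (magnus_letter K (v, b) * magnus_letter K (v, \<not> b) - 1)"
proof -
  have "highdeg 1 (- frag_of [Lf v])" by (intro highdeg_uminus highdeg_of) simp
  then have "highdeg K (- ((- frag_of [Lf v]) ^ K))" by (rule highdeg_uminus[OF highdeg_power])
  then show ?thesis by (cases b) (simp_all add: geometric_left geometric_right)
qed

lemma magnus_relator:
  assumes "(v, w) \<in> arcs_ends \<Gamma>"
  shows "highdeg K (magnus_word K (comm_word v w) - 1)"
proof -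
  define x y x' y' where d: "x = magnus_letter K (v, True)" "y = magnus_letter K (w, True)"
    "x' = magnus_letter K (v, False)" "y' = magnus_letter K (w, False)"
  have "null (brk (frag_of [Lf v]) (frag_of [Lf w]))"
    using sym[of "Lf v" "Lf w"] assms by (intro null_brk_letter) auto
  moreover have "x * y - y * x = brk (frag_of [Lf v]) (frag_of [Lf w])"
    by (simp add: d brk_def algebra_simps)
  ultimately have 1: "highdeg K ((x * y - y * x) * (x' * y'))"
    by (simp add: highdeg_null highdeg_mult_right)
  have 2: "highdeg K (y * ((x * x' - 1) * y'))" "highdeg K (y * y' - 1)"
    using magnus_cancel[of K v True] magnus_cancel[of K w True]
    by (simp_all add: d highdeg_mult_left highdeg_mult_right del: magnus_letter.simps)
  \<comment> \<open>First \<open>x\<close> and \<open>y\<close> are exchanged, then \<open>x\<close>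
    cancels against \<open>x'\<close> and \<open>y\<close> against \<open>y'\<close>.\<close>
  have "magnus_word K (comm_word v w) - 1 = (x * y - y * x) * (x' * y') + y * ((x * x' - 1) * y') + (y * y' - 1)"
    by (simp add: d comm_word_def algebra_simps del: magnus_letter.simps)
  then show ?thesis using 1 2 highdeg_add by metis
qed

lemma magnus_pres_rel:
  "(u, v) \<in> pres_rel V (adj_words \<Gamma>) \<Longrightarrow> highdeg K (magnus_word K u - magnus_word K v)"
proof (induct rule: pres_rel.induct)
  case (sym u v)
  then show ?case using highdeg_uminus by fastforce
next
  case (trans u v w)
  then show ?case using highdeg_add by fastforce
next
  case (cancel u v a b)
  then show ?case using highdeg_cong_mult[OF magnus_cancel[of K a b], of "magnus_word K u" "magnus_word K v"]
    by (simp add: mult.assoc del: magnus_letter.simps)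
next
  case (relator u v r)
  then obtain a b where "r = comm_word a b" "(a, b) \<in> arcs_ends \<Gamma>" by auto
  then show ?case using highdeg_cong_mult[OF magnus_relator[of a b K], of "magnus_word K u" "magnus_word K v"]
    by (simp add: mult.assoc)
qed simp

lemma magnus_exp_cls: "u \<in> words V \<Longrightarrow> highdeg K (magnus_exp K (cls u) - magnus_word K u)"
proof -
  assume "u \<in> words V"
  then have "u \<in> cls u" by (auto simp: raag_class_def intro: pres_rel.refl)
  then have "(SOME w. w \<in> cls u) \<in> cls u" by (rule someI)
  then have "(u, SOME w. w \<in> cls u) \<in> pres_rel V (adj_words \<Gamma>)" by (simp add: raag_class_def)
  from magnus_pres_rel[OF pres_rel.sym[OF this]] show ?thesis by (simp add: magnus_exp_def)
qed

lemma magnus_word_1: "K \<ge> 1 \<Longrightarrow> highdeg 1 (magnus_word K u - 1)"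
proof (induct u)
  case (Cons a u)
  obtain v b where a: "a = (v, b)" by (cases a)
  have x: "highdeg 1 (- frag_of [Lf v])" by (intro highdeg_uminus highdeg_of) simp
  have "highdeg 1 (magnus_letter K a - 1)"
  proof (cases b)
    case True
    then show ?thesis using highdeg_uminus[OF x] a by simp
  next
    case False
    have "highdeg 1 ((\<Sum>i<n. (- frag_of [Lf v]) ^ i) - 1)" if "n \<ge> 1" for n
      using that
    proof (induct n rule: nat_induct_at_least)
      case (Suc n)
      have "highdeg 1 ((- frag_of [Lf v]) ^ n)"
        using highdeg_mono[OF highdeg_power[OF x]] Suc(1) by simp
      from highdeg_add[OF Suc(2) this] show ?case by (simp add: algebra_simps)
    qed simp
    then show ?thesis using a False Cons(2) by simp
  qed
  then have "highdeg 1 ((magnus_letter K a - 1) * magnus_word K u + (magnus_word K u - 1))"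
    using Cons by (intro highdeg_add highdeg_mult_right) auto
  then show ?case by (simp add: algebra_simps)
qed simp

lemma magnus: "K \<ge> 1 \<Longrightarrow> magnus (raag \<Gamma>) (adj \<Gamma>) (magnus_exp K) K"
proof unfold_locales
  assume K: "K \<ge> 1"
  fix g assume "g \<in> carrier (raag \<Gamma>)"
  then obtain u where u: "u \<in> words V" "g = cls u" by (auto simp: carrier_eq)
  show "highdeg 1 (magnus_exp K g - 1)"
    using highdeg_add[OF highdeg_mono[OF magnus_exp_cls[OF u(1), of K] K] magnus_word_1[OF K, of u]] u by simp
  fix h assume "h \<in> carrier (raag \<Gamma>)"
  then obtain v where v: "v \<in> words V" "h = cls v" by (auto simp: carrier_eq)
  let ?M = "magnus_exp K" and ?m = "magnus_word K"
  have "?M (g \<otimes>\<^bsub>raag \<Gamma>\<^esub> h) - ?M g * ?M h = (?M (cls (u @ v)) - ?m (u @ v))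
      - ((?M g - ?m u) * ?m v) - ?M g * (?M h - ?m v)"
    using u v by (simp add: cls_mult algebra_simps)
  moreover have "highdeg K \<dots>"
    unfolding u(2) v(2)
    by (rule highdeg_diff[OF highdeg_diff[OF magnus_exp_cls highdeg_mult_right[OF magnus_exp_cls[OF u(1)]]]
      highdeg_mult_left[OF magnus_exp_cls[OF v(1)]]]) (use u v in simp)
  ultimately show "highdeg K (?M (g \<otimes>\<^bsub>raag \<Gamma>\<^esub> h) - ?M g * ?M h)" by simp
next
  show "highdeg K (magnus_exp K \<one>\<^bsub>raag \<Gamma>\<^esub> - 1)"
    using magnus_exp_cls[of "[]" K] by (simp add: cls_one)
qed

section \<open>The Lie ring of a right-angled Artin group inside the ring of traces\<close>

abbreviation "R \<equiv> Rep (tval gen) tdeg (Lf ` V)"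

lemma gradedV: "graded (tval gen) tdeg (Lf ` V)"
  by (auto simp: graded_def)

lemma R_keys:
  "R k g P \<Longrightarrow> w \<in> Poly_Mapping.keys P \<Longrightarrow> w \<in> lists (Lf ` V) \<and> w \<noteq> [] \<and> length w = k"
proof -
  assume "R k g P" "w \<in> Poly_Mapping.keys P"
  then have w: "w \<in> lists (Lf ` V)" "w \<noteq> []" "sum_list (map tdeg w) = k"
    using Rep_keys[OF _ gradedV] by blast+
  from w(1) have "sum_list (map tdeg w) = length w" by induct auto
  then show ?thesis using w by simp
qed

text \<open>The map from graded pieces to the ring of traces is well defined: \<open>P\<close> is
  the part of degree \<open>k\<close> of the Magnus expansion, and an element of
  \<open>\<gamma> (Suc k)\<close> has no such part.\<close>

lemma R_null:
  assumes "R k g P" "g \<in> \<gamma> (Suc k)" shows "null P"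
proof -
  interpret M: magnus "raag \<Gamma>" "adj \<Gamma>" "magnus_exp (Suc k)" "Suc k" by (rule magnus) simp
  have k: "k \<ge> 1" using Rep_mem[OF assms(1) gradedV] by simp
  have "highdeg (Suc k) (magnus_exp (Suc k) g - 1 - P)"
  proof (rule M.\<mu>_Rep[OF assms(1) gradedV])
    fix x assume "x \<in> Lf ` V"
    then obtain v where v: "v \<in> V" "x = Lf v" by auto
    show "highdeg (Suc (tdeg x)) (magnus_exp (Suc k) (tval gen x) - 1 - frag_of [x])"
      using highdeg_mono[OF magnus_exp_cls[of "[(v, True)]" "Suc k"], of "Suc 1"] k v
      by (simp add: raag_gen_def algebra_simps)
  qed simp
  moreover have "highdeg (Suc k) (magnus_exp (Suc k) g - 1)" using assms(2) by (intro M.\<mu>_\<gamma>) auto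
  ultimately have "highdeg (Suc k) P" using highdeg_diff by fastforce
  then show ?thesis using R_keys[OF assms(1)] by (intro highdeg_homogeneous) auto
qed

lemma R_exists: "k \<ge> 1 \<Longrightarrow> g \<in> \<gamma> k \<Longrightarrow> \<exists>P. R k g P"
proof (rule Rep_exists)
  show "carrier (raag \<Gamma>) = generate (raag \<Gamma>) (tval gen ` Lf ` V)"
    using generated by (simp add: image_image)
qed auto

lemma R_divisible:
  assumes "R k g P" "\<And>f. invariant f \<Longrightarrow> int n dvd pair f P"
  shows "\<exists>h\<in>\<gamma> k. gr k g = gr k (h [^]\<^bsub>raag \<Gamma>\<^esub> n)"
proof (rule Rep_divisible[OF commutation_axioms gradedV _ _ assms])
  show "gcomm (tval gen a) (tval gen b) \<in> \<gamma> (Suc (tdeg a + tdeg b))"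
    if "a \<in> Lf ` V" "b \<in> Lf ` V" "adj \<Gamma> a b" for a b
    using that gen_commute \<gamma>_one by auto
  have len: "sum_list (map tdeg w) = length w" if "w \<in> lists (Lf ` V)" for w
    using that by induct auto
  have "{w \<in> lists (Lf ` V). sum_list (map tdeg w) \<le> k} \<subseteq> {w. set w \<subseteq> Lf ` V \<and> length w \<le> k}"
  proof
    fix w assume "w \<in> {w \<in> lists (Lf ` V). sum_list (map tdeg w) \<le> k}"
    then have w: "w \<in> lists (Lf ` V)" "sum_list (map tdeg w) \<le> k" by auto
    then show "w \<in> {w. set w \<subseteq> Lf ` V \<and> length w \<le> k}" using len[OF w(1)] by auto
  qed
  then show "finite {w \<in> lists (Lf ` V). sum_list (map tdeg w) \<le> k}"
    using finite_lists_length_le[of "Lf ` V" k] finite_V finite_subset by blast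
qed

lemma R_pow: "R k g P \<Longrightarrow> R k (g [^]\<^bsub>raag \<Gamma>\<^esub> (n::nat)) (frag_cmul (int n) P)"
proof (induct n)
  case 0
  then show ?case using Rep.low[of k "\<one>\<^bsub>raag \<Gamma>\<^esub>"] \<gamma>_one Rep_mem[OF 0 gradedV] by simp
next
  case (Suc n)
  then show ?case using Rep.mult[of _ _ _ k "g [^]\<^bsub>raag \<Gamma>\<^esub> n" "frag_cmul (int n) P" g P]
    by (simp add: frag_cmul_distrib add.commute)
qed

lemma R_letter: "v \<in> V \<Longrightarrow> R 1 (gen v) (frag_of [Lf v])"
  using Rep.letter[of "Lf v" "Lf ` V" "tval gen" tdeg] by simp

text \<open>Injectivity, the converse of \<open>R_null\<close>: divisibility by 0 means that the
  class is trivial.\<close>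

lemma null_imp_\<gamma>_Suc:
  assumes "R k g P" "null P" shows "g \<in> \<gamma> (Suc k)"
proof -
  obtain h where "gr k g = gr k (h [^]\<^bsub>raag \<Gamma>\<^esub> (0::nat))"
    using R_divisible[OF assms(1), of 0] assms(2) by (auto simp: null_def)
  then show ?thesis using gr_eq_one_iff[of g k] Rep_mem[OF assms(1) gradedV] \<gamma>_carrier by auto
qed

text \<open>The graded piece embeds into the ring of traces, whose additive group is
  torsion-free.\<close>

lemma \<gamma>_torsion_free:
  assumes "k \<ge> 1" "z \<in> \<gamma> k" "z [^]\<^bsub>raag \<Gamma>\<^esub> (n::nat) \<in> \<gamma> (Suc k)" "n > 0"
  shows "z \<in> \<gamma> (Suc k)"
proof -
  obtain P where P: "R k z P" using R_exists assms by blast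
  have "null (frag_cmul (int n) P)" using R_null[OF R_pow[OF P] assms(3)] .
  then have "null P" using assms(4) by (simp add: null_def pair_cmul)
  then show ?thesis using null_imp_\<gamma>_Suc[OF P] by simp
qed

text \<open>A vertex adjacent to all others would give a central generator, and generators are
  nontrivial already in degree one.\<close>

lemma centreless_not_adj:
  assumes Z: "centre (raag \<Gamma>) = {\<one>\<^bsub>raag \<Gamma>\<^esub>}" and v: "v \<in> V"
  shows "\<exists>w\<in>V. v \<noteq> w \<and> (v, w) \<notin> arcs_ends \<Gamma>"
proof (rule ccontr)
  assume "\<not> ?thesis"
  then have a: "w = v \<or> gcomm (gen v) (gen w) = \<one>\<^bsub>raag \<Gamma>\<^esub>" if "w \<in> V" for w
    using that gen_commute by auto
  have c: "gen v \<otimes>\<^bsub>raag \<Gamma>\<^esub> gen w = gen w \<otimes>\<^bsub>raag \<Gamma>\<^esub> gen v" if w: "w \<in> V" for w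
    using a[OF w] conj_gcomm[of "gen v" "gen w"] w v inv_solve_right'[of "gen w" "gen v \<otimes>\<^bsub>raag \<Gamma>\<^esub> gen w" "gen v"]
    by auto
  have "gen v \<otimes>\<^bsub>raag \<Gamma>\<^esub> g = g \<otimes>\<^bsub>raag \<Gamma>\<^esub> gen v" if "g \<in> carrier (raag \<Gamma>)" for g
    using that
  proof (induct rule: generated_induct)
    case (gen w)
    then show ?case by (rule c)
  next
    case (inv w)
    then have "gen v \<otimes>\<^bsub>raag \<Gamma>\<^esub> inv\<^bsub>raag \<Gamma>\<^esub> gen w =
      inv\<^bsub>raag \<Gamma>\<^esub> gen w \<otimes>\<^bsub>raag \<Gamma>\<^esub> (gen w \<otimes>\<^bsub>raag \<Gamma>\<^esub> gen v) \<otimes>\<^bsub>raag \<Gamma>\<^esub> inv\<^bsub>raag \<Gamma>\<^esub> gen w"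
      using v by (simp add: m_assoc)
    also have "\<dots> = inv\<^bsub>raag \<Gamma>\<^esub> gen w \<otimes>\<^bsub>raag \<Gamma>\<^esub> gen v"
      using v inv unfolding c[OF inv, symmetric] by (simp add: m_assoc)
    finally show ?case .
  next
    case (mult x y)
    have "gen v \<otimes>\<^bsub>raag \<Gamma>\<^esub> (x \<otimes>\<^bsub>raag \<Gamma>\<^esub> y) = (gen v \<otimes>\<^bsub>raag \<Gamma>\<^esub> x) \<otimes>\<^bsub>raag \<Gamma>\<^esub> y"
      using mult(1,2) v by (simp add: m_assoc)
    also have "\<dots> = x \<otimes>\<^bsub>raag \<Gamma>\<^esub> (gen v \<otimes>\<^bsub>raag \<Gamma>\<^esub> y)" using mult(1,2) v unfolding mult(3) by (simp add: m_assoc)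
    also have "\<dots> = x \<otimes>\<^bsub>raag \<Gamma>\<^esub> y \<otimes>\<^bsub>raag \<Gamma>\<^esub> gen v" using mult(1,2) v unfolding mult(4) by (simp add: m_assoc)
    finally show ?case .
  qed (use v in simp)
  then have "gen v \<in> centre (raag \<Gamma>)" using v by (simp add: centre_def)
  then have "gen v = \<one>\<^bsub>raag \<Gamma>\<^esub>" using Z by auto
  then have "null (frag_of [Lf v])" using R_null[OF R_letter[OF v]] \<gamma>_one by simp
  \<comment> \<open>The sum of coefficients is a functional on traces with value 1 on a
    letter.\<close>
  moreover have "invariant (\<lambda>_. 1)" by (simp add: invariant_def)
  ultimately have "pair (\<lambda>_. 1) (frag_of [Lf v]) = 0" by (simp only: null_def)
  then show False by simp
qed

end

section \<open>Consequences of a trivial centre\<close>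

locale centreless_raag = raag_graph +
  assumes centreless: "centre (raag \<Gamma>) = {\<one>\<^bsub>raag \<Gamma>\<^esub>}"
begin

text \<open>An element central modulo \<open>n\<close> is divisible by \<open>n\<close>, first in
  the ring of traces by \<open>central_divisible\<close> and then in the Lie ring by
  \<open>R_divisible\<close>.\<close>

lemma R_central_divisible:
  assumes P: "R k g P"
    and dvd: "\<And>f v. invariant f \<Longrightarrow> v \<in> V \<Longrightarrow> int n dvd pair f (brk P (frag_of [Lf v]))"
  shows "\<exists>h\<in>\<gamma> k. gr k g = gr k (h [^]\<^bsub>raag \<Gamma>\<^esub> n)"
proof (rule R_divisible[OF P])
  fix f assume f: "invariant f"
  show "int n dvd pair f P"
  proof (rule central_divisible[OF R_keys[OF P] _ _ _ f])
    show "\<exists>w\<in>Lf ` V. v \<noteq> w \<and> \<not> adj \<Gamma> v w" if "v \<in> Lf ` V" for v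
      using that centreless_not_adj[OF centreless] by fastforce
    show "finite (Lf ` V)" using finite_V by simp
    show "int n dvd pair f (brk P (frag_of [w]))" if "invariant f" "w \<in> Lf ` V" for f w
      using that dvd by auto
  qed
qed

text \<open>Climbing one degree at a time: while \<open>j < c\<close>, the class of \<open>g\<close>
  in degree \<open>j\<close> commutes with all generators, hence it is zero by
  \<open>R_central_divisible\<close> with \<open>n = 0\<close>.\<close>

lemma \<gamma>_of_gcomm:
  assumes g: "g \<in> carrier (raag \<Gamma>)" and c: "\<And>v. v \<in> V \<Longrightarrow> gcomm g (gen v) \<in> \<gamma> (Suc c)"
  shows "1 \<le> j \<Longrightarrow> j \<le> c \<Longrightarrow> g \<in> \<gamma> j"
proof (induct j)
  case (Suc j)
  show ?case
  proof (cases "j = 0")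
    case False
    then have j: "j \<ge> 1" "g \<in> \<gamma> j" using Suc by auto
    then obtain P where P: "R j g P" using R_exists by blast
    have "null (brk P (frag_of [Lf v]))" if v: "v \<in> V" for v
    proof (rule R_null)
      show "R (j + 1) (gcomm g (gen v)) (brk P (frag_of [Lf v]))"
        using Rep.gcomm[OF P R_letter[OF v]] .
      show "gcomm g (gen v) \<in> \<gamma> (Suc (j + 1))" using c[OF v] \<gamma>_mono Suc(3) by auto
    qed
    then obtain h where "gr j g = gr j (h [^]\<^bsub>raag \<Gamma>\<^esub> (0::nat))"
      using R_central_divisible[OF P, of 0] by (auto simp: null_def)
    then show ?thesis using gr_eq_one_iff[OF g, of j] by simp
  qed (use g in simp)
qed simp

lemma gr_gcomm_pow:
  assumes "i \<ge> 1" "j \<ge> 1" "h \<in> \<gamma> i" "b \<in> \<gamma> j"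
  shows "gr (i + j) (gcomm (h [^]\<^bsub>raag \<Gamma>\<^esub> (n::nat)) b) = gr (i + j) (gcomm h b [^]\<^bsub>raag \<Gamma>\<^esub> n)"
proof (induct n)
  case 0
  have "b \<in> carrier (raag \<Gamma>)" using assms \<gamma>_carrier by auto
  then show ?case by (simp add: gcomm_def)
next
  case (Suc n)
  have c: "h \<in> carrier (raag \<Gamma>)" "b \<in> carrier (raag \<Gamma>)" using assms \<gamma>_carrier by auto
  have "h [^]\<^bsub>raag \<Gamma>\<^esub> n \<in> \<gamma> i" using assms(3) by (induct n) (auto simp: \<gamma>_mult \<gamma>_one)
  then show ?case using gr_gcomm_mult_left[of i j "h [^]\<^bsub>raag \<Gamma>\<^esub> n" h b] assms c Suc by simp
qed

lemma inner_root:
  fixes n :: nat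
  assumes c: "c \<ge> 1" and n: "n > 0" and g: "g \<in> \<gamma> c"
    and t: "\<And>v. v \<in> V \<Longrightarrow> t v \<in> \<gamma> (Suc c)"
    and eq: "\<And>v. v \<in> V \<Longrightarrow> gr (Suc c) (gcomm g (gen v)) = gr (Suc c) (t v [^]\<^bsub>raag \<Gamma>\<^esub> n)"
  shows "\<exists>h\<in>\<gamma> c. \<forall>v\<in>V. gr (Suc c) (t v) = gr (Suc c) (gcomm h (gen v))"
proof -
  interpret Q: group "Gr (Suc c)" by (rule gr_group)
  obtain P where P: "R c g P" using R_exists c g by blast
  have gc: "g \<in> carrier (raag \<Gamma>)" using g \<gamma>_carrier by auto
  have "int n dvd pair f (brk P (frag_of [Lf v]))" if f: "invariant f" and v: "v \<in> V" for f v
  proof -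
    obtain Q where Q: "R (Suc c) (t v) Q" using R_exists[of "Suc c"] t v by auto
    have tc: "t v \<in> carrier (raag \<Gamma>)" using t[OF v] \<gamma>_carrier by auto
    have "R (Suc c) (gcomm g (gen v)) (brk P (frag_of [Lf v]))"
      using Rep.gcomm[OF P R_letter[OF v]] by simp
    from Rep.mult[OF this Rep.inv[OF R_pow[OF Q, of n]]]
    \<comment> \<open>The hypothesis \<open>eq\<close>, read in the ring of traces: the bracket of
      \<open>P\<close> with \<open>v\<close> is \<open>n\<close> times the expression
      \<open>Q\<close> of \<open>t v\<close>.\<close>
    have "null (brk P (frag_of [Lf v]) + - frag_cmul (int n) Q)"
      using eq[OF v] v gc tc by (intro R_null) (auto simp flip: gr_eq_iff)
    then have "pair f (brk P (frag_of [Lf v])) = int n * pair f Q"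
      using f by (simp add: null_def pair_add pair_cmul)
    then show ?thesis by simp
  qed
  then obtain h where h: "h \<in> \<gamma> c" "gr c g = gr c (h [^]\<^bsub>raag \<Gamma>\<^esub> n)"
    using R_central_divisible[OF P] by blast
  have hc: "h \<in> carrier (raag \<Gamma>)" using h \<gamma>_carrier by auto
  have hn: "h [^]\<^bsub>raag \<Gamma>\<^esub> n \<in> \<gamma> c" using h(1) by (induct n) (auto simp: \<gamma>_mult \<gamma>_one)
  have "gr (Suc c) (t v) = gr (Suc c) (gcomm h (gen v))" if v: "v \<in> V" for v
  proof -
    let ?u = "gcomm h (gen v)"
    have tc: "t v \<in> carrier (raag \<Gamma>)" using t[OF v] \<gamma>_carrier by auto
    have uc: "?u \<in> carrier (raag \<Gamma>)" using hc v by simp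
    have u: "?u \<in> \<gamma> (Suc c)" using \<gamma>_gcomm_Suc[OF c h(1)] v by simp
    have "gr (c + 1) (gcomm g (gen v)) = gr (c + 1) (gcomm (h [^]\<^bsub>raag \<Gamma>\<^esub> n) (gen v))"
      using c g hn h(2) v by (intro gr_gcomm_cong_left) auto
    also have "\<dots> = gr (c + 1) (?u [^]\<^bsub>raag \<Gamma>\<^esub> n)" using c h(1) v by (intro gr_gcomm_pow) auto
    finally have pw: "gr (Suc c) (t v) [^]\<^bsub>Gr (Suc c)\<^esub> n = gr (Suc c) ?u [^]\<^bsub>Gr (Suc c)\<^esub> n"
      using eq[OF v] tc uc by simp
    \<comment> \<open>\<open>t v\<close> and \<open>?u\<close> have equal \<open>n\<close>-th powers
      in the central graded piece, so their quotient \<open>?z\<close> is a torsion element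
      there.\<close>
    let ?z = "t v \<otimes>\<^bsub>raag \<Gamma>\<^esub> inv\<^bsub>raag \<Gamma>\<^esub> ?u"
    have "gr (Suc c) (t v) \<otimes>\<^bsub>Gr (Suc c)\<^esub> gr (Suc c) (inv\<^bsub>raag \<Gamma>\<^esub> ?u) =
        gr (Suc c) (inv\<^bsub>raag \<Gamma>\<^esub> ?u) \<otimes>\<^bsub>Gr (Suc c)\<^esub> gr (Suc c) (t v)"
      using t[OF v] uc by (intro gr_central) auto
    from Q.pow_mult_distrib[OF this]
    have "gr (Suc c) (?z [^]\<^bsub>raag \<Gamma>\<^esub> n) = \<one>\<^bsub>Gr (Suc c)\<^esub>"
      using pw tc uc by (simp add: Q.nat_pow_inv)
    then have "?z [^]\<^bsub>raag \<Gamma>\<^esub> n \<in> \<gamma> (Suc (Suc c))"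
      using gr_eq_one_iff[of "?z [^]\<^bsub>raag \<Gamma>\<^esub> n" "Suc c"] tc uc by simp
    then have "?z \<in> \<gamma> (Suc (Suc c))"
      using \<gamma>_torsion_free[of "Suc c" ?z n] t[OF v] u n \<gamma>_mult \<gamma>_inv by auto
    then show ?thesis using gr_eq_iff[OF tc uc] by simp
  qed
  then show ?thesis using h by blast
qed

end


section \<open>Automorphisms\<close>

context group
begin

lemma auto_closed: "\<phi> \<in> auto G \<Longrightarrow> x \<in> carrier G \<Longrightarrow> \<phi> x \<in> carrier G"
  using group_hom.hom_closed[OF auto_group_hom[OF is_group]] .

lemma auto_mult: "\<phi> \<in> auto G \<Longrightarrow> x \<in> carrier G \<Longrightarrow> y \<in> carrier G \<Longrightarrow> \<phi> (x \<otimes> y) = \<phi> x \<otimes> \<phi> y"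
  using group_hom.hom_mult[OF auto_group_hom[OF is_group]] .

lemma auto_inv: "\<phi> \<in> auto G \<Longrightarrow> x \<in> carrier G \<Longrightarrow> \<phi> (inv x) = inv (\<phi> x)"
  using group_hom.hom_inv[OF auto_group_hom[OF is_group]] .

section \<open>Action of automorphisms on the graded pieces\<close>

lemma aut_filt_gr: "\<phi> \<in> aut_filt G c \<longleftrightarrow> \<phi> \<in> auto G \<and> (\<forall>x\<in>carrier G. gr c (\<phi> x) = gr c x)"
  unfolding aut_filt_iff by (intro conj_cong ball_cong HOL.refl) (simp add: gr_eq_iff auto_closed)

text \<open>As \<open>c \<ge> 1\<close>, the action on the abelianization is trivial, and all graded
  pieces are generated by brackets of elements of degree one.\<close>

lemma aut_filt_gr_\<gamma>:
  assumes \<phi>: "\<phi> \<in> aut_filt G c" and c: "c \<ge> 1"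
  shows "j \<ge> 1 \<Longrightarrow> t \<in> \<gamma> j \<Longrightarrow> gr j (\<phi> t) = gr j t"
proof (induct j arbitrary: t)
  case (Suc j)
  have au: "\<phi> \<in> auto G" using \<phi> by (simp add: aut_filt_iff)
  have 1: "gr 1 (\<phi> t) = gr 1 t" if t: "t \<in> carrier G" for t
  proof -
    have "\<phi> t \<otimes> inv t \<in> \<gamma> (Suc c)" using \<phi> t by (simp add: aut_filt_iff)
    then have "\<phi> t \<otimes> inv t \<in> \<gamma> (Suc 1)" using c by (elim \<gamma>_mono) simp
    then show ?thesis using gr_eq_iff[of "\<phi> t" t 1] auto_closed[OF au t] t by simp
  qed
  show ?case
  proof (cases "j = 0")
    case True
    then show ?thesis using 1 Suc \<gamma>_carrier by simp
  next
    case False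
    then have j: "j \<ge> 1" by simp
    from Suc(3) j show ?thesis
    proof (induct rule: \<gamma>_Suc_induct)
      case (gcomm h g)
      have h: "h \<in> carrier G" "gr j (\<phi> h) = gr j h" using Suc(1)[OF j gcomm(1)] gcomm \<gamma>_carrier by auto
      have cl: "\<phi> h \<in> carrier G" "\<phi> g \<in> carrier G" using auto_closed au h gcomm by auto
      have ph: "\<phi> h \<in> \<gamma> j" using gr_mem[OF h(2) cl(1) gcomm(1)] by simp
      have "\<phi> (local.gcomm h g) = local.gcomm (\<phi> h) (\<phi> g)"
        using h gcomm au by (simp add: gcomm_def auto_mult auto_inv)
      also have "gr (j + 1) \<dots> = gr (j + 1) (local.gcomm h (\<phi> g))"
        using j ph gcomm(1) cl h(2) by (intro gr_gcomm_cong_left) auto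
      also have "\<dots> = gr (j + 1) (local.gcomm h g)"
        using j gcomm cl 1[OF gcomm(2)] by (intro gr_gcomm_cong_right) auto
      finally show ?case by simp
    next
      case (mult x y)
      then have "x \<in> carrier G" "y \<in> carrier G" using \<gamma>_carrier by auto
      then show ?case using mult au by (simp add: auto_mult auto_closed)
    next
      case (inv x)
      then have "x \<in> carrier G" using \<gamma>_carrier by auto
      then show ?case using inv au by (simp add: auto_inv auto_closed)
    qed
  qed
qed simp

lemma aut_filt_pow:
  "\<phi> \<in> aut_filt G c \<Longrightarrow> \<phi> [^]\<^bsub>AutoGroup G\<^esub> (n::nat) \<in> aut_filt G c"
proof (induct n)
  case 0
  then show ?case using subgroup.one_closed[OF normal_imp_subgroup[OF aut_filt_normal]] by simp
next
  case (Suc n)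
  then show ?case using subgroup.m_closed[OF normal_imp_subgroup[OF aut_filt_normal]] by simp
qed

text \<open>With \<open>t = \<phi> u \<otimes> inv u\<close> we have
  \<open>\<phi> u = t \<otimes> u\<close>, and powers of \<open>\<phi>\<close> fix the class of
  \<open>t\<close> by \<open>aut_filt_gr_\<gamma>\<close>. So each application contributes one more
  factor \<open>t\<close>.\<close>

lemma gr_aut_pow:
  assumes \<phi>: "\<phi> \<in> aut_filt G c" and c: "c \<ge> 1" and u: "u \<in> carrier G"
  shows "gr (Suc c) ((\<phi> [^]\<^bsub>AutoGroup G\<^esub> (n::nat)) u) = gr (Suc c) ((\<phi> u \<otimes> inv u) [^] n \<otimes> u)"
proof (induct n)
  case 0
  then show ?case using u by (simp add: AutoGroup_simps)
next
  case (Suc n)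
  interpret Q: group "Gr (Suc c)" by (rule gr_group)
  let ?\<psi> = "\<phi> [^]\<^bsub>AutoGroup G\<^esub> n" and ?t = "\<phi> u \<otimes> inv u"
  have au: "\<phi> \<in> auto G" "?\<psi> \<in> auto G" using \<phi> aut_filt_pow[OF \<phi>] by (simp_all add: aut_filt_iff)
  have cl: "\<phi> u \<in> carrier G" "?t \<in> carrier G" using au u by (simp_all add: auto_closed)
  have t: "?t \<in> \<gamma> (Suc c)" using \<phi> u by (simp add: aut_filt_iff)
  have "(\<phi> [^]\<^bsub>AutoGroup G\<^esub> Suc n) u = ?\<psi> (\<phi> u)"
    using au u by (simp add: AutoGroup_simps compose_def)
  also have "\<phi> u = ?t \<otimes> u" using cl u by (simp add: m_assoc)
  also have "?\<psi> (?t \<otimes> u) = ?\<psi> ?t \<otimes> ?\<psi> u" using au cl u by (simp add: auto_mult)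
  also have "gr (Suc c) \<dots> = gr (Suc c) ?t \<otimes>\<^bsub>Gr (Suc c)\<^esub> gr (Suc c) (?t [^] n \<otimes> u)"
    using au cl u Suc aut_filt_gr_\<gamma>[OF aut_filt_pow[OF \<phi>] c _ t] by (simp add: auto_closed)
  also have "\<dots> = gr (Suc c) (?t \<otimes> (?t [^] n \<otimes> u))"
    using cl u by (simp only: gr_mult m_closed nat_pow_closed)
  also have "?t \<otimes> (?t [^] n \<otimes> u) = ?t [^] Suc n \<otimes> u"
    using cl u by (simp only: nat_pow_Suc2 m_assoc[of ?t "?t [^] n" u] nat_pow_closed)
  finally show ?case .
qed

section \<open>Passage to outer automorphisms\<close>

lemma to_Out_hom: "group_hom (AutoGroup G) (OutGroup G) (to_Out G)"
proof -
  interpret I: normal "Inn G" "AutoGroup G" by (rule Inn_normal)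
  show ?thesis
    using I.r_coset_hom_Mod AutoGroup group_OutGroup
    unfolding group_hom_def group_hom_axioms_def OutGroup_def to_Out_def[abs_def] by simp
qed

lemma to_Out_conj: "g \<in> carrier G \<Longrightarrow> to_Out G (conj_auto G g) = \<one>\<^bsub>OutGroup G\<^esub>"
  using group.coset_join2[OF AutoGroup _ normal_imp_subgroup[OF Inn_normal], of "conj_auto G g"] conj_auto_mem[of g]
  by (simp add: to_Out_def OutGroup_def FactGroup_def Inn_def AutoGroup_simps)

lemma to_Out_eqD:
  assumes "\<phi> \<in> auto G" "\<psi> \<in> auto G" "to_Out G \<phi> = to_Out G \<psi>"
  shows "\<exists>g\<in>carrier G. \<forall>x\<in>carrier G. \<phi> x = g \<otimes> \<psi> x \<otimes> inv g"
proof -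
  interpret A: group "AutoGroup G" by (rule AutoGroup)
  have "\<phi> \<in> Inn G #>\<^bsub>AutoGroup G\<^esub> \<phi>"
    using A.rcos_self[OF _ normal_imp_subgroup[OF Inn_normal]] assms(1) by (simp add: AutoGroup_simps)
  then have "\<phi> \<in> Inn G #>\<^bsub>AutoGroup G\<^esub> \<psi>" using assms(3) by (simp add: to_Out_def)
  then obtain g where g: "g \<in> carrier G" "\<phi> = conj_auto G g \<otimes>\<^bsub>AutoGroup G\<^esub> \<psi>"
    by (auto simp: r_coset_def Inn_def)
  then have "\<phi> x = g \<otimes> \<psi> x \<otimes> inv g" if "x \<in> carrier G" for x
    using that assms(2) conj_auto_mem[OF g(1)] auto_closed[OF assms(2) that]
    by (simp add: AutoGroup_simps compose_def conj_auto_def)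
  then show ?thesis using g by blast
qed

text \<open>Translates the claim about the iterated quotient into one about automorphisms, where
  elements can be computed with.\<close>

lemma torsion_free_out_filt_quot:
  assumes "\<And>\<phi> n. \<phi> \<in> aut_filt G c \<Longrightarrow> n > 0 \<Longrightarrow>
      to_Out G (\<phi> [^]\<^bsub>AutoGroup G\<^esub> (n::nat)) \<in> out_filt G (Suc c) \<Longrightarrow> to_Out G \<phi> \<in> out_filt G (Suc c)"
  shows "torsion_free (out_filt_quot G c)"
  unfolding torsion_free_def
proof (intro ballI allI impI)
  fix x and n :: nat
  interpret O: group "OutGroup G" by (rule group_OutGroup)
  let ?N = "out_filt G (Suc c)" and ?H = "OutGroup G\<lparr>carrier := out_filt G c\<rparr>"
  have sub: "?N \<subseteq> out_filt G c" using aut_filt_decseq by (auto simp: out_filt_def)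
  have HO: "subgroup (out_filt G c) (OutGroup G)" by (rule normal_imp_subgroup[OF out_filt_normal])
  interpret H: group ?H by (rule O.subgroup_imp_group[OF HO])
  have N: "?N \<lhd> ?H" using sub
    by (intro O.normal_restrict_supergroup out_filt_normal normal_imp_subgroup)
  interpret N: normal ?N ?H by (rule N)
  interpret q: group_hom ?H "?H Mod ?N" "\<lambda>y. ?N #>\<^bsub>?H\<^esub> y"
    unfolding group_hom_def group_hom_axioms_def
    using N.r_coset_hom_Mod N.factorgroup_is_group H.is_group by blast
  assume "x \<in> carrier (out_filt_quot G c)" and n: "n > 0" and xn: "x [^]\<^bsub>out_filt_quot G c\<^esub> n = \<one>\<^bsub>out_filt_quot G c\<^esub>"
  then obtain \<phi> where \<phi>: "\<phi> \<in> aut_filt G c" "x = ?N #>\<^bsub>?H\<^esub> to_Out G \<phi>"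
    by (auto simp: out_filt_quot_def carrier_FactGroup out_filt_def)
  have y: "to_Out G \<phi> \<in> carrier ?H" using \<phi> by (simp add: out_filt_def)
  have "?N #>\<^bsub>?H\<^esub> (to_Out G \<phi> [^]\<^bsub>?H\<^esub> n) = ?N"
    using xn q.hom_nat_pow[OF y, of n] \<phi>(2) by (simp add: out_filt_quot_def)
  then have "to_Out G \<phi> [^]\<^bsub>?H\<^esub> n \<in> ?N"
    using H.coset_join1 y N.subgroup_axioms H.nat_pow_closed by blast
  moreover have "to_Out G \<phi> [^]\<^bsub>?H\<^esub> n = to_Out G (\<phi> [^]\<^bsub>AutoGroup G\<^esub> n)"
    using group_hom.hom_nat_pow[OF to_Out_hom, of \<phi> n] \<phi>(1)
    by (simp add: aut_filt_iff AutoGroup_simps nat_pow_def)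
  ultimately have "to_Out G \<phi> \<in> ?N" using assms[OF \<phi>(1) n] by simp
  then show "x = \<one>\<^bsub>out_filt_quot G c\<^esub>"
    using H.coset_join2[OF y N.subgroup_axioms] \<phi>(2) by (simp add: out_filt_quot_def)
qed

end

section \<open>Roots in the filtration of outer automorphisms\<close>

context centreless_raag
begin

lemma out_filt_root:
  fixes n :: nat
  assumes c: "c \<ge> 1" and n: "n > 0" and \<phi>: "\<phi> \<in> aut_filt (raag \<Gamma>) c"
    and pow: "to_Out (raag \<Gamma>) (\<phi> [^]\<^bsub>AutoGroup (raag \<Gamma>)\<^esub> n) \<in> out_filt (raag \<Gamma>) (Suc c)"
  shows "to_Out (raag \<Gamma>) \<phi> \<in> out_filt (raag \<Gamma>) (Suc c)"
proof -
  let ?G = "raag \<Gamma>" and ?k = "Suc c"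
  interpret Q: group "Gr ?k" by (rule gr_group)
  interpret A: group "AutoGroup ?G" by (rule AutoGroup)
  have au: "\<phi> \<in> auto ?G" using \<phi> by (simp add: aut_filt_iff)
  obtain \<psi> where \<psi>: "\<psi> \<in> aut_filt ?G ?k" "to_Out ?G (\<phi> [^]\<^bsub>AutoGroup ?G\<^esub> n) = to_Out ?G \<psi>"
    using pow by (auto simp: out_filt_def)
  have au\<psi>: "\<psi> \<in> auto ?G" using \<psi> by (simp add: aut_filt_iff)
  have aun: "\<phi> [^]\<^bsub>AutoGroup ?G\<^esub> n \<in> auto ?G" using aut_filt_pow[OF \<phi>] by (simp add: aut_filt_iff)
  obtain g where g: "g \<in> carrier ?G"
    "\<And>x. x \<in> carrier ?G \<Longrightarrow> (\<phi> [^]\<^bsub>AutoGroup ?G\<^esub> n) x = g \<otimes>\<^bsub>?G\<^esub> \<psi> x \<otimes>\<^bsub>?G\<^esub> inv\<^bsub>?G\<^esub> g"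
    using to_Out_eqD[OF aun au\<psi> \<psi>(2)] by blast
  define t where "t v = \<phi> (gen v) \<otimes>\<^bsub>?G\<^esub> inv\<^bsub>?G\<^esub> gen v" for v
  have t: "t v \<in> \<gamma> ?k" "t v \<in> carrier ?G" if "v \<in> V" for v
  proof -
    show "t v \<in> \<gamma> ?k" using \<phi> that by (simp add: t_def aut_filt_iff)
    then show "t v \<in> carrier ?G" by (rule \<gamma>_carrier)
  qed
  \<comment> \<open>Two values for the \<open>n\<close>-th power of \<open>\<phi>\<close> at
    \<open>gen v\<close>: by \<open>gr_aut_pow\<close> it is \<open>t v\<close> to the power
    \<open>n\<close> times \<open>gen v\<close>, and as a conjugate by \<open>g\<close> it is
    \<open>gcomm g (gen v)\<close> times \<open>gen v\<close>.\<close>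
  have eq: "gr ?k (gcomm g (gen v)) = gr ?k (t v [^]\<^bsub>?G\<^esub> n)" if v: "v \<in> V" for v
  proof -
    have \<psi>v: "\<psi> (gen v) \<in> carrier ?G" "gr ?k (\<psi> (gen v)) = gr ?k (gen v)"
      using \<psi>(1) v au\<psi> by (auto simp: aut_filt_gr auto_closed)
    have "gr ?k (gcomm g (gen v) \<otimes>\<^bsub>?G\<^esub> gen v) = gr ?k (g \<otimes>\<^bsub>?G\<^esub> \<psi> (gen v) \<otimes>\<^bsub>?G\<^esub> inv\<^bsub>?G\<^esub> g)"
      using g(1) v \<psi>v by (simp flip: conj_gcomm)
    also have "\<dots> = gr ?k (t v [^]\<^bsub>?G\<^esub> n \<otimes>\<^bsub>?G\<^esub> gen v)"
      using gr_aut_pow[OF \<phi> c gen_closed[OF v], of n] g(2)[OF gen_closed[OF v]] by (simp add: t_def)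
    finally show ?thesis using g(1) v t(2)[OF v] by simp
  qed
  \<comment> \<open>The powers of \<open>t v\<close> lie in \<open>\<gamma> (Suc c)\<close>, hence
    so do these commutators; \<open>\<gamma>_of_gcomm\<close> then places \<open>g\<close> in
    \<open>\<gamma> c\<close>.\<close>
  have "gcomm g (gen v) \<in> \<gamma> (Suc c)" if v: "v \<in> V" for v
  proof (rule gr_mem[OF eq[OF v]])
    show "t v [^]\<^bsub>?G\<^esub> n \<in> \<gamma> (Suc c)" using t[OF v] by (induct n) (auto simp: \<gamma>_mult \<gamma>_one)
  qed (use g v in auto)
  then have "g \<in> \<gamma> c" using \<gamma>_of_gcomm[OF g(1), of c c] c by simp
  then obtain h where h: "h \<in> \<gamma> c" "\<And>v. v \<in> V \<Longrightarrow> gr ?k (t v) = gr ?k (gcomm h (gen v))"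
    using inner_root[OF c n _ t(1) eq] by blast
  have hc: "h \<in> carrier ?G" using h \<gamma>_carrier by auto
  \<comment> \<open>Both sides are homomorphisms to \<open>Gr ?k\<close>, and by the choice of
    \<open>h\<close> they agree on the generators.\<close>
  have conj: "gr ?k (\<phi> x) = gr ?k (h \<otimes>\<^bsub>?G\<^esub> x \<otimes>\<^bsub>?G\<^esub> inv\<^bsub>?G\<^esub> h)" if "x \<in> carrier ?G" for x
  proof -
    interpret p: group_hom ?G "Gr ?k" "\<lambda>x. gr ?k (\<phi> x)"
      by unfold_locales (auto simp: hom_def auto_closed[OF au] auto_mult[OF au])
    interpret q: group_hom ?G "Gr ?k" "\<lambda>x. gr ?k (h \<otimes>\<^bsub>?G\<^esub> x \<otimes>\<^bsub>?G\<^esub> inv\<^bsub>?G\<^esub> h)"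
      by unfold_locales (use hc in \<open>auto simp: hom_def Q.m_assoc\<close>)
    have G: "gr ?k (\<phi> (gen v)) = gr ?k (h \<otimes>\<^bsub>?G\<^esub> gen v \<otimes>\<^bsub>?G\<^esub> inv\<^bsub>?G\<^esub> h)" if v: "v \<in> V" for v
    proof -
      have "\<phi> (gen v) = t v \<otimes>\<^bsub>?G\<^esub> gen v"
        using v auto_closed[OF au] by (simp add: t_def m_assoc)
      then show ?thesis using h(2)[OF v] v hc t(2)[OF v] by (simp add: conj_gcomm)
    qed
    from that show ?thesis
    proof (induct rule: generated_induct)
      case one
      then show ?case using p.hom_one q.hom_one by simp
    next
      case (gen v)
      then show ?case by (rule G)
    next
      case (inv v)
      then show ?case using G[OF inv] p.hom_inv[of "gen v"] q.hom_inv[of "gen v"] gen_closed by simp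
    next
      case (mult x y)
      then show ?case using p.hom_mult[of x y] q.hom_mult[of x y] by simp
    qed
  qed
  \<comment> \<open>Undoing the conjugation by \<open>h\<close> keeps the outer class of
    \<open>\<phi>\<close> and moves it one step down the filtration.\<close>
  let ?\<chi> = "conj_auto ?G (inv\<^bsub>?G\<^esub> h) \<otimes>\<^bsub>AutoGroup ?G\<^esub> \<phi>"
  have cj: "conj_auto ?G (inv\<^bsub>?G\<^esub> h) \<in> carrier (AutoGroup ?G)"
    using conj_auto_mem hc by (simp add: AutoGroup_simps)
  have "?\<chi> \<in> aut_filt ?G ?k"
    unfolding aut_filt_gr
  proof (intro conjI ballI)
    show "?\<chi> \<in> auto ?G" using A.m_closed[OF cj] au by (simp add: AutoGroup_simps)
    fix x assume x: "x \<in> carrier ?G"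
    have px: "\<phi> x \<in> carrier ?G" using auto_closed[OF au x] .
    have "?\<chi> x = inv\<^bsub>?G\<^esub> h \<otimes>\<^bsub>?G\<^esub> \<phi> x \<otimes>\<^bsub>?G\<^esub> h"
      using cj au x px hc by (simp add: AutoGroup_simps compose_def conj_auto_def)
    then have "gr ?k (?\<chi> x) = gr ?k (inv\<^bsub>?G\<^esub> h) \<otimes>\<^bsub>Gr ?k\<^esub> gr ?k (h \<otimes>\<^bsub>?G\<^esub> x \<otimes>\<^bsub>?G\<^esub> inv\<^bsub>?G\<^esub> h) \<otimes>\<^bsub>Gr ?k\<^esub> gr ?k h"
      using px hc conj[OF x] by simp
    also have "\<dots> = gr ?k (inv\<^bsub>?G\<^esub> h \<otimes>\<^bsub>?G\<^esub> (h \<otimes>\<^bsub>?G\<^esub> x \<otimes>\<^bsub>?G\<^esub> inv\<^bsub>?G\<^esub> h) \<otimes>\<^bsub>?G\<^esub> h)"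
      using hc x by (simp only: gr_mult m_closed inv_closed)
    also have "\<dots> = gr ?k x" using hc x by (simp add: m_assoc)
    finally show "gr ?k (?\<chi> x) = gr ?k x" .
  qed
  moreover have "to_Out ?G ?\<chi> = to_Out ?G \<phi>"
  proof -
    interpret T: group_hom "AutoGroup ?G" "OutGroup ?G" "to_Out ?G" by (rule to_Out_hom)
    have p: "\<phi> \<in> carrier (AutoGroup ?G)" using au by (simp add: AutoGroup_simps)
    show ?thesis using T.hom_mult[OF cj p] to_Out_conj[of "inv\<^bsub>?G\<^esub> h"] hc T.hom_closed[OF p] by simp
  qed
  ultimately show ?thesis unfolding out_filt_def by (metis imageI)
qed

end

theorem theorem4p6:
  fixes \<Gamma> :: "('a, 'b) pre_digraph" and c :: nat
  assumes "graph \<Gamma>"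
    and "centre (raag \<Gamma>) = {\<one>\<^bsub>raag \<Gamma>\<^esub>}"
    and "c \<ge> 1"
  shows "torsion_free (out_filt_quot (raag \<Gamma>) c)"
proof -
  interpret centreless_raag \<Gamma> using assms(1,2)
    by (intro centreless_raag.intro raag_graph.intro centreless_raag_axioms.intro)
  show ?thesis using out_filt_root[OF assms(3)] by (intro torsion_free_out_filt_quot) blast
qed

end
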